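(* Let $p=2^{f_0}$ with $f_0\ge1$ and let $a\in\mathbb{F}_p$ be a nonzero element with $\mathrm{Tr}_{\mathbb{F}_p/\mathbb{F}_2}(a)=0$. There exists an $\mathbb{F}_2$-linearized polynomial $Q_a(x)\in\mathbb{F}_p[x]$ such that $$a^{-2}\sum_{i=1}^{f_0}(ax)^{2^i}=Q_a(x^2+ax).$$ Assume moreover that $f_0$ is odd. Then the smooth compactification of the affine curve defined by $z^2+z=xQ_a(x)$ is $\mathbb{F}_{p^4}$-maximal.
   Context: An $\mathbb{F}_2$-linearized polynomial is one of the form $\sum_i c_ix^{2^i}$. A smooth projective geometrically connected curve $C$ of genus $g$ over $\mathbb{F}_{p^4}$ is $\mathbb{F}_{p^4}$-maximal if $|C(\mathbb{F}_{p^4})|=p^4+1+2gp^2$. *)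

theory Defs
  imports
    "HOL-Algebra.Algebraic_Closure_Type"
    "HOL-Computational_Algebra.Computational_Algebra"
    "HOL-Library.Cardinality"
    "HOL-Library.Function_Algebras"
begin

definition is_subfield :: "'a::field set \<Rightarrow> bool" where
  "is_subfield F \<longleftrightarrow> 0 \<in> F \<and> 1 \<in> F \<and>
     (\<forall>u\<in>F. \<forall>v\<in>F. u + v \<in> F \<and> u * v \<in> F) \<and> (\<forall>u\<in>F. - u \<in> F \<and> inverse u \<in> F)"

definition F2_linearized :: "'a::comm_semiring_1 poly \<Rightarrow> bool" where
  "F2_linearized Q \<longleftrightarrow> (\<exists>n c. Q = (\<Sum>i<n. monom (c i) (2 ^ i)))"

text \<open>Trace from the field with \<open>2 ^ n\<close> elements to the field with two elements,
  as the sum of the Galois conjugates.\<close>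
definition trace_to_F2 :: "nat \<Rightarrow> 'a::field \<Rightarrow> 'a" where
  "trace_to_F2 n a = (\<Sum>i<n. a ^ (2 ^ i))"

definition is_Q_a :: "nat \<Rightarrow> 'a::field set \<Rightarrow> 'a \<Rightarrow> 'a poly \<Rightarrow> bool" where
  "is_Q_a f0 Fp a Q \<longleftrightarrow> F2_linearized Q \<and> set (coeffs Q) \<subseteq> Fp \<and>
     smult (inverse (a ^ 2)) (\<Sum>i=1..f0. [:0, a:] ^ (2 ^ i)) = pcompose Q [:0, a, 1:]"

text \<open>The polynomial \<open>z^2 + z - x * Q(x)\<close>.\<close>
definition artin_schreier_eq :: "'k::field poly \<Rightarrow> 'k poly poly" where
  "artin_schreier_eq Q = [:- ([:0, 1:] * Q), 1, 1:]"


text \<open>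
  Function fields of curves over a field \<open>k\<close> (the type \<open>'k\<close>) are realised as
  subfields \<open>K\<close> of one algebraically closed field, an algebraic closure of \<open>k(x)\<close>.

  A smooth projective curve over a perfect field \<open>k\<close> is given by its function field \<open>K\<close>,
  as an abstract nonsingular curve: its closed points are the valuation rings of \<open>K/k\<close>,
  a point being identified with its local ring, and the residue field of the point is the
  residue field of that ring.
\<close>

type_synonym 'k rat_closure = "'k poly fract alg_closure"

definition emb_poly :: "'k::field poly \<Rightarrow> 'k rat_closure" where
  "emb_poly q = to_ac (to_fract q)"

definition emb_const :: "'k::field \<Rightarrow> 'k rat_closure" where
  "emb_const c = emb_poly [:c:]"

text \<open>
  The function field of the plane affine curve \<open>F(x, z) = 0\<close>, where \<open>F\<close> is written as a
  polynomial in \<open>z\<close> with coefficients in \<open>k[x]\<close> and is irreducible of positive degree in \<open>z\<close>: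
  then \<open>k[x, z]/(F)\<close> is a domain and its fraction field is \<open>k(x, \<zeta>)\<close> for any root \<open>\<zeta>\<close> of
  \<open>F(x, z)\<close> in the algebraic closure of \<open>k(x)\<close>. Different roots give isomorphic fields.
  The smooth compactification of the affine curve is the smooth projective curve with this
  function field.
\<close>
definition curve_function_field :: "'k::field poly poly \<Rightarrow> 'k rat_closure set" where
  "curve_function_field F =
     (let \<zeta> = (SOME \<zeta>. poly (map_poly emb_poly F) \<zeta> = 0)
      in is_subfield hull (range emb_const \<union> {emb_poly [:0, 1:], \<zeta>}))"

definition closed_points :: "'k::field rat_closure set \<Rightarrow> 'k rat_closure set set" where
  "closed_points K = {R. range emb_const \<subseteq> R \<and> R \<subset> K \<and>
     (\<forall>u\<in>R. \<forall>v\<in>R. u + v \<in> R \<and> u * v \<in> R) \<and> (\<forall>u\<in>K. u \<in> R \<or> inverse u \<in> R)}"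

definition maximal_ideal_of :: "'a::field set \<Rightarrow> 'a set" where
  "maximal_ideal_of R = {u \<in> R. u = 0 \<or> inverse u \<notin> R}"

definition rational_points :: "'k::field rat_closure set \<Rightarrow> 'k rat_closure set set" where
  "rational_points K =
     {R \<in> closed_points K. \<forall>u\<in>R. \<exists>c. u - emb_const c \<in> maximal_ideal_of R}"

definition const_closure :: "'k::field rat_closure set" where
  "const_closure = {w. \<exists>q::'k poly. q \<noteq> 0 \<and> poly (map_poly emb_const q) w = 0}"

definition lin_indep_over :: "'a::field set \<Rightarrow> 'a set \<Rightarrow> bool" where
  "lin_indep_over E B \<longleftrightarrow>
     (\<forall>c. c ` B \<subseteq> E \<longrightarrow> (\<Sum>b\<in>B. c b * b) = 0 \<longrightarrow> (\<forall>b\<in>B. c b = 0))"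

text \<open>
  \<open>K\<close> is linearly disjoint over \<open>k\<close> from the algebraic closure \<open>k'\<close> of \<open>k\<close>, that is, the map from
  \<open>K \<otimes> k'\<close> to the ambient field is injective. This holds iff \<open>K \<otimes> k'\<close> is a field, which is then
  the function field of the base change of the curve to \<open>k'\<close>; that base change being regular, this
  says that it is connected.
\<close>
definition geometrically_connected :: "'k::field rat_closure set \<Rightarrow> bool" where
  "geometrically_connected K \<longleftrightarrow>
     (\<forall>B. finite B \<longrightarrow> B \<subseteq> K \<longrightarrow> lin_indep_over (range (emb_const :: 'k \<Rightarrow> _)) B \<longrightarrow>
        lin_indep_over const_closure B)"

text \<open>
  The \<open>k\<close>-derivations of \<open>K\<close>; the values outside \<open>K\<close> are irrelevant. They are the \<open>K\<close>-linear
  functionals on the module of Kaehler differentials of \<open>K/k\<close>. Since a vector space embeds into its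
  double dual, that module is the \<open>K\<close>-span of the maps \<open>db: D \<mapsto> D b\<close> on derivations. For a subring
  \<open>R\<close> of \<open>K\<close>, \<open>differentials K R\<close> is the image in it of the module of Kaehler differentials of \<open>R/k\<close>,
  i.e. the set of all sums of \<open>a db\<close> with \<open>a\<close> and \<open>b\<close> in \<open>R\<close>.
\<close>
definition derivations ::
  "'k::field rat_closure set \<Rightarrow> ('k rat_closure \<Rightarrow> 'k rat_closure) set" where
  "derivations K = {D. (\<forall>u\<in>K. D u \<in> K) \<and>
     (\<forall>u\<in>K. \<forall>v\<in>K. D (u + v) = D u + D v \<and> D (u * v) = u * D v + v * D u) \<and>
     (\<forall>c. D (emb_const c) = 0)}"

type_synonym 'k diff = "('k rat_closure \<Rightarrow> 'k rat_closure) \<Rightarrow> 'k rat_closure"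

definition differentials ::
  "'k::field rat_closure set \<Rightarrow> 'k rat_closure set \<Rightarrow> 'k diff set" where
  "differentials K R = {\<omega>. \<exists>S a. finite S \<and> S \<subseteq> R \<and> a ` S \<subseteq> R \<and>
     \<omega> = (\<lambda>D. if D \<in> derivations K then \<Sum>b\<in>S. a b * D b else 0)}"

definition regular_differentials :: "'k::field rat_closure set \<Rightarrow> 'k diff set" where
  "regular_differentials K =
     {\<omega> \<in> differentials K K. \<forall>R \<in> closed_points K. \<omega> \<in> differentials K R}"

definition scale_diff :: "'k::field \<Rightarrow> 'k diff \<Rightarrow> 'k diff" where
  "scale_diff c \<omega> = (\<lambda>D. emb_const c * \<omega> D)"

lemma emb_const_simps:
  "emb_const (c + d) = emb_const c + emb_const d"
  "emb_const (c * d) = emb_const c * emb_const d"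
  "emb_const 1 = 1"
proof -
  show "emb_const (c + d) = emb_const c + emb_const d"
    by (simp add: emb_const_def emb_poly_def flip: to_ac_add to_fract_add)
  show "emb_const (c * d) = emb_const c * emb_const d"
    by (simp add: emb_const_def emb_poly_def mult.commute flip: to_ac_mult to_fract_mult)
  show "emb_const 1 = 1"
    by (simp add: emb_const_def emb_poly_def flip: one_pCons)
qed

interpretation diffs: vector_space scale_diff
  by unfold_locales
    (auto simp: scale_diff_def emb_const_simps fun_eq_iff algebra_simps)

text \<open>The genus as the dimension of the space of regular differentials. A basis is asked for
  explicitly because \<open>diffs.dim\<close> is \<open>0\<close> on spaces without a finite basis.\<close>
definition has_genus :: "'k::field rat_closure set \<Rightarrow> nat \<Rightarrow> bool" where
  "has_genus K g \<longleftrightarrow>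
     (\<exists>B. finite B \<and> card B = g \<and> diffs.independent B \<and> diffs.span B = regular_differentials K)"

text \<open>Maximality over the field \<open>'k\<close> with \<open>p ^ 4\<close> elements.\<close>
definition maximal_curve :: "nat \<Rightarrow> 'k::{field,finite} rat_closure set \<Rightarrow> bool" where
  "maximal_curve p K \<longleftrightarrow> CARD('k) = p ^ 4 \<and> geometrically_connected K \<and>
     (\<exists>g. has_genus K g \<and> card (rational_points K) = p ^ 4 + 1 + 2 * g * p ^ 2)"

end

theory Submission
  imports Defs
begin

text \<open>
  The substitution \<open>x = y\<^sup>2 + a y\<close> turns the quadratic form \<open>Tr (x Q\<^sub>a(x))\<close> on the field with
  \<open>p ^ 4\<close> elements into \<open>Tr (y ^ (p + 1) + y\<^sup>2)\<close>. In terms of \<open>s = y + y ^ p\<^sup>2\<close>, and for odd \<open>f0\<close>,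
  this is the trace from \<open>F\<^sub>p\<close> of \<open>N(s + 1) + 1\<close>, where \<open>N\<close> is the norm from the field with \<open>p\<^sup>2\<close>
  elements; so its exponential sum is \<open>p ^ 3\<close>. The map \<open>y \<mapsto> y\<^sup>2 + a y\<close> is two-to-one onto a subgroup
  of index 2. On the other coset the sum vanishes, since translation by a suitable \<open>y\<^sup>2 + a y\<close> with
  \<open>y\<close> in the field with \<open>p\<^sup>2\<close> elements flips the sign. Hence there are \<open>p ^ 4 + p ^ 3 / 2\<close> affine points.

  The function field is \<open>K = k(x) + k(x) \<zeta>\<close> with \<open>\<zeta>\<^sup>2 + \<zeta> = f\<close> of odd degree \<open>2 g + 1\<close>. By parity of
  degrees the norm form \<open>A\<^sup>2 - A B - B\<^sup>2 f\<close> is anisotropic, also over the algebraic closure of \<open>k\<close>.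
  If \<open>A + B \<zeta>\<close> is not divisible by a prime \<open>P\<close> of \<open>k[x]\<close>, then it or its conjugate is a unit at a
  given place over \<open>P\<close>, so the valuation rings containing \<open>x\<close> are the localizations of \<open>k[x, \<zeta>]\<close>;
  there is exactly one that does not contain \<open>x\<close>. The derivation \<open>d/dx\<close> preserves the former, so the
  regular differentials are the \<open>q dx\<close> with \<open>degree q < g\<close>. Finally \<open>g = p / 4\<close> and
  \<open>p ^ 3 / 2 = 2 g p\<^sup>2\<close>.
\<close>

subsection \<open>Fields of characteristic 2\<close>

text \<open>The constants fit because comparing degrees in the identity that defines Q_a gives it
  degree p / 2, so x Q_a has degree 2 g + 1 with g = p / 4. A nonzero element of trace zero excludes
  f0 = 1; hence an odd f0 is at least 3 and g is even. That evenness makes the derivative of x^g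
  vanish, which is what makes the differentials at infinity computable. Oddness of f0 also enters as
  the trace of 1, which fixes the sign of the exponential sum. Closed points are bare valuation
  rings, with no order function attached, so orders of zeros and poles have to be expressed through
  degrees of polynomials. This works at infinity because the pole orders of A and B \<zeta> differ
  in parity and cannot cancel. Exact counts come from a squeeze between a root bound on each fibre
  and the total number of elements, so no preimages are constructed. For geometric connectedness,
  the finitely many algebraic constants of one relation lie in a finite field, the fixed points of a
  power of Frobenius, and over a finite field x is transcendental because it has infinitely many
  powers.\<close>

lemma two_eq_0_of_card:
  assumes "CARD('k::{field,finite}) = 2 ^ n"
  shows "(2::'k) = 0"
proof -
  \<comment> \<open>Translation by 1 permutes the terms of the sum of all elements, so the number of
    elements is zero in the field.\<close>
  have "(\<Sum>x\<in>(UNIV::'k set). x) = (\<Sum>x\<in>(UNIV::'k set). x + 1)"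
    by (rule sum.reindex_bij_witness[of _ "\<lambda>x. x + 1" "\<lambda>x. x - 1"]) auto
  then have "of_nat (2 ^ n) = (0::'k)"
    using assms by (simp add: sum.distrib)
  then show ?thesis by simp
qed

text \<open>Multiplication by \<open>a\<close> permutes the nonzero elements; cancelling their
  product shows that \<open>a\<close> to the number of them is 1.\<close>

lemma subfield_power_card:
  fixes F :: "'a::field set"
  assumes F: "is_subfield F" and fin: "finite F" and a: "a \<in> F"
  shows "a ^ card F = a"
proof (cases "a = 0")
  case True
  have "card F \<noteq> 0" using fin a by auto
  then show ?thesis using True by simp
next
  case False
  let ?G = "F - {0}"
  have mul: "a * v \<in> F" if "v \<in> F" for v
    using F a that by (simp add: is_subfield_def)
  have inj: "inj_on ((*) a) ?G"
    using False by (simp add: inj_on_def)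
  have "(*) a ` ?G = ?G"
  proof (rule endo_inj_surj)
    show "(*) a ` ?G \<subseteq> ?G" using False mul by fastforce
  qed (use fin inj in simp_all)
  then have "(\<Prod>x\<in>?G. x) = (\<Prod>x\<in>(*) a ` ?G. x)" by simp
  also have "\<dots> = (\<Prod>x\<in>?G. a * x)" using inj by (simp add: prod.reindex)
  also have "\<dots> = a ^ card ?G * (\<Prod>x\<in>?G. x)" by (simp add: prod.distrib)
  finally have "a ^ card ?G = 1" using fin by (simp add: prod_zero_iff)
  moreover have "card F = Suc (card ?G)"
    using F fin by (intro card.remove) (auto simp: is_subfield_def)
  ultimately show ?thesis by simp
qed

lemma finite_field_power_card: "(x::'k::{field,finite}) ^ CARD('k) = x"
  by (rule subfield_power_card) (auto simp: is_subfield_def)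

context
  assumes two: "(2::'a::idom) = 0"
begin

lemma add_self_char2: "x + x = (0::'a)"
  using two by (metis mult_2 mult_zero_left)

lemma minus_char2: "- x = (x::'a)"
  using add_self_char2[of x] by (simp add: eq_neg_iff_add_eq_0)

lemma diff_char2: "x - y = x + (y::'a)"
  using minus_char2[of y] by (metis diff_conv_add_uminus)

lemma sum_eq_0_char2: "x + y = 0 \<longleftrightarrow> x = (y::'a)"
  by (metis diff_char2 right_minus_eq)

lemma power2_add_char2: "((x::'a) + y)\<^sup>2 = x\<^sup>2 + y\<^sup>2"
  by (simp add: power2_sum two)

lemma power_2pow_add: "((x::'a) + y) ^ 2 ^ n = x ^ 2 ^ n + y ^ 2 ^ n"
proof (induction n)
  case (Suc n)
  have "(x + y) ^ 2 ^ Suc n = ((x + y) ^ 2 ^ n)\<^sup>2" by (simp add: power_mult [symmetric] mult.commute)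
  also have "\<dots> = (x ^ 2 ^ n)\<^sup>2 + (y ^ 2 ^ n)\<^sup>2" by (simp add: Suc power2_add_char2)
  finally show ?case by (simp add: power_mult [symmetric] mult.commute)
qed simp

lemma power_2pow_eq_iff: "(x::'a) ^ 2 ^ n = y ^ 2 ^ n \<longleftrightarrow> x = y"
proof
  assume "x ^ 2 ^ n = y ^ 2 ^ n"
  then have "(x + y) ^ 2 ^ n = 0" by (simp add: power_2pow_add add_self_char2)
  then show "x = y" by (simp add: sum_eq_0_char2)
qed simp

lemma power_2pow_sum: "(\<Sum>i\<in>A. f i :: 'a) ^ 2 ^ n = (\<Sum>i\<in>A. f i ^ 2 ^ n)"
  by (induction A rule: infinite_finite_induct) (auto simp: power_2pow_add zero_power)

end

lemma trace_to_F2_0 [simp]: "trace_to_F2 n 0 = 0"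
  by (simp add: trace_to_F2_def zero_power)

lemma trace_to_F2_1: "trace_to_F2 n 1 = of_nat n"
  by (simp add: trace_to_F2_def)

context
  assumes two: "(2::'a::field) = 0"
begin

lemma trace_to_F2_add: "trace_to_F2 n (x + y) = trace_to_F2 n x + trace_to_F2 n (y::'a)"
  by (simp add: trace_to_F2_def power_2pow_add[OF two] sum.distrib)

lemma trace_to_F2_sum: "trace_to_F2 n (\<Sum>i\<in>A. f i :: 'a) = (\<Sum>i\<in>A. trace_to_F2 n (f i))"
  by (induction A rule: infinite_finite_induct) (auto simp: trace_to_F2_add)

lemma trace_to_F2_power: "trace_to_F2 n (x ^ 2 ^ k) = trace_to_F2 n (x::'a) ^ 2 ^ k"
  by (simp add: trace_to_F2_def power_2pow_sum[OF two] power_mult [symmetric] mult.commute)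

text \<open>Squaring shifts the sum of conjugates by one place, and only the two end terms fail to
  cancel. It holds for every \<open>x\<close>: in \<open>Tr_xQ_L\<close> it is applied to elements
  outside the field with \<open>2 ^ n\<close> elements.\<close>

lemma trace_to_F2_squared: "(trace_to_F2 n (x::'a))\<^sup>2 = trace_to_F2 n x + x ^ 2 ^ n + x"
proof (induction n)
  case 0
  show ?case using add_self_char2[OF two, of x] by (simp add: trace_to_F2_def)
next
  case (Suc n)
  have S: "trace_to_F2 (Suc n) x = trace_to_F2 n x + x ^ 2 ^ n" by (simp add: trace_to_F2_def)
  have "(trace_to_F2 (Suc n) x)\<^sup>2 = (trace_to_F2 n x)\<^sup>2 + (x ^ 2 ^ n)\<^sup>2"
    by (simp add: S power2_add_char2[OF two])
  then show ?case by (simp add: S Suc power_mult [symmetric] mult.commute algebra_simps)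
qed

lemma trace_to_F2_cases:
  assumes "(x::'a) ^ 2 ^ n = x"
  shows "trace_to_F2 n x = 0 \<or> trace_to_F2 n x = 1"
proof -
  have "trace_to_F2 n x * (trace_to_F2 n x - 1) = 0"
    using trace_to_F2_squared[of n x] assms add_self_char2[OF two, of x]
    by (simp add: power2_eq_square algebra_simps)
  then show ?thesis by simp
qed

lemma trace_to_F2_fixed_power:
  assumes "(x::'a) ^ 2 ^ n = x"
  shows "trace_to_F2 n (x ^ 2 ^ k) = trace_to_F2 n x"
  using trace_to_F2_cases[OF assms] by (auto simp: trace_to_F2_power zero_power)

end

section \<open>Counting roots of linearized polynomials and points in fibres\<close>

lemma card_roots_linearized:
  fixes c :: "nat \<Rightarrow> 'a::field"
  assumes "c m \<noteq> 0"
  shows "finite {x. (\<Sum>i\<le>m. c i * x ^ 2 ^ i) = 0}"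
    and "card {x. (\<Sum>i\<le>m. c i * x ^ 2 ^ i) = 0} \<le> 2 ^ m"
proof -
  let ?P = "\<Sum>i\<le>m. monom (c i) (2 ^ i)"
  have eq: "{x. (\<Sum>i\<le>m. c i * x ^ 2 ^ i) = 0} = {x. poly ?P x = 0}"
    by (simp add: poly_sum poly_monom)
  have "coeff ?P (2 ^ m) = (\<Sum>i\<le>m. if i = m then c i else 0)"
    by (simp add: coeff_sum)
  then have "coeff ?P (2 ^ m) = c m" by simp
  then have nz: "?P \<noteq> 0" using assms by (metis coeff_0)
  have "degree ?P \<le> 2 ^ m"
    by (rule degree_sum_le) (auto intro: order.trans[OF degree_monom_le] power_increasing)
  then show "finite {x. (\<Sum>i\<le>m. c i * x ^ 2 ^ i) = 0}"
    and "card {x. (\<Sum>i\<le>m. c i * x ^ 2 ^ i) = 0} \<le> 2 ^ m"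
    unfolding eq using poly_roots_finite[OF nz] card_poly_roots_bound[OF nz] by auto
qed

lemma card_trace_zero_le:
  assumes "n \<ge> 1"
  shows "finite {x::'a::field. trace_to_F2 n x = 0}"
    and "card {x::'a. trace_to_F2 n x = 0} \<le> 2 ^ (n - 1)"
proof -
  have "{..<n} = {..n - 1}" using assms by auto
  then have "trace_to_F2 n x = (\<Sum>i\<le>n - 1. 1 * x ^ 2 ^ i)" for x :: 'a
    by (simp add: trace_to_F2_def)
  then show "finite {x::'a. trace_to_F2 n x = 0}"
    and "card {x::'a. trace_to_F2 n x = 0} \<le> 2 ^ (n - 1)"
    using card_roots_linearized[of "\<lambda>_. 1::'a" "n - 1"] by auto
qed

lemma card_fixed_power_le:
  assumes "n \<ge> 1"
  shows "finite {x::'a::field. x ^ 2 ^ n = x}" and "card {x::'a. x ^ 2 ^ n = x} \<le> 2 ^ n"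
proof -
  define c :: "nat \<Rightarrow> 'a" where "c i = (if i = n then 1 else if i = 0 then -1 else 0)" for i
  have "(\<Sum>i\<le>n. c i * x ^ 2 ^ i) = x ^ 2 ^ n - x" for x :: 'a
  proof -
    have "(\<Sum>i\<le>n. c i * x ^ 2 ^ i) = (\<Sum>i\<in>{0, n}. c i * x ^ 2 ^ i)"
      by (rule sum.mono_neutral_right) (auto simp: c_def)
    then show ?thesis using assms by (simp add: c_def)
  qed
  then have "{x::'a. x ^ 2 ^ n = x} = {x. (\<Sum>i\<le>n. c i * x ^ 2 ^ i) = 0}" by auto
  moreover have "c n \<noteq> 0" by (simp add: c_def)
  ultimately show "finite {x::'a. x ^ 2 ^ n = x}" and "card {x::'a. x ^ 2 ^ n = x} \<le> 2 ^ n"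
    using card_roots_linearized[of c n] by simp_all
qed

lemma sum_fibres:
  fixes G :: "'b \<Rightarrow> int"
  assumes "finite A" "h ` A \<subseteq> B" "finite B" and "\<And>y. y \<in> B \<Longrightarrow> card {x\<in>A. h x = y} = m"
  shows "(\<Sum>x\<in>A. G (h x)) = int m * (\<Sum>y\<in>B. G y)"
proof -
  have "(\<Sum>x\<in>A. G (h x)) = (\<Sum>y\<in>B. \<Sum>x\<in>{x\<in>A. h x = y}. G (h x))"
    by (rule sum.group[symmetric]) (use assms in auto)
  also have "\<dots> = (\<Sum>y\<in>B. int m * G y)"
    by (rule sum.cong) (use assms in auto)
  finally show ?thesis by (simp add: sum_distrib_left)
qed

text \<open>Pigeonhole: if no fibre exceeds \<open>m\<close> and there are enough points to fill all
  of them, then every fibre is full. This turns root bounds into exact counts and gives surjectivity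
  of traces and norms for free.\<close>

lemma fibres_card_eq:
  assumes "finite A" "h ` A \<subseteq> B" "finite B"
    and le: "\<And>y. y \<in> B \<Longrightarrow> card {x\<in>A. h x = y} \<le> m" and card: "m * card B \<le> card A"
    and y: "y \<in> B"
  shows "card {x\<in>A. h x = y} = m"
proof (rule ccontr)
  assume "card {x\<in>A. h x = y} \<noteq> m"
  with le y have lt: "card {x\<in>A. h x = y} < m" by (meson le_neq_implies_less)
  have "card A = (\<Sum>x\<in>A. 1)" by simp
  also have "\<dots> = (\<Sum>y\<in>B. \<Sum>x\<in>{x\<in>A. h x = y}. 1)"
    by (rule sum.group[symmetric]) (use assms in auto)
  also have "\<dots> = (\<Sum>y\<in>B. card {x\<in>A. h x = y})" by simp
  also have "\<dots> < (\<Sum>y\<in>B. m)"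
    by (rule sum_strict_mono_ex1) (use assms lt in auto)
  finally show False using card by (simp add: mult.commute)
qed

subsection \<open>The exponential sum\<close>

lemma card_additive_fibre_le:
  fixes h :: "'a::ab_group_add \<Rightarrow> 'b::ab_group_add"
  assumes add: "\<And>x y. h (x + y) = h x + h y" and fin: "finite {x. h x = 0}"
  shows "card {x. h x = y} \<le> card {x. h x = 0}"
proof (cases "\<exists>x0. h x0 = y")
  case True
  then obtain x0 where x0: "h x0 = y" by blast
  have "h (x - x0) = 0" if "h x = y" for x
    using add[of "x - x0" x0] that x0 by simp
  then have "(\<lambda>x. x - x0) ` {x. h x = y} \<subseteq> {x. h x = 0}" by auto
  then have "card ((\<lambda>x. x - x0) ` {x. h x = y}) \<le> card {x. h x = 0}"
    by (rule card_mono[OF fin])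
  then show ?thesis by (simp add: card_image)
next
  case False
  then have "{x. h x = y} = {}" by blast
  then show ?thesis by simp
qed

lemma trace_to_F2_plus: "trace_to_F2 (m + n) x = trace_to_F2 m x + trace_to_F2 n (x ^ 2 ^ m)"
proof -
  have "(\<Sum>i<m + n. x ^ 2 ^ i) = (\<Sum>i<m. x ^ 2 ^ i) + (\<Sum>i<n. x ^ 2 ^ (m + i))"
    by (induction n) (auto simp: add.assoc)
  then show ?thesis
    by (simp add: trace_to_F2_def power_add power_mult)
qed

text \<open>The additive character (-1)^Tr with integer values, meant for arguments whose trace is 0
  or 1.\<close>

definition trace_sign :: "nat \<Rightarrow> 'a::field \<Rightarrow> int" where
  "trace_sign n x = (if trace_to_F2 n x = 0 then 1 else -1)"

text \<open>Orthogonality of the character. The elements of trace 0 are at most half by the root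
  bound, those of trace 1 are no more numerous because they form a translate of the kernel, so both
  bounds are attained. \<open>F\<close> may sit inside a larger field, as F_p does here.\<close>

lemma sum_trace_sign:
  fixes F :: "'a::field set"
  assumes two: "(2::'a) = 0" and "n \<ge> 1" and F: "\<And>x. x \<in> F \<Longrightarrow> x ^ 2 ^ n = x"
    and card: "card F = 2 ^ n"
  shows "(\<Sum>x\<in>F. trace_sign n x) = 0"
proof -
  have fin: "finite F" by (rule card_ge_0_finite) (simp add: card)
  let ?Z = "{x\<in>F. trace_to_F2 n x = 0}" and ?O = "{x\<in>F. trace_to_F2 n x = 1}"
  have "card ?Z \<le> card {x::'a. trace_to_F2 n x = 0}"
    by (rule card_mono) (use card_trace_zero_le[OF \<open>n \<ge> 1\<close>] in auto)
  then have Z: "card ?Z \<le> 2 ^ (n - 1)"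
    using card_trace_zero_le(2)[OF \<open>n \<ge> 1\<close>, where ?'a='a] by simp
  have finO: "finite {x::'a. trace_to_F2 n x = 1}"
  proof (rule finite_subset)
    show "{x::'a. trace_to_F2 n x = 1} \<subseteq> {x. x ^ 2 ^ n = x}"
    proof (rule subsetI, rule CollectI)
      fix x :: 'a assume "x \<in> {x. trace_to_F2 n x = 1}"
      then have "x ^ 2 ^ n + x = 0" using trace_to_F2_squared[OF two, of n x] by (simp add: add.assoc)
      then show "x ^ 2 ^ n = x" by (simp add: sum_eq_0_char2[OF two])
    qed
  qed (rule card_fixed_power_le[OF \<open>n \<ge> 1\<close>])
  have "card ?O \<le> card {x::'a. trace_to_F2 n x = 1}"
    by (rule card_mono[OF finO]) auto
  also have "\<dots> \<le> card {x::'a. trace_to_F2 n x = 0}"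
    by (rule card_additive_fibre_le) (use trace_to_F2_add[OF two] card_trace_zero_le[OF \<open>n \<ge> 1\<close>] in auto)
  finally have O: "card ?O \<le> 2 ^ (n - 1)"
    using card_trace_zero_le(2)[OF \<open>n \<ge> 1\<close>, where ?'a='a] by simp
  have FU: "F = ?Z \<union> ?O" using F trace_to_F2_cases[OF two, of _ n] by blast
  have "card F = card ?Z + card ?O"
    by (subst FU, rule card_Un_disjoint) (use fin in auto)
  then have "card ?Z + card ?O = 2 * 2 ^ (n - 1)"
    using card \<open>n \<ge> 1\<close> by (simp flip: power_Suc)
  with Z O have eq: "card ?Z = card ?O" by linarith
  have "(\<Sum>x\<in>F. trace_sign n x) = (\<Sum>x\<in>?Z. trace_sign n x) + (\<Sum>x\<in>?O. trace_sign n x)"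
    by (subst FU, rule sum.union_disjoint) (use fin in auto)
  also have "(\<Sum>x\<in>?Z. trace_sign n x) = (\<Sum>x\<in>?Z. 1)" by (rule sum.cong) (auto simp: trace_sign_def)
  also have "(\<Sum>x\<in>?O. trace_sign n x) = (\<Sum>x\<in>?O. -1)" by (rule sum.cong) (auto simp: trace_sign_def)
  finally show ?thesis using eq by simp
qed

text \<open>The coefficients in \<open>F2_linearized\<close> are existentially quantified and may
  carry zeros beyond the degree; this rewrites \<open>Q\<close> through its own coefficients up to a
  chosen bound.\<close>

lemma F2_linearized_eval:
  fixes Q :: "'a::field poly"
  assumes "F2_linearized Q" and "degree Q \<le> 2 ^ h"
  shows "poly Q x = (\<Sum>i\<le>h. coeff Q (2 ^ i) * x ^ 2 ^ i)"
proof -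
  obtain n c where Q: "Q = (\<Sum>i<n. monom (c i) (2 ^ i))" using assms unfolding F2_linearized_def by blast
  have co: "coeff Q (2 ^ i) = (if i < n then c i else 0)" for i
  proof -
    have "coeff Q (2 ^ i) = (\<Sum>j<n. if j = i then c j else 0)"
      unfolding Q coeff_sum by (rule sum.cong) auto
    then show ?thesis by simp
  qed
  have "poly Q x = (\<Sum>i<n. coeff Q (2 ^ i) * x ^ 2 ^ i)"
    unfolding co by (simp add: Q poly_sum poly_monom)
  also have "\<dots> = (\<Sum>i\<in>{..<n} \<union> {..h}. coeff Q (2 ^ i) * x ^ 2 ^ i)"
    by (rule sum.mono_neutral_left) (auto simp: co)
  also have "\<dots> = (\<Sum>i\<le>h. coeff Q (2 ^ i) * x ^ 2 ^ i)"
  proof (rule sum.mono_neutral_right)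
    have "coeff Q (2 ^ i) = 0" if "i > h" for i
      by (rule coeff_eq_0, rule le_less_trans[OF assms(2)]) (use that in simp)
    then show "\<forall>i\<in>{..<n} \<union> {..h} - {..h}. coeff Q (2 ^ i) * x ^ 2 ^ i = 0" by auto
  qed auto
  finally show ?thesis .
qed

lemma F2_linearized_add:
  fixes Q :: "'a::field poly"
  assumes "F2_linearized Q" and two: "(2::'a) = 0"
  shows "poly Q (x + y) = poly Q x + poly Q y"
proof -
  obtain n c where Q: "Q = (\<Sum>i<n. monom (c i) (2 ^ i))" using assms unfolding F2_linearized_def by blast
  show ?thesis
    by (simp add: Q poly_sum poly_monom power_2pow_add[OF two] algebra_simps sum.distrib)
qed

section \<open>The tower of fields with p, p^2 and p^4 elements, and the form in y\<close>

locale trace_zero_setting =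
  fixes f0 p :: nat and Fp :: "'k::{field,finite} set" and a :: 'k
  assumes f0: "f0 \<ge> 1" and p: "p = 2 ^ f0"
    and card_k: "CARD('k) = p ^ 4"
    and Fp: "is_subfield Fp" and card_Fp: "card Fp = p"
    and a: "a \<in> Fp" "a \<noteq> 0" and tr_a: "trace_to_F2 f0 a = 0"
begin

lemma card_k': "CARD('k) = 2 ^ (4 * f0)"
  by (simp add: card_k p power_mult [symmetric] mult.commute)

lemma two: "(2::'k) = 0"
  by (rule two_eq_0_of_card[OF card_k'])

lemma dbl: "x + x = (0::'k)"
  by (rule add_self_char2[OF two])

lemma dbl2: "x + (x + y) = (y::'k)"
  by (simp add: dbl add.assoc[symmetric])

abbreviation fr :: "'k \<Rightarrow> 'k" where "fr x \<equiv> x ^ p"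

lemma fr_add: "fr (x + y) = fr x + fr y"
  unfolding p by (rule power_2pow_add[OF two])

lemma fr_mult: "fr (x * y) = fr x * fr y"
  by (rule power_mult_distrib)

lemma fr_2: "fr (fr x) = x ^ 2 ^ (2 * f0)"
  by (simp only: p power_mult [symmetric] power_add [symmetric] mult_2)

lemma frob: "(x::'k) ^ 2 ^ (4 * f0) = x"
  using finite_field_power_card[of x] by (simp add: card_k')

lemma fr_4: "fr (fr (fr (fr x))) = x"
proof -
  have "fr (fr (fr (fr x))) = x ^ p ^ 4"
    by (simp only: power_mult [symmetric] power4_eq_xxxx mult.assoc)
  then show ?thesis by (simp add: finite_field_power_card flip: card_k)
qed

lemma Fp_eq: "Fp = {x. fr x = x}"
proof (rule card_subset_eq)
  show "Fp \<subseteq> {x. fr x = x}" using subfield_power_card[OF Fp] card_Fp by auto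
  then have "card Fp \<le> card {x::'k. fr x = x}" by (intro card_mono) auto
  then show "card Fp = card {x. fr x = x}"
    using card_fixed_power_le(2)[OF f0, where ?'a='k] by (simp add: card_Fp p)
qed auto

lemma fr_a: "fr a = a"
  using a Fp_eq by auto

definition Fp2 :: "'k set" where "Fp2 = {x. fr (fr x) = x}"

abbreviation Tr :: "'k \<Rightarrow> 'k" where "Tr x \<equiv> trace_to_F2 (4 * f0) x"

lemma Tr_cases: "Tr x = 0 \<or> Tr x = 1"
  by (rule trace_to_F2_cases[OF two frob])

lemma Tr_add: "Tr (x + y) = Tr x + Tr y"
  by (rule trace_to_F2_add[OF two])

lemma Tr_power: "Tr (x ^ 2 ^ k) = Tr x"
  by (rule trace_to_F2_fixed_power[OF two frob])

lemma Tr_square: "Tr (x\<^sup>2) = Tr x"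
  using Tr_power[of x 1] by simp

lemma Tr_fr: "Tr (fr x) = Tr x"
  using Tr_power[of x f0] by (simp add: p)

lemma Tr_tower: "Tr x = trace_to_F2 f0 (x + fr x + fr (fr x) + fr (fr (fr x)))"
proof -
  have "4 * f0 = f0 + (f0 + (f0 + f0))" by simp
  then have "Tr x = trace_to_F2 (f0 + (f0 + (f0 + f0))) x" by (rule arg_cong)
  also have "\<dots> = trace_to_F2 f0 x + (trace_to_F2 f0 (fr x) +
      (trace_to_F2 f0 (fr (fr x)) + trace_to_F2 f0 (fr (fr (fr x)))))"
    by (simp only: trace_to_F2_plus p)
  finally show ?thesis by (simp only: trace_to_F2_add[OF two] add.assoc)
qed

lemma fr_0: "fr 0 = 0"
  by (simp add: p)

text \<open>The additive map y + y^(p^2) has kernel \<open>Fp2\<close> and image inside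
  \<open>Fp2\<close>, a root set of at most p^2 elements. Distributing p^4 elements over at most p^2
  values with fibres of at most p^2 elements leaves no slack, and the fibre over 0 then gives the
  size of \<open>Fp2\<close>.\<close>

lemma card_Fp2_fibre: "y \<in> Fp2 \<Longrightarrow> card {x\<in>UNIV. x + fr (fr x) = y} = p\<^sup>2"
  and card_Fp2: "card Fp2 = p\<^sup>2"
proof -
  have pp: "p\<^sup>2 = 2 ^ (2 * f0)" by (simp add: p power_mult [symmetric] mult.commute)
  have ker: "{x. x + fr (fr x) = 0} = Fp2"
    unfolding Fp2_def using sum_eq_0_char2[OF two] by metis
  have le: "card Fp2 \<le> p\<^sup>2"
    using card_fixed_power_le(2)[of "2 * f0", where ?'a='k] f0 by (simp add: Fp2_def fr_2 pp)
  have fib: "card {x\<in>UNIV. x + fr (fr x) = y} \<le> p\<^sup>2" for y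
    using card_additive_fibre_le[of "\<lambda>x. x + fr (fr x)" y] le
    by (simp add: ker fr_add algebra_simps)
  have tot: "p\<^sup>2 * card Fp2 \<le> card (UNIV :: 'k set)"
    using le by (simp add: card_k power2_eq_square power4_eq_xxxx mult_mono mult.assoc)
  have img: "range (\<lambda>x. x + fr (fr x)) \<subseteq> Fp2"
    by (auto simp: Fp2_def fr_add fr_4 add.commute)
  have all: "card {x\<in>UNIV. x + fr (fr x) = y} = p\<^sup>2" if "y \<in> Fp2" for y
    by (rule fibres_card_eq[OF _ img _ _ tot that]) (use fib in auto)
  then show "y \<in> Fp2 \<Longrightarrow> card {x\<in>UNIV. x + fr (fr x) = y} = p\<^sup>2" .
  have "(0::'k) \<in> Fp2" by (simp add: Fp2_def fr_0)
  with all[of 0] show "card Fp2 = p\<^sup>2" by (simp add: ker)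
qed

text \<open>The norm is s^(p+1), so a nonzero value is taken at most p + 1 times; as p^2 - 1 = (p +
  1) (p - 1), exactly that often. By orthogonality the nonzero norms contribute -(p + 1), and s = 0
  contributes 1.\<close>

lemma sum_norm_sign: "(\<Sum>s\<in>Fp2. trace_sign f0 (s * fr s)) = - int p"
proof -
  let ?h = "\<lambda>s::'k. s * fr s"
  have fib: "card {s\<in>Fp2 - {0}. ?h s = n} \<le> p + 1" for n
  proof -
    let ?P = "monom 1 (p + 1) - [:n:]"
    have "coeff ?P (p + 1) = 1" by (simp add: coeff_pCons)
    then have nz: "?P \<noteq> 0" by (metis coeff_0 zero_neq_one)
    have "degree ?P \<le> p + 1" by (rule degree_diff_le) (auto simp: degree_monom_le)
    then have "card {s. poly ?P s = 0} \<le> p + 1" using card_poly_roots_bound[OF nz] by linarith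
    moreover have "card {s\<in>Fp2 - {0}. ?h s = n} \<le> card {s. poly ?P s = 0}"
      by (rule card_mono) (auto simp: poly_monom)
    ultimately show ?thesis by linarith
  qed
  have z: "0 \<in> Fp" "0 \<in> Fp2" using Fp by (auto simp: is_subfield_def Fp2_def fr_0)
  have img: "?h ` (Fp2 - {0}) \<subseteq> Fp - {0}"
    by (auto simp: Fp2_def Fp_eq fr_mult mult.commute)
  have cards: "card (Fp - {0}) = p - 1" "card (Fp2 - {0}) = p\<^sup>2 - 1"
    using z by (auto simp: card_Fp card_Fp2)
  have tot: "(p + 1) * card (Fp - {0}) \<le> card (Fp2 - {0})"
    by (simp add: cards power2_eq_square algebra_simps)
  have "(\<Sum>s\<in>Fp2 - {0}. trace_sign f0 (?h s)) = int (p + 1) * (\<Sum>n\<in>Fp - {0}. trace_sign f0 n)"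
    by (rule sum_fibres[OF _ img])
      (use fibres_card_eq[OF _ img _ fib tot] in auto)
  also have "(\<Sum>n\<in>Fp - {0}. trace_sign f0 n) = -1"
  proof -
    have "(\<Sum>n\<in>Fp. trace_sign f0 n) = 0"
      by (rule sum_trace_sign[OF two f0]) (use Fp_eq card_Fp p in auto)
    then show ?thesis using z sum.remove[of Fp 0 "trace_sign f0"] by (simp add: trace_sign_def)
  qed
  finally show ?thesis using z sum.remove[of Fp2 0 "\<lambda>s. trace_sign f0 (?h s)"]
    by (simp add: trace_sign_def)
qed

text \<open>The four conjugates of y^(p+1) add up to (y + y^(p^2)) (y^p + y^(p^3)) = s s^p, and
  those of y^2 to (s + s^p)^2, which has the same trace as s + s^p. The norm of s + 1 is s s^p + s +
  s^p + 1, so only a constant has to be corrected.\<close>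

lemma Tr_form:
  assumes "odd f0"
  shows "Tr (y * fr y + y\<^sup>2) =
    trace_to_F2 f0 ((y + fr (fr y) + 1) * fr (y + fr (fr y) + 1)) + 1"
proof -
  define s where "s = y + fr (fr y)"
  have frs: "fr s = fr y + fr (fr (fr y))" by (simp add: s_def fr_add)
  have frs2: "fr (fr s) = s" by (simp add: frs fr_add fr_4 s_def add.commute)
  have fr_sq: "fr (x\<^sup>2) = (fr x)\<^sup>2" for x by (simp add: power_mult [symmetric] mult.commute)
  have "y * fr y + y\<^sup>2 + fr (y * fr y + y\<^sup>2) + fr (fr (y * fr y + y\<^sup>2)) + fr (fr (fr (y * fr y + y\<^sup>2)))
      = s * fr s + (s + fr s)\<^sup>2"
    unfolding frs s_def
    by (simp add: fr_add fr_mult fr_sq fr_4 power2_add_char2[OF two] algebra_simps del: power_mult_distrib)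
  then have "Tr (y * fr y + y\<^sup>2) = trace_to_F2 f0 (s * fr s) + trace_to_F2 f0 ((s + fr s)\<^sup>2)"
    by (simp only: Tr_tower trace_to_F2_add[OF two, symmetric])
  also have "trace_to_F2 f0 ((s + fr s)\<^sup>2) = trace_to_F2 f0 (s + fr s)"
    using trace_to_F2_fixed_power[OF two, of "s + fr s" f0 1] frs2
    by (simp add: p[symmetric] fr_add add.commute power2_eq_square)
  finally have 1: "Tr (y * fr y + y\<^sup>2) = trace_to_F2 f0 (s * fr s) + trace_to_F2 f0 (s + fr s)" .
  \<comment> \<open>The correction term: the trace of 1 is f0 modulo 2.\<close>
  have "trace_to_F2 f0 (1::'k) = 1"
  proof -
    obtain m where "f0 = 2 * m + 1" using assms by (elim oddE)
    then show ?thesis by (simp add: trace_to_F2_1 two)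
  qed
  moreover have "(s + 1) * fr (s + 1) = s * fr s + (s + fr s) + 1"
    by (simp add: fr_add algebra_simps)
  ultimately have "trace_to_F2 f0 ((s + 1) * fr (s + 1)) + 1
      = trace_to_F2 f0 (s * fr s) + trace_to_F2 f0 (s + fr s) + (1 + 1)"
    by (simp add: trace_to_F2_add[OF two] add.assoc)
  then show ?thesis using 1 two by (simp add: s_def)
qed

text \<open>The summand depends only on s = y + y^(p^2), which takes each value in
  \<open>Fp2\<close> exactly p^2 times. The constant 1 in \<open>Tr_form\<close> turns the norm sum
  -p into p.\<close>

lemma sum_Tr_form:
  assumes "odd f0"
  shows "(\<Sum>y\<in>UNIV. trace_sign (4 * f0) (y * fr y + y\<^sup>2)) = int (p ^ 3)"
proof -
  have s1: "s + 1 \<in> Fp2 \<longleftrightarrow> s \<in> Fp2" for s by (simp add: Fp2_def fr_add)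
  have fx: "(s * fr s) ^ 2 ^ f0 = s * fr s" if "s \<in> Fp2" for s
    using that by (simp add: p[symmetric] Fp2_def fr_mult mult.commute)
  have sgn: "trace_sign (4 * f0) (y * fr y + y\<^sup>2) =
      - trace_sign f0 ((y + fr (fr y) + 1) * fr (y + fr (fr y) + 1))" for y
  proof -
    have "y + fr (fr y) + 1 \<in> Fp2" by (simp add: s1) (simp add: Fp2_def fr_add fr_4 add.commute)
    from trace_to_F2_cases[OF two fx[OF this]] show ?thesis
      using Tr_form[OF assms, of y] two by (auto simp: trace_sign_def)
  qed
  have "(\<Sum>y\<in>UNIV. trace_sign (4 * f0) (y * fr y + y\<^sup>2)) =
      (\<Sum>y\<in>UNIV. (\<lambda>s. - trace_sign f0 ((s + 1) * fr (s + 1))) (y + fr (fr y)))"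
    by (simp add: sgn)
  also have "\<dots> = int (p\<^sup>2) * (\<Sum>s\<in>Fp2. - trace_sign f0 ((s + 1) * fr (s + 1)))"
    by (rule sum_fibres) (use card_Fp2_fibre in \<open>auto simp: Fp2_def fr_add fr_4 add.commute\<close>)
  also have "(\<Sum>s\<in>Fp2. - trace_sign f0 ((s + 1) * fr (s + 1))) = (\<Sum>s\<in>Fp2. - trace_sign f0 (s * fr s))"
    by (rule sum.reindex_bij_witness[of _ "\<lambda>s. s + 1" "\<lambda>s. s + 1"])
      (auto simp: s1 add.assoc two)
  also have "\<dots> = int p" by (simp add: sum_negf sum_norm_sign)
  finally show ?thesis by (simp add: power2_eq_square power3_eq_cube)
qed

end

section \<open>The substitution \<open>x = y\<^sup>2 + a y\<close> and the polynomial Q_a\<close>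

lemma linear_monom_power: "[:0, b:] ^ n = monom (b ^ n) n"
  by (induction n) (simp_all add: monom_Suc monom_0 smult_monom)

lemma pcompose_monom: "pcompose (monom b n) q = smult b (q ^ n)"
  by (induction n) (simp_all add: monom_Suc monom_0 pcompose_pCons)

context trace_zero_setting
begin

definition L :: "'k \<Rightarrow> 'k" where "L y = y\<^sup>2 + a * y"

lemma L_add: "L (x + y) = L x + L y"
  by (simp add: L_def power2_add_char2[OF two] algebra_simps)

text \<open>For \<open>f0 = 1\<close> the trace of \<open>a\<close> is \<open>a\<close> itself,
  which is nonzero.\<close>

lemma f0_ge_2: "f0 \<ge> 2"
proof (rule ccontr)
  assume "\<not> f0 \<ge> 2"
  then have "f0 = 1" using f0 by simp
  then show False using tr_a a by (simp add: trace_to_F2_def)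
qed

lemma L_eq_iff: "L y = L z \<longleftrightarrow> y = z \<or> y = z + a"
proof -
  have "L y = L z \<longleftrightarrow> L (y + z) = 0"
    by (simp add: L_add sum_eq_0_char2[OF two])
  also have "\<dots> \<longleftrightarrow> (y + z) * (y + z + a) = 0"
    by (simp add: L_def power2_eq_square algebra_simps)
  also have "\<dots> \<longleftrightarrow> y = z \<or> y = z + a"
    by (simp add: sum_eq_0_char2[OF two] add.assoc)
  finally show ?thesis .
qed

lemma L_fibre: "x \<in> range L \<Longrightarrow> card {y\<in>A. L y = x} \<le> 2"
  and L_fibre_UNIV: "x \<in> range L \<Longrightarrow> card {y\<in>UNIV. L y = x} = 2"
proof -
  assume "x \<in> range L"
  then obtain z where z: "x = L z" by blast
  have eq: "{y. L y = x} = {z, z + a}" by (auto simp: z L_eq_iff)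
  then show 1: "card {y\<in>UNIV. L y = x} = 2" using a by simp
  have "card {y\<in>A. L y = x} \<le> card {y. L y = x}" by (rule card_mono) auto
  with 1 show "card {y\<in>A. L y = x} \<le> 2" by simp
qed

text \<open>The sum over i from 1 to f0 is the square of the sum over i below f0. For general
  \<open>y\<close> the expression \<open>trace_to_F2 f0 (a * y)\<close> is just a value of an
  additive polynomial, not a trace.\<close>

lemma is_Q_a_eval:
  assumes "is_Q_a f0 Fp a Q"
  shows "poly Q (L y) = (trace_to_F2 f0 (a * y))\<^sup>2 / a\<^sup>2"
proof -
  have eq: "smult (inverse (a ^ 2)) (\<Sum>i=1..f0. [:0, a:] ^ (2 ^ i)) = pcompose Q [:0, a, 1:]"
    using assms by (simp add: is_Q_a_def)
  have "poly Q (L y) = poly (pcompose Q [:0, a, 1:]) y"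
    by (simp add: poly_pcompose L_def power2_eq_square algebra_simps)
  also have "\<dots> = inverse (a\<^sup>2) * (\<Sum>i=1..f0. (y * a) ^ 2 ^ i)"
    by (simp flip: eq add: poly_sum)
  also have "(\<Sum>i=1..f0. (y * a) ^ 2 ^ i) = (\<Sum>i<f0. ((a * y) ^ 2 ^ i)\<^sup>2)"
    by (rule sum.reindex_bij_witness[of _ Suc "\<lambda>i. i - 1"])
      (auto simp: mult.commute power_mult[symmetric] simp flip: power_Suc)
  also have "\<dots> = (trace_to_F2 f0 (a * y))\<^sup>2"
    using power_2pow_sum[OF two, of "\<lambda>i. (a * y) ^ 2 ^ i" "{..<f0}" 1] by (simp add: trace_to_F2_def)
  finally show ?thesis by (simp add: field_simps)
qed

lemma degree_Q:
  assumes "is_Q_a f0 Fp a Q"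
  shows "degree Q = 2 ^ (f0 - 1)"
proof -
  have eq: "smult (inverse (a ^ 2)) (\<Sum>i=1..f0. [:0, a:] ^ (2 ^ i)) = pcompose Q [:0, a, 1:]"
    using assms by (simp add: is_Q_a_def)
  note mon = linear_monom_power
  have "degree (\<Sum>i=1..f0. [:0, a:] ^ (2 ^ i)) \<le> 2 ^ f0"
    by (rule degree_sum_le) (auto simp: mon intro: order.trans[OF degree_monom_le] power_increasing)
  moreover have "coeff (\<Sum>i=1..f0. [:0, a:] ^ (2 ^ i)) (2 ^ f0) \<noteq> 0"
  proof -
    have "coeff (\<Sum>i=1..f0. [:0, a:] ^ (2 ^ i)) (2 ^ f0) = (\<Sum>i=1..f0. if i = f0 then a ^ 2 ^ i else 0)"
      unfolding coeff_sum by (rule sum.cong) (auto simp: mon)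
    then show ?thesis using f0 a by simp
  qed
  ultimately have "degree (\<Sum>i=1..f0. [:0, a:] ^ (2 ^ i)) = 2 ^ f0"
    using le_degree by (meson antisym)
  then have "degree (pcompose Q [:0, a, 1:]) = 2 ^ f0"
    using a by (simp flip: eq)
  then have "degree Q * 2 = 2 ^ f0" by (simp add: degree_pcompose)
  also have "\<dots> = 2 ^ (f0 - 1) * 2" using f0 by (metis Suc_pred' mult.commute not_one_le_zero power_Suc zero_less_iff_neq_zero)
  finally show ?thesis by simp
qed

text \<open>The polarization of the quadratic form Tr (x Q(x)), as \<open>Tr_xQ_add\<close>
  shows.\<close>

definition bil :: "'k poly \<Rightarrow> 'k \<Rightarrow> 'k \<Rightarrow> 'k" where
  "bil Q r x = Tr (r * poly Q x + x * poly Q r)"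

lemma Tr_xQ_add:
  assumes "is_Q_a f0 Fp a Q"
  shows "Tr ((x + r) * poly Q (x + r)) = Tr (x * poly Q x) + Tr (r * poly Q r) + bil Q r x"
proof -
  have "F2_linearized Q" using assms by (simp add: is_Q_a_def)
  from F2_linearized_add[OF this two] show ?thesis
    by (simp only: bil_def Tr_add ring_distribs add_ac)
qed

text \<open>With m = y / a one has L y = a^2 (m^2 + m), so the product is m^2 t^2 + m t^2. Squaring
  the second term does not change its trace and makes the total (m (t^2 + t))^2; finally t^2 + t = a
  (y^p + y) by telescoping.\<close>

lemma Tr_xQ_L:
  assumes "is_Q_a f0 Fp a Q"
  shows "Tr (L y * poly Q (L y)) = Tr (y * fr y + y\<^sup>2)"
proof -
  define t where "t = trace_to_F2 f0 (a * y)"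
  define m where "m = y / a"
  have "t\<^sup>2 + t = (t + t) + (a * fr y + a * y)"
    using trace_to_F2_squared[OF two, of f0 "a * y"]
    by (simp only: t_def p[symmetric] fr_mult fr_a add_ac)
  then have t: "t\<^sup>2 + t = a * fr y + a * y" by (simp only: dbl add_0_left)
  have "L y * poly Q (L y) = m\<^sup>2 * t\<^sup>2 + m * t\<^sup>2"
    unfolding is_Q_a_eval[OF assms] using a by (simp add: t_def m_def L_def field_simps power2_eq_square)
  then have "Tr (L y * poly Q (L y)) = Tr (m\<^sup>2 * t\<^sup>2) + Tr ((m * t\<^sup>2)\<^sup>2)"
    by (simp add: Tr_add Tr_square)
  also have "\<dots> = Tr ((m * (t\<^sup>2 + t))\<^sup>2)"
    by (simp only: power_mult_distrib power2_add_char2[OF two] ring_distribs add_ac Tr_add)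
  also have "\<dots> = Tr (m * (t\<^sup>2 + t))" by (rule Tr_square)
  also have "m * (t\<^sup>2 + t) = y * fr y + y\<^sup>2"
    unfolding t using a by (simp add: m_def field_simps power2_eq_square)
  finally show ?thesis .
qed

text \<open>For y in \<open>Fp2\<close> the conjugates repeat with period two, so the sum over the
  tower cancels in characteristic 2. In the coordinate y the polarization is Tr (z y^p) + Tr (y
  z^p), and one application of Frobenius identifies the two traces when y^(p^2) = y.\<close>

lemma Tr_xQ_Fp2:
  assumes "is_Q_a f0 Fp a Q" "y \<in> Fp2"
  shows "Tr (L y * poly Q (L y)) = 0" and "bil Q (L y) (L z) = 0"
proof -
  have fy: "fr (fr y) = y" using assms by (simp add: Fp2_def)
  have *: "Tr (u * fr y) = Tr (y * fr u)" for u
    using Tr_fr[of "u * fr y"] by (simp add: fr_mult fy mult.commute)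
  show 0: "Tr (L y * poly Q (L y)) = 0"
  proof -
    have "y * fr y + y\<^sup>2 + fr (y * fr y + y\<^sup>2) + fr (fr (y * fr y + y\<^sup>2)) + fr (fr (fr (y * fr y + y\<^sup>2)))
       = (y * fr y + y\<^sup>2 + fr (y * fr y + y\<^sup>2)) + (y * fr y + y\<^sup>2 + fr (y * fr y + y\<^sup>2))"
      by (simp add: fr_add fr_mult fy power2_eq_square algebra_simps)
    then have "Tr (y * fr y + y\<^sup>2) = 0" by (simp only: Tr_tower dbl trace_to_F2_0)
    then show ?thesis by (simp only: Tr_xQ_L[OF assms(1)])
  qed
  have "Tr (L (z + y) * poly Q (L (z + y))) = Tr (L z * poly Q (L z)) + Tr (L y * poly Q (L y)) + bil Q (L y) (L z)"
    unfolding L_add by (rule Tr_xQ_add[OF assms(1)])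
  moreover have "Tr (L (z + y) * poly Q (L (z + y))) =
      Tr (L z * poly Q (L z)) + Tr (L y * poly Q (L y)) + (Tr (z * fr y) + Tr (y * fr z))"
    unfolding Tr_xQ_L[OF assms(1)]
    by (simp only: fr_add power2_add_char2[OF two] Tr_add ring_distribs add_ac)
  ultimately show "bil Q (L y) (L z) = 0" using * by (simp add: dbl)
qed

lemma Tr_nondegenerate:
  assumes "e \<noteq> 0"
  obtains x where "Tr (x * e) \<noteq> 0"
proof -
  have "\<exists>x. Tr (x * e) \<noteq> 0"
  proof (rule ccontr)
    assume n: "\<not> (\<exists>x. Tr (x * e) \<noteq> 0)"
    have "Tr u = 0" for u
    proof -
      have "u = u / e * e" using assms by simp
      with n show ?thesis by metis
    qed
    then have "{x. Tr x = 0} = UNIV" by auto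
    then have "CARD('k) \<le> 2 ^ (4 * f0 - 1)" using card_trace_zero_le(2)[of "4 * f0", where ?'a='k] f0 by simp
    moreover have "(2::nat) ^ (4 * f0 - 1) < 2 ^ (4 * f0)" using f0 by simp
    ultimately show False unfolding card_k' by linarith
  qed
  then show ?thesis using that by blast
qed

text \<open>The radical of the bilinear form is cut out by a linearized polynomial of degree
  \<open>(p div 2)\<^sup>2\<close>, hence it cannot contain the image under \<open>L\<close> of the field with \<open>p\<^sup>2\<close> elements.\<close>
lemma ex_bil_nonzero:
  assumes Q: "is_Q_a f0 Fp a Q"
  obtains y x where "y \<in> Fp2" "bil Q (L y) x \<noteq> 0"
proof -
  define h where "h = f0 - 1"
  have h1: "h \<ge> 1" using f0_ge_2 by (simp add: h_def)
  define c where "c i = coeff Q (2 ^ i)" for i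
  have degQ: "degree Q = 2 ^ h" using degree_Q[OF Q] by (simp add: h_def)
  have lin: "F2_linearized Q" using Q by (simp add: is_Q_a_def)
  have ev: "poly Q x = (\<Sum>i\<le>h. c i * x ^ 2 ^ i)" for x
    unfolding c_def by (rule F2_linearized_eval[OF lin]) (simp add: degQ)
  have ch: "c h \<noteq> 0" unfolding c_def degQ[symmetric] using degQ by (metis degree_0 leading_coeff_0_iff power_not_zero zero_neq_numeral)
  \<comment> \<open>Since Frobenius preserves \<open>Tr\<close>, the terms of the form may be raised
    to the powers 2^(h-i) and 2^h, which gives all of them the factor x^(2^h). \<open>e\<close>
    collects the resulting coefficients of r; the two families overlap only at j = h, so for h \<ge>
    1 the top coefficient is c_h^(2^h).\<close>
  define e where "e j = (if j \<le> h then c (h - j) ^ 2 ^ j else 0) + (if h \<le> j then c (j - h) ^ 2 ^ h else 0)" for j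
  define E where "E r = (\<Sum>j\<le>2 * h. e j * r ^ 2 ^ j)" for r
  have "E r = (\<Sum>i\<le>h. c i ^ 2 ^ (h - i) * r ^ 2 ^ (h - i)) + (\<Sum>i\<le>h. c i ^ 2 ^ h * r ^ 2 ^ (h + i))" for r
  proof -
    have "E r = (\<Sum>j\<le>2 * h. if j \<le> h then c (h - j) ^ 2 ^ j * r ^ 2 ^ j else 0)
        + (\<Sum>j\<le>2 * h. if h \<le> j then c (j - h) ^ 2 ^ h * r ^ 2 ^ j else 0)"
      unfolding E_def sum.distrib[symmetric] by (rule sum.cong) (auto simp: e_def algebra_simps)
    also have "(\<Sum>j\<le>2 * h. if j \<le> h then c (h - j) ^ 2 ^ j * r ^ 2 ^ j else 0)
        = (\<Sum>j\<le>h. c (h - j) ^ 2 ^ j * r ^ 2 ^ j)"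
      by (rule sum.mono_neutral_cong_right) auto
    also have "\<dots> = (\<Sum>i\<le>h. c i ^ 2 ^ (h - i) * r ^ 2 ^ (h - i))"
      by (rule sum.reindex_bij_witness[of _ "\<lambda>i. h - i" "\<lambda>i. h - i"]) auto
    also have "(\<Sum>j\<le>2 * h. if h \<le> j then c (j - h) ^ 2 ^ h * r ^ 2 ^ j else 0)
        = (\<Sum>j\<in>{h..2*h}. c (j - h) ^ 2 ^ h * r ^ 2 ^ j)"
      by (rule sum.mono_neutral_cong_right) auto
    also have "\<dots> = (\<Sum>i\<le>h. c i ^ 2 ^ h * r ^ 2 ^ (h + i))"
      by (rule sum.reindex_bij_witness[of _ "\<lambda>i. h + i" "\<lambda>i. i - h"]) auto
    finally show ?thesis .
  qed
  note E_eq = this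
  have bil_E: "bil Q r x = Tr (x ^ 2 ^ h * E r)" for r x
  proof -
    have 1: "Tr (r * (c i * x ^ 2 ^ i)) = Tr (x ^ 2 ^ h * (c i ^ 2 ^ (h - i) * r ^ 2 ^ (h - i)))" if "i \<le> h" for i
    proof -
      have "(2::nat) ^ i * 2 ^ (h - i) = 2 ^ h" using that by (simp flip: power_add)
      then have "(r * (c i * x ^ 2 ^ i)) ^ 2 ^ (h - i) = x ^ 2 ^ h * (c i ^ 2 ^ (h - i) * r ^ 2 ^ (h - i))"
        by (simp add: power_mult_distrib mult_ac flip: power_mult)
      then show ?thesis by (metis Tr_power)
    qed
    have 2: "Tr (x * (c i * r ^ 2 ^ i)) = Tr (x ^ 2 ^ h * (c i ^ 2 ^ h * r ^ 2 ^ (h + i)))" for i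
    proof -
      have "(x * (c i * r ^ 2 ^ i)) ^ 2 ^ h = x ^ 2 ^ h * (c i ^ 2 ^ h * r ^ 2 ^ (h + i))"
        by (simp add: power_mult_distrib power_add mult_ac flip: power_mult)
      then show ?thesis by (metis Tr_power)
    qed
    have "bil Q r x = (\<Sum>i\<le>h. Tr (r * (c i * x ^ 2 ^ i))) + (\<Sum>i\<le>h. Tr (x * (c i * r ^ 2 ^ i)))"
      unfolding bil_def ev by (simp add: Tr_add trace_to_F2_sum[OF two] sum_distrib_left)
    also have "\<dots> = Tr (x ^ 2 ^ h * E r)"
      unfolding E_eq by (simp add: 1 2 distrib_left Tr_add trace_to_F2_sum[OF two] sum_distrib_left)
    finally show ?thesis .
  qed
  have "\<exists>y\<in>Fp2. E (L y) \<noteq> 0"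
  proof (rule ccontr)
    assume "\<not> (\<exists>y\<in>Fp2. E (L y) \<noteq> 0)"
    then have "L ` Fp2 \<subseteq> {r. E r = 0}" by auto
    then have "card (L ` Fp2) \<le> card {r. E r = 0}" by (intro card_mono) auto
    also have "\<dots> \<le> 2 ^ (2 * h)"
      unfolding E_def by (rule card_roots_linearized) (use ch h1 in \<open>simp add: e_def\<close>)
    finally have le: "card (L ` Fp2) \<le> 2 ^ (2 * h)" .
    \<comment> \<open>\<open>L\<close> is at most two-to-one, so the image has at least p^2 / 2
      elements, while \<open>E\<close> has at most p^2 / 4 roots.\<close>
    have "card Fp2 = (\<Sum>x\<in>L ` Fp2. card {y\<in>Fp2. L y = x})"
      using sum.group[of Fp2 "L ` Fp2" L "\<lambda>_. 1::nat"] by simp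
    also have "\<dots> \<le> (\<Sum>x\<in>L ` Fp2. 2)" by (rule sum_mono) (use L_fibre in auto)
    finally have "p\<^sup>2 \<le> 2 * 2 ^ (2 * h)" using le by (simp add: card_Fp2)
    moreover have "p = 2 * 2 ^ h" using f0 by (simp add: p h_def flip: power_Suc)
    then have "p\<^sup>2 = 4 * 2 ^ (2 * h)" by (simp add: power_mult_distrib mult.commute flip: power_mult)
    ultimately show False by simp
  qed
  then obtain y where y: "y \<in> Fp2" "E (L y) \<noteq> 0" by blast
  obtain u where u: "Tr (u * E (L y)) \<noteq> 0" using Tr_nondegenerate[OF y(2)] .
  \<comment> \<open>The form sees x only through x^(2^h), so the element found for nondegeneracy
    must be written as such a power.\<close>
  have "inj (\<lambda>x::'k. x ^ 2 ^ h)" by (rule injI) (simp add: power_2pow_eq_iff[OF two])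
  then have "surj (\<lambda>x::'k. x ^ 2 ^ h)" by (simp add: finite_UNIV_inj_surj)
  then obtain x where "u = x ^ 2 ^ h" by (metis surjD)
  with u have "bil Q (L y) x \<noteq> 0" by (simp add: bil_E)
  with y(1) show ?thesis by (rule that)
qed

lemma range_L: "2 * card (range L) = CARD('k)"
proof -
  have "CARD('k) = (\<Sum>x\<in>range L. card {y\<in>UNIV. L y = x})"
    using sum.group[of UNIV "range L" L "\<lambda>_. 1::nat"] by simp
  then show ?thesis using L_fibre_UNIV by simp
qed

lemma index_2_L:
  assumes "x \<notin> range L" "y \<notin> range L"
  shows "x + y \<in> range L"
proof -
  have sub: "(\<lambda>u. x + u) ` range L \<subseteq> - range L"
  proof
    fix v assume "v \<in> (\<lambda>u. x + u) ` range L"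
    then obtain z where z: "v = x + L z" by auto
    show "v \<in> - range L"
    proof
      assume "v \<in> range L"
      then obtain w where "v = L w" by auto
      then have "x = L (w + z)" using z dbl by (metis L_add add.assoc add.right_neutral)
      then show False using assms by auto
    qed
  qed
  have "card ((\<lambda>u. x + u) ` range L) = card (range L)" by (rule card_image) simp
  moreover have "card (- range L) = card (range L)"
    using range_L by (simp add: Compl_eq_Diff_UNIV card_Diff_subset)
  ultimately have "(\<lambda>u. x + u) ` range L = - range L"
    using sub by (intro card_subset_eq) auto
  then obtain z where "y = x + L z" using assms by blast
  then have "x + y = L z" using dbl2 by simp
  then show ?thesis by auto
qed

lemma sum_Tr_xQ:
  assumes Q: "is_Q_a f0 Fp a Q" and "odd f0"
  shows "2 * (\<Sum>x\<in>UNIV. trace_sign (4 * f0) (x * poly Q x)) = int (p ^ 3)"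
proof -
  let ?q = "\<lambda>x. trace_sign (4 * f0) (x * poly Q x)"
  have "int (p ^ 3) = (\<Sum>y\<in>UNIV. ?q (L y))"
    unfolding sum_Tr_form[OF \<open>odd f0\<close>, symmetric] by (simp add: trace_sign_def Tr_xQ_L[OF Q])
  also have "\<dots> = int 2 * (\<Sum>x\<in>range L. ?q x)"
    by (rule sum_fibres) (use L_fibre_UNIV in auto)
  finally have 1: "2 * (\<Sum>x\<in>range L. ?q x) = int (p ^ 3)" by simp
  obtain y x0 where y: "y \<in> Fp2" and x0: "bil Q (L y) x0 \<noteq> 0" using ex_bil_nonzero[OF Q] .
  have lin: "F2_linearized Q" using Q by (simp add: is_Q_a_def)
  have bil_add: "bil Q r (u + v) = bil Q r u + bil Q r v" for r u v
    by (simp only: bil_def F2_linearized_add[OF lin two] ring_distribs add_ac Tr_add)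
  have x0': "x0 \<notin> range L" using x0 Tr_xQ_Fp2(2)[OF Q y] by auto
  have flip: "?q (x + L y) = - ?q x" if x: "x \<notin> range L" for x
  proof -
    \<comment> \<open>The additive map \<open>bil Q (L y)\<close> vanishes on the range of
      \<open>L\<close>, and the complement is a single coset; its value there is the nonzero value
      at \<open>x0\<close>.\<close>
    obtain z where z: "x + x0 = L z" using index_2_L[OF x x0'] by auto
    have "bil Q (L y) x + bil Q (L y) x0 = 0"
      unfolding bil_add[symmetric] z by (rule Tr_xQ_Fp2(2)[OF Q y])
    then have "bil Q (L y) x \<noteq> 0" using x0 by auto
    then have "bil Q (L y) x = 1" using Tr_cases by (auto simp: bil_def)
    then have "Tr ((x + L y) * poly Q (x + L y)) = Tr (x * poly Q x) + 1"
      by (simp add: Tr_xQ_add[OF Q] Tr_xQ_Fp2(1)[OF Q y])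
    then show ?thesis using Tr_cases[of "x * poly Q x"] dbl[of 1] by (auto simp: trace_sign_def)
  qed
  have cosets: "x + L y \<in> range L \<longleftrightarrow> x \<in> range L" for x
  proof
    assume "x + L y \<in> range L"
    then obtain w where "x + L y = L w" by auto
    then have "x = L (w + y)" using dbl by (metis L_add add.assoc add.right_neutral)
    then show "x \<in> range L" by auto
  next
    assume "x \<in> range L"
    then show "x + L y \<in> range L" by (auto simp flip: L_add)
  qed
  have "(\<Sum>x\<in>- range L. ?q x) = (\<Sum>x\<in>- range L. ?q (x + L y))"
    by (rule sum.reindex_bij_witness[of _ "\<lambda>x. x + L y" "\<lambda>x. x + L y"])
      (use cosets in \<open>auto simp: add.assoc dbl\<close>)
  also have "\<dots> = - (\<Sum>x\<in>- range L. ?q x)"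
    unfolding sum_negf[symmetric] by (rule sum.cong) (use flip in auto)
  finally have 2: "(\<Sum>x\<in>- range L. ?q x) = 0" by simp
  have "(\<Sum>x\<in>UNIV. ?q x) = (\<Sum>x\<in>range L. ?q x) + (\<Sum>x\<in>- range L. ?q x)"
    by (subst sum.union_disjoint[symmetric]) (auto intro: sum.cong)
  then show ?thesis using 1 2 by simp
qed

text \<open>The additive map d^2 + d has kernel {0, 1} and values of trace zero, which make up at
  most half of the field; so each element of trace zero is hit exactly twice.\<close>

lemma card_artin_schreier_roots:
  "int (card {d::'k. d\<^sup>2 + d = v}) = 1 + trace_sign (4 * f0) v"
proof -
  let ?h = "\<lambda>d::'k. d\<^sup>2 + d" and ?B = "{v::'k. Tr v = 0}"
  have add: "?h (x + y) = ?h x + ?h y" for x y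
    by (simp add: power2_add_char2[OF two] algebra_simps)
  have "?h x = 0 \<longleftrightarrow> x = 0 \<or> x = 1" for x
  proof -
    have "?h x = x * (x + 1)" by (simp add: power2_eq_square algebra_simps)
    then show ?thesis by (simp add: sum_eq_0_char2[OF two])
  qed
  then have "{x. ?h x = 0} = {0, 1}" by auto
  then have le: "card {x\<in>UNIV. ?h x = y} \<le> 2" for y
    using card_additive_fibre_le[of ?h y] add by simp
  have T: "Tr (?h d) = 0" for d by (simp add: Tr_add Tr_square dbl)
  have "card ?B \<le> 2 ^ (4 * f0 - 1)"
    using card_trace_zero_le(2)[of "4 * f0", where ?'a='k] f0 by simp
  moreover have "CARD('k) = 2 * 2 ^ (4 * f0 - 1)"
    unfolding card_k' using f0 by (subst power_Suc[symmetric]) simp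
  ultimately have tot: "2 * card ?B \<le> card (UNIV::'k set)" by simp
  have "card {d\<in>UNIV. ?h d = v} = 2" if "Tr v = 0"
    by (rule fibres_card_eq[of UNIV ?h ?B]) (use T le tot that in auto)
  moreover have "{d. ?h d = v} = {}" if "Tr v \<noteq> 0" using T that by auto
  ultimately show ?thesis by (simp add: trace_sign_def)
qed

lemma card_affine_points:
  assumes Q: "is_Q_a f0 Fp a Q" and "odd f0"
  shows "2 * card {(c, d). d\<^sup>2 + d = c * poly Q c} = 2 * p ^ 4 + p ^ 3"
proof -
  have "{(c, d). d\<^sup>2 + d = c * poly Q c} = (SIGMA c:UNIV. {d. d\<^sup>2 + d = c * poly Q c})" by auto
  then have "card {(c, d). d\<^sup>2 + d = c * poly Q c} = (\<Sum>c\<in>UNIV. card {d. d\<^sup>2 + d = c * poly Q c})"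
    by simp
  then have "int (card {(c, d). d\<^sup>2 + d = c * poly Q c}) = (\<Sum>c\<in>UNIV. int (card {d. d\<^sup>2 + d = c * poly Q c}))"
    by simp
  also have "\<dots> = int (CARD('k)) + (\<Sum>c\<in>UNIV. trace_sign (4 * f0) (c * poly Q c))"
    by (simp add: card_artin_schreier_roots sum.distrib)
  finally have "2 * int (card {(c, d). d\<^sup>2 + d = c * poly Q c}) = 2 * int (p ^ 4) + int (p ^ 3)"
    using sum_Tr_xQ[OF assms] by (simp add: card_k)
  then show ?thesis by linarith
qed

text \<open>Comparing coefficients gives a recursion for the coefficients of \<open>Q\<close>, solved by
  the following closed form; the vanishing of the trace is what makes the top coefficient fit.\<close>
lemma ex_Q_a: "\<exists>Q. is_Q_a f0 Fp a Q"
proof -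
  \<comment> \<open>The coefficient equation at x^(2^i) reads c_(i-1) + c_i a^(2^i) = a^(2^i) / a^2.
    Multiplied by a^2 a^(2^i) it becomes s_(i-1) + s_i = a^(2^(i+1)), which partial sums solve in
    characteristic 2.\<close>
  define s where "s i = (\<Sum>j\<in>{2..i + 1}. a ^ 2 ^ j)" for i
  define c where "c i = s i / (a\<^sup>2 * a ^ 2 ^ (i + 1))" for i
  define Q where "Q = (\<Sum>i<f0. monom (c i) (2 ^ i))"
  have zero: "0 \<in> Fp" and one: "1 \<in> Fp" and add: "\<And>u v. u \<in> Fp \<Longrightarrow> v \<in> Fp \<Longrightarrow> u + v \<in> Fp"
    and mult: "\<And>u v. u \<in> Fp \<Longrightarrow> v \<in> Fp \<Longrightarrow> u * v \<in> Fp"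
    and inv: "\<And>u. u \<in> Fp \<Longrightarrow> inverse u \<in> Fp"
    using Fp unfolding is_subfield_def by blast+
  have pow: "a ^ n \<in> Fp" for n
    by (induction n) (simp_all add: one mult a)
  have sum_Fp: "(\<Sum>j\<in>A. u j) \<in> Fp" if "\<And>j. u j \<in> Fp" for A :: "nat set" and u
    by (induction A rule: infinite_finite_induct) (simp_all add: zero add that)
  have "s i \<in> Fp" for i unfolding s_def by (intro sum_Fp pow)
  then have cF: "c i \<in> Fp" for i unfolding c_def divide_inverse by (intro mult inv pow)
  have "coeff Q n \<in> Fp" for n
  proof -
    have "coeff Q n = (\<Sum>i<f0. if 2 ^ i = n then c i else 0)" by (simp add: Q_def coeff_sum)
    also have "\<dots> \<in> Fp" by (rule sum_Fp) (simp add: cF zero)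
    finally show ?thesis .
  qed
  then have co: "set (coeffs Q) \<subseteq> Fp"
    using forall_coeffs_conv[of "\<lambda>x. x \<in> Fp" Q] zero by blast
  have two': "(2::'k poly) = 0"
    by (simp add: numeral_poly two)
  note mon = linear_monom_power
  have comp: "pcompose (monom b (2 ^ i)) [:0, a, 1:] = monom b (2 ^ (i + 1)) + monom (b * a ^ 2 ^ i) (2 ^ i)" for b i
  proof -
    have "[:0, a, 1:] = [:0, a:] + [:0, 1:]\<^sup>2" by (simp add: power2_eq_square)
    then have "[:0, a, 1:] ^ 2 ^ i = [:0, a:] ^ 2 ^ i + [:0, 1:] ^ 2 ^ (i + 1)"
      by (simp add: power_2pow_add[OF two'] mult.commute flip: power_mult)
    then show ?thesis
      by (simp add: pcompose_monom mon smult_add_right smult_monom add.commute)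
  qed
  have split: "(\<Sum>i<f0. monom (c i) (2 ^ (i + 1))) + (\<Sum>i<f0. monom (c i * a ^ 2 ^ i) (2 ^ i))
     = (\<Sum>i=1..f0. monom (inverse (a\<^sup>2) * a ^ 2 ^ i) (2 ^ i))"
  proof -
    have rec: "c (i - 1) + (if i < f0 then c i * a ^ 2 ^ i else 0) = inverse (a\<^sup>2) * a ^ 2 ^ i"
      if i: "i \<in> {1..f0}" for i
    proof -
      have "s i = s (i - 1) + a ^ 2 ^ (i + 1)"
        using i by (cases i) (simp_all add: s_def)
      moreover have "(a ^ 2 ^ i)\<^sup>2 = a ^ 2 ^ (i + 1)"
        by (simp add: mult.commute flip: power_mult)
      ultimately have ss: "s (i - 1) + s i = (a ^ 2 ^ i)\<^sup>2"
        by (simp only: dbl2)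
      have ci: "c (i - 1) = s (i - 1) / (a\<^sup>2 * a ^ 2 ^ i)" using i by (simp add: c_def)
      show ?thesis
      proof (cases "i < f0")
        case True
        have "c i * a ^ 2 ^ i = s i / (a\<^sup>2 * a ^ 2 ^ i)"
        proof -
          have "a ^ 2 ^ (i + 1) = a ^ 2 ^ i * a ^ 2 ^ i"
            by (simp only: Suc_eq_plus1[symmetric] power_Suc mult_2 power_add)
          then show ?thesis using a by (simp add: c_def field_simps)
        qed
        then have "c (i - 1) + c i * a ^ 2 ^ i = (s (i - 1) + s i) / (a\<^sup>2 * a ^ 2 ^ i)"
          by (simp only: ci add_divide_distrib)
        also have "\<dots> = inverse (a\<^sup>2) * a ^ 2 ^ i"
          unfolding ss using a by (simp add: field_simps power2_eq_square)
        finally show ?thesis using True by simp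
      next
        case False
        then have i0: "i = f0" using i by simp
        \<comment> \<open>At the top there is no further coefficient to choose. The squared trace is
          a^2 + s_(f0-1), so its vanishing gives s_(f0-1) = a^2, exactly the value required.\<close>
        have "(trace_to_F2 f0 a)\<^sup>2 = (\<Sum>j<f0. a ^ 2 ^ (j + 1))"
          using power_2pow_sum[OF two, of "\<lambda>i. a ^ 2 ^ i" "{..<f0}" 1]
          by (simp add: trace_to_F2_def mult.commute flip: power_mult)
        also have "\<dots> = (\<Sum>j=1..f0. a ^ 2 ^ j)"
          by (rule sum.reindex_bij_witness[of _ "\<lambda>j. j - 1" Suc]) auto
        also have "\<dots> = a\<^sup>2 + s (f0 - 1)"
          using f0 by (subst sum.atLeast_Suc_atMost) (simp_all add: s_def numeral_2_eq_2)
        finally have "s (f0 - 1) = a\<^sup>2" using tr_a by (simp add: sum_eq_0_char2[OF two])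
        then have "c (f0 - 1) = a\<^sup>2 / (a\<^sup>2 * a)" using ci fr_a by (simp only: i0 p[symmetric])
        then show ?thesis using i0 a fr_a by (simp add: p[symmetric] field_simps power2_eq_square)
      qed
    qed
    have "(\<Sum>i<f0. monom (c i) (2 ^ (i + 1))) = (\<Sum>i=1..f0. monom (c (i - 1)) (2 ^ i))"
      by (rule sum.reindex_bij_witness[of _ "\<lambda>j. j - 1" Suc]) auto
    moreover have "(\<Sum>i<f0. monom (c i * a ^ 2 ^ i) (2 ^ i))
        = (\<Sum>i=1..f0. monom (if i < f0 then c i * a ^ 2 ^ i else 0) (2 ^ i))"
    proof -
      have "(\<Sum>i<f0. monom (c i * a ^ 2 ^ i) (2 ^ i)) = (\<Sum>i\<in>{1..<f0}. monom (c i * a ^ 2 ^ i) (2 ^ i))"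
      proof (rule sum.mono_neutral_right)
        show "\<forall>i\<in>{..<f0} - {1..<f0}. monom (c i * a ^ 2 ^ i) (2 ^ i) = 0"
        proof
          fix i assume "i \<in> {..<f0} - {1..<f0}"
          then have "i = 0" by auto
          \<comment> \<open>\<open>c 0\<close> is zero because \<open>s 0\<close> sums over the
            empty set \<open>{2..1}\<close>; so no linear term arises.\<close>
          then show "monom (c i * a ^ 2 ^ i) (2 ^ i) = 0" by (simp add: c_def s_def)
        qed
      qed auto
      also have "\<dots> = (\<Sum>i=1..f0. monom (if i < f0 then c i * a ^ 2 ^ i else 0) (2 ^ i))"
        by (rule sum.mono_neutral_cong_left) auto
      finally show ?thesis .
    qed
    ultimately show ?thesis
      by (simp only: sum.distrib[symmetric] add_monom) (rule sum.cong[OF refl], simp only: rec)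
  qed
  have "pcompose Q [:0, a, 1:] = (\<Sum>i=1..f0. monom (inverse (a\<^sup>2) * a ^ 2 ^ i) (2 ^ i))"
    unfolding split[symmetric] by (simp add: Q_def pcompose_sum comp sum.distrib)
  then have "smult (inverse (a\<^sup>2)) (\<Sum>i=1..f0. [:0, a:] ^ 2 ^ i) = pcompose Q [:0, a, 1:]"
    using sum_distrib_left[of "[:inverse (a\<^sup>2):]" "\<lambda>i. [:0, a:] ^ 2 ^ i" "{1..f0}"]
    by (simp add: mon smult_monom)
  then have "is_Q_a f0 Fp a Q"
    using co unfolding is_Q_a_def F2_linearized_def Q_def by blast
  then show ?thesis ..
qed

end

subsection \<open>Closed points of a function field\<close>

lemma emb_poly_0 [simp]: "emb_poly 0 = 0"
  and emb_poly_1 [simp]: "emb_poly 1 = 1"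
  and emb_poly_add [simp]: "emb_poly (p + q) = emb_poly p + emb_poly q"
  and emb_poly_minus [simp]: "emb_poly (- p) = - emb_poly p"
  and emb_poly_diff [simp]: "emb_poly (p - q) = emb_poly p - emb_poly q"
  and emb_poly_mult [simp]: "emb_poly (p * q) = emb_poly p * emb_poly q"
  and emb_poly_eq_iff [simp]: "emb_poly p = emb_poly q \<longleftrightarrow> p = q"
  and emb_poly_eq_0_iff [simp]: "emb_poly p = 0 \<longleftrightarrow> p = 0"
  by (simp_all add: emb_poly_def)

lemma emb_poly_power [simp]: "emb_poly (p ^ n) = emb_poly p ^ n"
  by (induction n) simp_all

lemma emb_poly_sum: "emb_poly (\<Sum>i\<in>A. p i) = (\<Sum>i\<in>A. emb_poly (p i))"
  by (induction A rule: infinite_finite_induct) simp_all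

lemma emb_const_0 [simp]: "emb_const 0 = 0"
  and emb_const_1 [simp]: "emb_const 1 = 1"
  and emb_const_eq_iff [simp]: "emb_const c = emb_const d \<longleftrightarrow> c = d"
  and emb_const_eq_0_iff [simp]: "emb_const c = 0 \<longleftrightarrow> c = 0"
  and emb_const_minus: "emb_const (- c) = - emb_const c"
  by (simp_all add: emb_const_simps(3)) (simp_all add: emb_const_def flip: emb_poly_minus)

lemma emb_const_inverse: "emb_const (inverse c) = inverse (emb_const c)"
proof (cases "c = 0")
  case False
  then have "emb_const c * emb_const (inverse c) = 1"
    by (simp flip: emb_const_simps)
  then show ?thesis by (metis inverse_unique)
qed simp

lemma emb_const_power: "emb_const (c ^ n) = emb_const c ^ n"
  by (induction n) (simp_all add: emb_const_simps)

lemma emb_poly_smult: "emb_poly (smult c p) = emb_const c * emb_poly p"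
  using emb_poly_mult[of "[:c:]" p] by (simp add: emb_const_def)

lemma emb_poly_pCons: "emb_poly (pCons c p) = emb_const c + emb_poly [:0, 1:] * emb_poly p"
proof -
  have "pCons c p = [:c:] + [:0, 1:] * p" by simp
  then show ?thesis unfolding emb_const_def by (metis emb_poly_add emb_poly_mult)
qed

lemma emb_poly_altdef: "emb_poly p = (\<Sum>i\<le>degree p. emb_const (coeff p i) * emb_poly [:0, 1:] ^ i)"
proof -
  have "p = (\<Sum>i\<le>degree p. smult (coeff p i) ([:0, 1:] ^ i))"
    using poly_as_sum_of_monoms[of p] by (simp add: monom_altdef)
  then have "emb_poly p = (\<Sum>i\<le>degree p. emb_poly (smult (coeff p i) ([:0, 1:] ^ i)))"
    by (metis emb_poly_sum)
  then show ?thesis by (simp add: emb_poly_smult)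
qed

lemma is_subfield_diff: "is_subfield F \<Longrightarrow> u \<in> F \<Longrightarrow> v \<in> F \<Longrightarrow> u - v \<in> F"
  unfolding is_subfield_def by (metis diff_conv_add_uminus)

lemma is_subfield_divide: "is_subfield F \<Longrightarrow> u \<in> F \<Longrightarrow> v \<in> F \<Longrightarrow> u / v \<in> F"
  unfolding is_subfield_def divide_inverse by blast

lemma is_subfield_power: "is_subfield F \<Longrightarrow> u \<in> F \<Longrightarrow> u ^ n \<in> F"
  by (induction n) (auto simp: is_subfield_def)

lemma is_subfield_sum: "is_subfield F \<Longrightarrow> (\<And>i. i \<in> A \<Longrightarrow> u i \<in> F) \<Longrightarrow> (\<Sum>i\<in>A. u i) \<in> F"
  by (induction A rule: infinite_finite_induct) (auto simp: is_subfield_def)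

lemma is_subfield_hull: "is_subfield (is_subfield hull S)"
  by (rule hull_in) (auto simp: is_subfield_def)

locale closed_point =
  fixes K R :: "'k::field rat_closure set"
  assumes K: "is_subfield K" and R: "R \<in> closed_points K"
begin

lemma const: "emb_const c \<in> R"
  and sub: "R \<subseteq> K"
  and proper: "R \<noteq> K"
  and add: "u \<in> R \<Longrightarrow> v \<in> R \<Longrightarrow> u + v \<in> R"
  and mult: "u \<in> R \<Longrightarrow> v \<in> R \<Longrightarrow> u * v \<in> R"
  and total: "u \<in> K \<Longrightarrow> u \<in> R \<or> inverse u \<in> R"
  using R by (auto simp: closed_points_def)

lemma zero: "0 \<in> R" and one: "1 \<in> R"
  using const[of 0] const[of 1] by simp_all

lemma minus: "u \<in> R \<Longrightarrow> - u \<in> R"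
  using mult[OF const[of "- 1"], of u] by (simp add: emb_const_minus)

lemma diff: "u \<in> R \<Longrightarrow> v \<in> R \<Longrightarrow> u - v \<in> R"
  using add[OF _ minus, of u v] by simp

lemma power: "u \<in> R \<Longrightarrow> u ^ n \<in> R"
  by (induction n) (auto intro: one mult)

lemma sum: "(\<And>i. i \<in> A \<Longrightarrow> u i \<in> R) \<Longrightarrow> (\<Sum>i\<in>A. u i) \<in> R"
  by (induction A rule: infinite_finite_induct) (auto intro: zero add)

abbreviation "\<mm> \<equiv> maximal_ideal_of R"

lemma max_sub: "u \<in> \<mm> \<Longrightarrow> u \<in> R"
  and zero_max: "0 \<in> \<mm>"
  and one_max: "1 \<notin> \<mm>"
  by (auto simp: maximal_ideal_of_def zero one)

lemma unit: "u \<in> R \<Longrightarrow> u \<notin> \<mm> \<Longrightarrow> inverse u \<in> R"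
  and unit_nz: "u \<in> R \<Longrightarrow> u \<notin> \<mm> \<Longrightarrow> u \<noteq> 0"
  by (auto simp: maximal_ideal_of_def zero)

lemma max_mult: "u \<in> \<mm> \<Longrightarrow> r \<in> R \<Longrightarrow> u * r \<in> \<mm>"
proof -
  assume u: "u \<in> \<mm>" and r: "r \<in> R"
  have "u * r \<in> R" using u r by (auto intro: mult max_sub)
  moreover have "inverse (u * r) \<notin> R" if "u * r \<noteq> 0"
  proof
    assume "inverse (u * r) \<in> R"
    then have "inverse (u * r) * r \<in> R" using r by (rule mult)
    moreover have "inverse (u * r) * r = inverse u" using that by (simp add: field_simps)
    ultimately have "inverse u \<in> R" by metis
    then show False using u that by (auto simp: maximal_ideal_of_def)
  qed
  ultimately show ?thesis by (auto simp: maximal_ideal_of_def)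
qed

text \<open>Of u / v and v / u one lies in the valuation ring, so the sum is a multiple of v or of
  u.\<close>

lemma max_add: "u \<in> \<mm> \<Longrightarrow> v \<in> \<mm> \<Longrightarrow> u + v \<in> \<mm>"
proof -
  have *: "u + v \<in> \<mm>" if u: "u \<in> \<mm>" and v: "v \<in> \<mm>" and uv: "u / v \<in> R" and nz: "v \<noteq> 0" for u v
  proof -
    have "v * (u / v + 1) \<in> \<mm>" by (intro max_mult v add uv one)
    then show ?thesis using nz by (simp add: field_simps)
  qed
  assume u: "u \<in> \<mm>" and v: "v \<in> \<mm>"
  show "u + v \<in> \<mm>"
  proof (cases "u = 0 \<or> v = 0")
    case False
    have "u / v \<in> K" using is_subfield_divide[OF K] max_sub[OF u] max_sub[OF v] sub by blast
    then have "u / v \<in> R \<or> v / u \<in> R" using total[of "u / v"] by simp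
    then show ?thesis using *[of u v] *[of v u] u v False by (auto simp: add.commute)
  qed (use u v in auto)
qed

lemma max_minus: "u \<in> \<mm> \<Longrightarrow> - u \<in> \<mm>"
  using max_mult[of u "-1"] minus[OF one] by simp

lemma max_diff: "u \<in> \<mm> \<Longrightarrow> v \<in> \<mm> \<Longrightarrow> u - v \<in> \<mm>"
  using max_add[OF _ max_minus, of u v] by simp

lemma max_prime: "u \<in> R \<Longrightarrow> v \<in> R \<Longrightarrow> u * v \<in> \<mm> \<Longrightarrow> u \<in> \<mm> \<or> v \<in> \<mm>"
proof (rule ccontr)
  assume u: "u \<in> R" and v: "v \<in> R" and uv: "u * v \<in> \<mm>" and n: "\<not> (u \<in> \<mm> \<or> v \<in> \<mm>)"
  have "inverse u \<in> R" "inverse v \<in> R" "u \<noteq> 0" "v \<noteq> 0"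
    using unit[OF u] unit[OF v] unit_nz[OF u] unit_nz[OF v] n by blast+
  then have "u * v * (inverse u * inverse v) \<in> \<mm>" by (intro max_mult[OF uv] mult)
  then show False using one_max \<open>u \<noteq> 0\<close> \<open>v \<noteq> 0\<close> by (simp add: field_simps)
qed

text \<open>Valuation rings are integrally closed. Only quadratic equations occur: that of \<zeta>,
  and that of \<zeta> / x^(g+1) at infinity.\<close>

lemma integral:
  assumes w: "w \<in> K" and b: "b \<in> R" and c: "c \<in> R" and eq: "w\<^sup>2 = b * w + c"
  shows "w \<in> R"
proof (rule ccontr)
  assume nR: "w \<notin> R"
  then have i: "inverse w \<in> R" using total[OF w] by blast
  have nz: "w \<noteq> 0" using nR zero by auto
  then have "(b + c * inverse w) * w = w * w"
    using eq by (simp add: distrib_right mult.assoc power2_eq_square)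
  then have "w = b + c * inverse w" using nz by (metis mult_right_cancel)
  also have "\<dots> \<in> R" by (intro add mult b c i)
  finally show False using nR by simp
qed

end

section \<open>Divisibility of polynomials over a field\<close>

lemma split_power:
  fixes P N :: "'a::field poly"
  assumes P: "degree P > 0" and "N \<noteq> 0"
  shows "\<exists>n C. N = P ^ n * C \<and> \<not> P dvd C"
  using assms(2)
proof (induction "degree N" arbitrary: N rule: less_induct)
  case less
  show ?case
  proof (cases "P dvd N")
    case True
    then obtain M where M: "N = P * M" by (elim dvdE)
    have nz: "M \<noteq> 0" "P \<noteq> 0" using less.prems M by simp_all
    have "degree M < degree N" unfolding M degree_mult_eq[OF nz(2,1)] using P by simp
    from less.hyps[OF this nz(1)] obtain n C where C: "M = P ^ n * C" "\<not> P dvd C" by blast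
    have "N = P ^ Suc n * C" unfolding M C(1) by (simp only: power_Suc mult.assoc)
    with C(2) show ?thesis by blast
  next
    case False
    have "N = P ^ 0 * N" by simp
    with False show ?thesis by blast
  qed
qed

lemma ex_prime_elem_dvd:
  fixes C :: "'a::field poly"
  assumes "degree C > 0"
  obtains P where "P dvd C" "prime_elem P"
proof -
  let ?S = "\<lambda>n. \<exists>P. P dvd C \<and> degree P = n \<and> n > 0"
  have ex: "?S (degree C)" using assms by (intro exI[of _ C]) simp
  \<comment> \<open>A divisor of least positive degree cannot factor further.\<close>
  define n where "n = (LEAST n. ?S n)"
  have "?S n" unfolding n_def by (rule LeastI[of ?S, OF ex])
  then obtain P where P: "P dvd C" "degree P = n" "n > 0" by blast
  have min: "n \<le> degree D" if "D dvd C" "degree D > 0" for D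
    unfolding n_def by (rule Least_le) (use that in auto)
  have "irreducible P"
  proof (rule irreducibleI)
    show "P \<noteq> 0" using P by auto
    then show "\<not> is_unit P" using P by (simp add: is_unit_iff_degree)
    fix u v assume uv: "P = u * v"
    then have nz: "u \<noteq> 0" "v \<noteq> 0" using P by auto
    have "degree u + degree v = n" using P nz by (simp add: uv degree_mult_eq)
    moreover have "degree u = 0 \<or> n \<le> degree u"
      using min[of u] P(1) uv by (metis dvd_mult_left not_gr_zero)
    ultimately have "degree u = 0 \<or> degree v = 0" by linarith
    then show "is_unit u \<or> is_unit v" using nz by (auto simp: is_unit_iff_degree)
  qed
  then show ?thesis using that P(1) field_poly_irreducible_imp_prime by blast
qed

text \<open>Bezout: a nonzero combination of P and B of least degree divides both, by division with
  remainder, and is a unit because P is prime and does not divide B.\<close>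

lemma prime_elem_inverse_mod:
  fixes P B :: "'a::field poly"
  assumes "prime_elem P" "\<not> P dvd B"
  obtains V where "P dvd V * B - 1"
proof -
  let ?S = "\<lambda>n. \<exists>U V. U * P + V * B \<noteq> 0 \<and> degree (U * P + V * B) = n"
  have "B \<noteq> 0" using assms by auto
  then have ex: "?S (degree B)" by (intro exI[of _ 0] exI[of _ 1]) simp
  define n where "n = (LEAST n. ?S n)"
  have "?S n" unfolding n_def by (rule LeastI[of ?S, OF ex])
  then obtain U V where D: "U * P + V * B \<noteq> 0" "degree (U * P + V * B) = n" by blast
  define D where "D = U * P + V * B"
  have min: "n \<le> degree (U' * P + V' * B)" if "U' * P + V' * B \<noteq> 0" for U' V'
    unfolding n_def by (rule Least_le) (use that in auto)
  have dvd: "D dvd U' * P + V' * B" for U' V'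
  proof -
    let ?W = "U' * P + V' * B"
    have r: "?W mod D = (U' - ?W div D * U) * P + (V' - ?W div D * V) * B"
      by (simp add: minus_div_mult_eq_mod[symmetric] D_def algebra_simps)
    have "?W mod D = 0"
    proof (rule ccontr)
      assume nz: "?W mod D \<noteq> 0"
      then have "degree (?W mod D) < degree D" using D by (intro degree_mod_less') (auto simp: D_def)
      moreover have "n \<le> degree (?W mod D)" using min nz unfolding r by blast
      ultimately show False using D by (simp add: D_def)
    qed
    then show ?thesis by (simp add: dvd_eq_mod_eq_0)
  qed
  have DP: "D dvd P" using dvd[of 1 0] by simp
  have DB: "D dvd B" using dvd[of 0 1] by simp
  have "is_unit D"
  proof (rule ccontr)
    assume "\<not> is_unit D"
    obtain w where w: "P = D * w" using DP by (elim dvdE)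
    have "\<not> P dvd w"
    proof
      assume "P dvd w"
      then obtain v where "w = P * v" by (elim dvdE)
      then have "P * 1 = P * (D * v)" using w by (simp add: mult_ac)
      moreover have "P \<noteq> 0" using assms(1) by auto
      ultimately have "1 = D * v" by (metis mult_left_cancel)
      then show False using \<open>\<not> is_unit D\<close> dvdI by blast
    qed
    moreover have "P dvd D \<or> P dvd w"
      using assms(1) w by (intro prime_elem_dvd_multD) simp_all
    ultimately have "P dvd D" by blast
    then show False using DB assms(2) dvd_trans by blast
  qed
  then obtain c where c: "D * c = 1" by (metis dvdE)
  have "c * V * B - 1 = P * (- c * U)" using c by (simp add: D_def algebra_simps)
  then have "P dvd c * V * B - 1" by (metis dvd_triv_left)
  then show ?thesis by (rule that)
qed

subsection \<open>Artin-Schreier curves of odd degree\<close>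

text \<open>The degree of A^2 is even, that of B^2 f is odd, and A B lies strictly below the larger
  of the two, so leading terms never cancel. The field is arbitrary because the same form is used
  over the ambient algebraically closed field in \<open>zeta_transcendental\<close>; the lower
  bounds control poles at infinity.\<close>

lemma quadratic_form_degree:
  fixes A B f :: "'a::field poly"
  assumes deg_f: "degree f = 2 * g + 1" and AB: "A \<noteq> 0 \<or> B \<noteq> 0"
  shows "A\<^sup>2 - A * B - B\<^sup>2 * f \<noteq> 0"
    and "2 * degree A \<le> degree (A\<^sup>2 - A * B - B\<^sup>2 * f)"
    and "B \<noteq> 0 \<Longrightarrow> 2 * degree B + 2 * g + 1 \<le> degree (A\<^sup>2 - A * B - B\<^sup>2 * f)"
proof -
  define N where "N = A\<^sup>2 - A * B - B\<^sup>2 * f"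
  have f_nz: "f \<noteq> 0" using deg_f by auto
  have "N \<noteq> 0 \<and> 2 * degree A \<le> degree N \<and> (B \<noteq> 0 \<longrightarrow> 2 * degree B + 2 * g + 1 \<le> degree N)"
  proof (cases "B = 0")
    case True
    then have "N = A * A" "A \<noteq> 0" using AB by (simp_all add: N_def power2_eq_square)
    then show ?thesis using True by (simp add: degree_mult_eq)
  next
    case B: False
    have dB: "degree (- (B\<^sup>2 * f)) = 2 * degree B + 2 * g + 1"
      using B f_nz deg_f by (simp add: degree_mult_eq power2_eq_square)
    have dAB: "degree (A * B) \<le> degree A + degree B" by (rule degree_mult_le)
    have dAA: "degree (A * A) \<le> degree A + degree A" by (rule degree_mult_le)
    show ?thesis
    proof (cases "degree A \<le> degree B + g")
      case True
      have "degree (A * A - A * B) \<le> 2 * degree B + 2 * g"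
        by (rule degree_diff_le) (use True dAB dAA in linarith)+
      then have "degree (A * A - A * B + - (B\<^sup>2 * f)) = degree (- (B\<^sup>2 * f))"
        by (intro degree_add_eq_right) (simp only: dB)
      then have "degree N = 2 * degree B + 2 * g + 1"
        unfolding dB by (simp add: N_def power2_eq_square)
      then show ?thesis using True by auto
    next
      case False
      then have "A \<noteq> 0" by auto
      then have dAA': "degree (A * A) = 2 * degree A" by (simp add: degree_mult_eq)
      have "degree (- (A * B) - B\<^sup>2 * f) \<le> 2 * degree A - 1"
      proof (rule degree_diff_le)
        show "degree (- (A * B)) \<le> 2 * degree A - 1" using dAB False by simp
        show "degree (B\<^sup>2 * f) \<le> 2 * degree A - 1" using dB False by simp
      qed
      then have "degree (A * A + (- (A * B) - B\<^sup>2 * f)) = degree (A * A)"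
        by (intro degree_add_eq_left) (use False dAA' in simp)
      then have "degree N = 2 * degree A"
        unfolding dAA' by (simp add: N_def power2_eq_square algebra_simps)
      then show ?thesis using False by auto
    qed
  qed
  then show "A\<^sup>2 - A * B - B\<^sup>2 * f \<noteq> 0"
    and "2 * degree A \<le> degree (A\<^sup>2 - A * B - B\<^sup>2 * f)"
    and "B \<noteq> 0 \<Longrightarrow> 2 * degree B + 2 * g + 1 \<le> degree (A\<^sup>2 - A * B - B\<^sup>2 * f)"
    unfolding N_def by blast+
qed

text \<open>\<open>\<zeta>\<close> is any root of the equation. Evenness of \<open>g\<close> makes
  the derivative of x^g vanish in \<open>dform_regular\<close>.\<close>

locale artin_schreier_curve =
  fixes f :: "'k::{field,finite} poly" and \<zeta> :: "'k rat_closure" and g :: nat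
  assumes two_k: "(2::'k) = 0" and deg_f: "degree f = 2 * g + 1"
    and root: "\<zeta>\<^sup>2 + \<zeta> = emb_poly f" and g: "g \<ge> 1" "even g"
begin

abbreviation e :: "'k poly \<Rightarrow> 'k rat_closure" where "e \<equiv> emb_poly"
abbreviation x :: "'k rat_closure" where "x \<equiv> emb_poly [:0, 1:]"
definition K :: "'k rat_closure set" where "K = is_subfield hull (range emb_const \<union> {x, \<zeta>})"

lemma two_poly: "(2::'k poly) = 0"
  by (simp add: numeral_poly two_k)

lemma two_ac: "(2::'k rat_closure) = 0"
proof -
  have "e (1 + 1) = 1 + 1" by (simp only: emb_poly_add emb_poly_1)
  moreover have "1 + 1 = (0::'k poly)" using two_poly by (simp only: one_add_one)
  ultimately have "1 + 1 = (0::'k rat_closure)" by (simp only: emb_poly_0)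
  then show ?thesis by (simp only: one_add_one)
qed

lemma dbl_ac: "u + u = (0::'k rat_closure)"
  by (rule add_self_char2[OF two_ac])

lemma f_nz: "f \<noteq> 0"
  using deg_f by auto

definition lin :: "'k poly \<Rightarrow> 'k poly \<Rightarrow> 'k rat_closure" where
  "lin A B = e A + e B * \<zeta>"

text \<open>The norm of A + B \<zeta> down to k(x). The conjugate of \<zeta> is -1 - \<zeta>, so
  that of \<open>lin A B\<close> is \<open>lin (A - B) (- B)\<close>.\<close>

definition nrm :: "'k poly \<Rightarrow> 'k poly \<Rightarrow> 'k poly" where
  "nrm A B = A\<^sup>2 - A * B - B\<^sup>2 * f"

lemma zeta_sq: "\<zeta> * \<zeta> = e f - \<zeta>"
  using root by (simp add: power2_eq_square algebra_simps)

lemma lin_add: "lin A B + lin C D = lin (A + C) (B + D)"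
  by (simp add: lin_def algebra_simps)

lemma lin_minus: "- lin A B = lin (- A) (- B)"
  by (simp add: lin_def)

lemma lin_diff: "lin A B - lin C D = lin (A - C) (B - D)"
  by (simp add: lin_def algebra_simps)

lemma lin_mult: "lin A B * lin C D = lin (A * C + B * D * f) (A * D + B * C - B * D)"
proof -
  have "lin A B * lin C D = e A * e C + (e A * e D + e B * e C) * \<zeta> + e B * e D * (\<zeta> * \<zeta>)"
    by (simp add: lin_def algebra_simps)
  then show ?thesis
    unfolding zeta_sq by (simp add: lin_def algebra_simps)
qed

lemma lin_square: "lin A B * lin A B = lin (A * A + B * B * f) (- (B * B))"
  unfolding lin_mult by (simp add: mult.commute two_poly)

lemma lin_0: "lin A 0 = e A"
  by (simp add: lin_def)

lemma e_lin: "e C * lin A B = lin (C * A) (C * B)"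
  by (simp add: lin_def algebra_simps)

lemma lin_conj: "lin A B * lin (A - B) (- B) = e (nrm A B)"
proof -
  have "A * (A - B) + B * (- B) * f = nrm A B" "A * (- B) + B * (A - B) - B * (- B) = 0"
    by (simp_all add: nrm_def power2_eq_square algebra_simps)
  then show ?thesis unfolding lin_mult by (simp add: lin_0)
qed

lemma nrm_mult: "nrm (A * C + B * D * f) (A * D + B * C - B * D) = nrm A B * nrm C D"
  by (simp add: nrm_def power2_eq_square algebra_simps)

lemma nrm_degree:
  assumes "A \<noteq> 0 \<or> B \<noteq> 0"
  shows "nrm A B \<noteq> 0" and "2 * degree A \<le> degree (nrm A B)"
    and "B \<noteq> 0 \<Longrightarrow> 2 * degree B + 2 * g + 1 \<le> degree (nrm A B)"
  unfolding nrm_def using quadratic_form_degree[OF deg_f assms] by blast+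

text \<open>Anisotropy of the norm makes 1 and \<zeta> linearly independent over k[x]; coefficients
  can be compared from here on.\<close>

lemma lin_eq_0_iff: "lin A B = 0 \<longleftrightarrow> A = 0 \<and> B = 0"
proof
  assume "lin A B = 0"
  then have "e (nrm A B) = 0" using lin_conj[of A B] by simp
  then have "nrm A B = 0" by simp
  then show "A = 0 \<and> B = 0" using nrm_degree(1) by blast
qed (simp add: lin_def)

lemma lin_eq_iff: "lin A B = lin C D \<longleftrightarrow> A = C \<and> B = D"
  using lin_eq_0_iff[of "A - C" "B - D"] unfolding lin_diff[symmetric] by simp

lemma subfield_K: "is_subfield K"
  unfolding K_def by (rule is_subfield_hull)

lemma const_K: "emb_const c \<in> K" and x_K: "x \<in> K" and zeta_K: "\<zeta> \<in> K"
  unfolding K_def by (rule hull_inc; simp)+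

lemma e_in:
  assumes "\<And>c. emb_const c \<in> S" "x \<in> S" "\<And>u v. u \<in> S \<Longrightarrow> v \<in> S \<Longrightarrow> u + v \<in> S"
    "\<And>u v. u \<in> S \<Longrightarrow> v \<in> S \<Longrightarrow> u * v \<in> S"
  shows "e p \<in> S"
proof (induction p)
  case 0
  show ?case using assms(1)[of 0] by simp
next
  case (pCons c p)
  show ?case unfolding emb_poly_pCons[of c p] by (intro assms pCons.IH)
qed

lemma K_add: "u \<in> K \<Longrightarrow> v \<in> K \<Longrightarrow> u + v \<in> K" and K_mult: "u \<in> K \<Longrightarrow> v \<in> K \<Longrightarrow> u * v \<in> K"
  and K_inverse: "u \<in> K \<Longrightarrow> inverse u \<in> K"
  using subfield_K unfolding is_subfield_def by blast+

lemma e_K: "e p \<in> K"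
  by (rule e_in) (intro const_K x_K K_add K_mult; assumption)+

lemma lin_K: "lin A B \<in> K"
  unfolding lin_def by (intro K_add K_mult e_K zeta_K)

text \<open>The fractions are closed under inversion: multiplying by the conjugate moves \<zeta> out
  of the denominator, and the norm is nonzero.\<close>

lemma K_eq: "K = {lin A B / e C | A B C. C \<noteq> 0}"
proof
  let ?S = "{lin A B / e C | A B C. C \<noteq> 0}"
  show "?S \<subseteq> K" by (auto intro!: is_subfield_divide[OF subfield_K] lin_K e_K)
  have I: "lin A B / e C \<in> ?S" if "C \<noteq> 0" for A B C using that by blast
  show "K \<subseteq> ?S"
    unfolding K_def
  proof (rule hull_minimal)
    have I1: "lin A B / e 1 \<in> ?S" for A B by (rule I) simp
    have "emb_const c \<in> ?S" for c using I1[of "[:c:]" 0] by (simp add: lin_def emb_const_def)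
    moreover have "x \<in> ?S" using I1[of "[:0, 1:]" 0] by (simp add: lin_def)
    moreover have "\<zeta> \<in> ?S" using I1[of 0 1] by (simp add: lin_def)
    ultimately show "range emb_const \<union> {x, \<zeta>} \<subseteq> ?S" by blast
    show "is_subfield ?S"
      unfolding is_subfield_def
    proof (intro conjI ballI)
      show "0 \<in> ?S" using I[of 1 0 0] by (simp add: lin_def)
      show "1 \<in> ?S" using I[of 1 1 0] by (simp add: lin_def)
      fix u assume "u \<in> ?S"
      then obtain A B C where u: "u = lin A B / e C" "C \<noteq> 0" by blast
      have "- u = lin (- A) (- B) / e C" by (simp add: u lin_minus[symmetric])
      then show "- u \<in> ?S" using I[OF u(2)] by simp
      show "inverse u \<in> ?S"
      proof (cases "A = 0 \<and> B = 0")
        case True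
        then have "inverse u = 0" by (simp add: u lin_def)
        then show ?thesis using I[of 1 0 0] by (simp add: lin_def)
      next
        case False
        then have nz: "lin A B \<noteq> 0" "nrm A B \<noteq> 0" using lin_eq_0_iff nrm_degree(1) by blast+
        then have "lin (A - B) (- B) \<noteq> 0" using lin_conj[of A B] by (metis emb_poly_eq_0_iff mult_zero_right)
        have "inverse u = e C / lin A B" by (simp add: u)
        also have "\<dots> = e C * lin (A - B) (- B) / e (nrm A B)"
          using nz \<open>lin (A - B) (- B) \<noteq> 0\<close> by (simp add: lin_conj[symmetric])
        finally have "inverse u = lin (C * (A - B)) (C * - B) / e (nrm A B)" unfolding e_lin .
        then show ?thesis using I[OF nz(2)] by simp
      qed
      fix v assume "v \<in> ?S"
      then obtain A' B' C' where v: "v = lin A' B' / e C'" "C' \<noteq> 0" by blast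
      have nz: "C * C' \<noteq> 0" using u v by simp
      have "u + v = (e C' * lin A B + e C * lin A' B') / e (C * C')"
        using u v by (simp add: field_simps)
      then show "u + v \<in> ?S" unfolding e_lin lin_add using I[OF nz] by simp
      have "u * v = (lin A B * lin A' B') / e (C * C')" using u v by simp
      then show "u * v \<in> ?S" unfolding lin_mult using I[OF nz] by simp
    qed
  qed
qed

section \<open>The affine coordinate ring and its localizations\<close>

definition affine_ring :: "'k rat_closure set" where
  "affine_ring = {lin A B | A B. True}"

lemma lin_affine: "lin A B \<in> affine_ring"
  by (auto simp: affine_ring_def)

lemma e_affine: "e A \<in> affine_ring"
  using lin_affine[of A 0] by (simp add: lin_0)

lemma affine_mult: "u \<in> affine_ring \<Longrightarrow> v \<in> affine_ring \<Longrightarrow> u * v \<in> affine_ring"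
proof -
  assume "u \<in> affine_ring" "v \<in> affine_ring"
  then obtain A B C D where "u = lin A B" "v = lin C D" unfolding affine_ring_def by blast
  then show ?thesis by (simp only: lin_mult lin_affine)
qed

lemma affine_add: "u \<in> affine_ring \<Longrightarrow> v \<in> affine_ring \<Longrightarrow> u + v \<in> affine_ring"
proof -
  assume "u \<in> affine_ring" "v \<in> affine_ring"
  then obtain A B C D where "u = lin A B" "v = lin C D" unfolding affine_ring_def by blast
  then show ?thesis by (simp only: lin_add lin_affine)
qed

text \<open>A prime ideal of k[x, \<zeta>] whose contraction to k[x] is generated by
  \<open>P\<close>. The positive degree makes it proper and nonzero.\<close>

definition prime_over :: "'k poly \<Rightarrow> 'k rat_closure set \<Rightarrow> bool" where
  "prime_over P M \<longleftrightarrow> M \<subseteq> affine_ring \<and> (\<forall>u\<in>M. \<forall>v\<in>M. u + v \<in> M) \<and>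
     (\<forall>u\<in>M. \<forall>v\<in>affine_ring. u * v \<in> M) \<and>
     (\<forall>u\<in>affine_ring. \<forall>v\<in>affine_ring. u * v \<in> M \<longrightarrow> u \<in> M \<or> v \<in> M) \<and>
     (\<forall>r. e r \<in> M \<longleftrightarrow> P dvd r) \<and> degree P > 0"

definition local_ring :: "'k rat_closure set \<Rightarrow> 'k rat_closure set" where
  "local_ring M = {u / v | u v. u \<in> affine_ring \<and> v \<in> affine_ring - M}"

context
  fixes P M assumes PM: "prime_over P M"
begin

lemma M_sub: "M \<subseteq> affine_ring"
  and M_add: "u \<in> M \<Longrightarrow> v \<in> M \<Longrightarrow> u + v \<in> M"
  and M_mult: "u \<in> M \<Longrightarrow> v \<in> affine_ring \<Longrightarrow> u * v \<in> M"
  and M_prime: "u \<in> affine_ring \<Longrightarrow> v \<in> affine_ring \<Longrightarrow> u * v \<in> M \<Longrightarrow> u \<in> M \<or> v \<in> M"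
  and e_M: "e r \<in> M \<longleftrightarrow> P dvd r"
  and deg_P: "degree P > 0"
  using PM unfolding prime_over_def by auto

lemma M_diff: "u \<in> M \<Longrightarrow> v \<in> M \<Longrightarrow> u - v \<in> M"
  using M_add[of u "v * e (- 1)"] M_mult[of v "e (- 1)"] e_affine[of "- 1"] by simp

lemma P_nz: "P \<noteq> 0"
  using deg_P by auto

lemma P_nunit: "\<not> P dvd 1"
  using deg_P P_nz by (simp add: is_unit_iff_degree)

lemma one_diff_M: "1 \<in> affine_ring - M"
  using e_affine[of 1] e_M[of 1] P_nunit by simp

lemma zero_M: "0 \<in> M"
  using e_M[of 0] by simp

lemma diff_M_mult: "u \<in> affine_ring - M \<Longrightarrow> v \<in> affine_ring - M \<Longrightarrow> u * v \<in> affine_ring - M"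
  using affine_mult[of u v] M_prime[of u v] by blast

lemma diff_M_nz: "u \<in> affine_ring - M \<Longrightarrow> u \<noteq> 0"
  using zero_M by auto

text \<open>If \<open>A\<close> and \<open>B\<close> are not both divisible by \<open>P\<close>, then \<open>A + B \<zeta>\<close> and its conjugate cannot
  both lie in \<open>M\<close>: in characteristic 2 their difference is \<open>B\<close>.\<close>
lemma affine_decomp:
  assumes "A \<noteq> 0 \<or> B \<noteq> 0"
  shows "\<exists>n. \<exists>b\<in>affine_ring - M. \<exists>c\<in>affine_ring - M. lin A B * c = e P ^ n * b"
  using assms
proof (induction "degree A + degree B" arbitrary: A B rule: less_induct)
  case less
  show ?case
  proof (cases "P dvd A \<and> P dvd B")
    case True
    then obtain A' B' where A': "A = P * A'" and B': "B = P * B'" by (auto elim!: dvdE)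
    have nz: "A' \<noteq> 0 \<or> B' \<noteq> 0" using less.prems A' B' by auto
    have d: "degree A' \<le> degree A" "degree B' \<le> degree B"
      "A' \<noteq> 0 \<longrightarrow> degree A' < degree A" "B' \<noteq> 0 \<longrightarrow> degree B' < degree B"
      using deg_P P_nz by (cases "A' = 0"; cases "B' = 0"; simp add: A' B' degree_mult_eq)+
    have "degree A' + degree B' < degree A + degree B" using d nz by linarith
    from less.hyps[OF this nz] obtain n b c where
      *: "b \<in> affine_ring - M" "c \<in> affine_ring - M" "lin A' B' * c = e P ^ n * b" by blast
    have "lin A B * c = e P ^ Suc n * b"
      unfolding A' B' e_lin[symmetric] by (simp only: power_Suc mult.assoc *(3))
    then show ?thesis using * by blast
  next
    case nd: False
    show ?thesis
    proof (cases "lin A B \<in> M")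
      case False
      have "lin A B * 1 = e P ^ 0 * lin A B" by simp
      then show ?thesis using False lin_affine one_diff_M by blast
    next
      case True
      have conj: "lin (A - B) (- B) \<notin> M"
      proof
        assume "lin (A - B) (- B) \<in> M"
        then have "lin A B - lin (A - B) (- B) \<in> M" by (rule M_diff[OF True])
        also have "lin A B - lin (A - B) (- B) = e B"
          unfolding lin_diff using lin_0[of B] add_self_char2[OF two_poly, of B] by (simp add: two_poly)
        finally have eB: "e B \<in> M" .
        then have "e B * lin 0 1 \<in> M" using lin_affine by (rule M_mult)
        then have "lin A B - e B * lin 0 1 \<in> M" by (rule M_diff[OF True])
        also have "lin A B - e B * lin 0 1 = e A" by (simp add: lin_def)
        finally show False using eB nd by (simp add: e_M)
      qed
      obtain n C where C: "nrm A B = P ^ n * C" "\<not> P dvd C"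
        using split_power[OF deg_P nrm_degree(1)[OF less.prems]] by blast
      have "lin A B * lin (A - B) (- B) = e P ^ n * e C" by (simp add: lin_conj C)
      then show ?thesis using conj lin_affine e_affine C e_M by blast
    qed
  qed
qed

text \<open>The affine curve is unramified over the line, so \<open>P\<close> is a uniformizer at
  each place over it: every nonzero u is an integer power of P times a quotient of elements outside
  \<open>M\<close>. The disjunction avoids negative exponents.\<close>

lemma K_decomp:
  assumes "u \<in> K" "u \<noteq> 0"
  shows "\<exists>n. \<exists>b\<in>affine_ring - M. \<exists>c\<in>affine_ring - M. u * c = e P ^ n * b \<or> u * e P ^ n * c = b"
proof -
  obtain A B C where u: "u = lin A B / e C" and C: "C \<noteq> 0"
    using assms(1) unfolding K_eq by blast
  have "A \<noteq> 0 \<or> B \<noteq> 0" using assms(2) u by (auto simp: lin_def)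
  from affine_decomp[OF this] obtain n b c where
    *: "b \<in> affine_ring - M" "c \<in> affine_ring - M" "lin A B * c = e P ^ n * b" by blast
  obtain m D where D: "C = P ^ m * D" "\<not> P dvd D" using split_power[OF deg_P C] by blast
  have eD: "e D \<in> affine_ring - M" using e_affine e_M D by blast
  have "u * e C = lin A B" using u C by simp
  then have "u * e P ^ m * (e D * c) = lin A B * c" by (simp add: D mult_ac)
  then have eq: "u * e P ^ m * (e D * c) = e P ^ n * b" using * by simp
  have Dc: "e D * c \<in> affine_ring - M" by (rule diff_M_mult[OF eD *(2)])
  have eP: "e P ^ k \<noteq> 0" for k using P_nz by simp
  show ?thesis
  proof (cases "m \<le> n")
    case True
    then have "e P ^ n = e P ^ m * e P ^ (n - m)" by (simp flip: power_add)
    then have "e P ^ m * (u * (e D * c)) = e P ^ m * (e P ^ (n - m) * b)"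
      using eq by (simp add: mult_ac)
    then have "u * (e D * c) = e P ^ (n - m) * b" using eP by (metis mult_left_cancel)
    then show ?thesis using *(1) Dc by blast
  next
    case False
    then have "e P ^ m = e P ^ n * e P ^ (m - n)" by (simp flip: power_add)
    then have "e P ^ n * (u * e P ^ (m - n) * (e D * c)) = e P ^ n * b"
      using eq by (simp add: mult_ac)
    then have "u * e P ^ (m - n) * (e D * c) = b" using eP by (metis mult_left_cancel)
    then show ?thesis using *(1) Dc by blast
  qed
qed

lemma inverse_P_notin: "u \<in> M \<Longrightarrow> u \<noteq> 0 \<Longrightarrow> v \<in> affine_ring - M \<Longrightarrow> v / u \<notin> local_ring M"
proof
  assume u: "u \<in> M" "u \<noteq> 0" and v: "v \<in> affine_ring - M" and "v / u \<in> local_ring M"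
  then obtain b c where bc: "b \<in> affine_ring" "c \<in> affine_ring - M" "v / u = b / c"
    unfolding local_ring_def by blast
  have "c \<noteq> 0" using bc(2) by (rule diff_M_nz)
  then have "v * c = u * b" using bc(3) u by (simp add: field_simps)
  moreover have "u * b \<in> M" by (rule M_mult[OF u(1) bc(1)])
  moreover have "v * c \<in> affine_ring - M" by (rule diff_M_mult[OF v bc(2)])
  ultimately show False by simp
qed

lemma affine_local: "u \<in> affine_ring \<Longrightarrow> u \<in> local_ring M"
proof -
  assume "u \<in> affine_ring"
  then have "u / 1 \<in> local_ring M" unfolding local_ring_def using one_diff_M by blast
  then show ?thesis by simp
qed

lemma affine_sub_K: "affine_ring \<subseteq> K"
  unfolding affine_ring_def using lin_K by blast

lemma const_affine: "emb_const c \<in> affine_ring"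
  using e_affine[of "[:c:]"] by (simp add: emb_const_def)

lemma local_ring_closed_point: "local_ring M \<in> closed_points K"
  unfolding closed_points_def
proof (intro CollectI conjI ballI)
  show "range emb_const \<subseteq> local_ring M" using const_affine affine_local by blast
  have "local_ring M \<subseteq> K"
  proof
    fix w assume "w \<in> local_ring M"
    then obtain b c where "w = b / c" "b \<in> affine_ring" "c \<in> affine_ring"
      unfolding local_ring_def by blast
    then show "w \<in> K" using affine_sub_K is_subfield_divide[OF subfield_K, of b c] by blast
  qed
  moreover have "1 / e P \<in> K" by (intro is_subfield_divide[OF subfield_K] e_K) (use e_K[of 1] in simp)
  moreover have "1 / e P \<notin> local_ring M"
    by (rule inverse_P_notin) (use e_M P_nz one_diff_M in auto)
  ultimately show "local_ring M \<subset> K" by blast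
  fix u assume "u \<in> local_ring M"
  then obtain b c where u: "u = b / c" "b \<in> affine_ring" "c \<in> affine_ring - M"
    unfolding local_ring_def by blast
  fix v assume "v \<in> local_ring M"
  then obtain b' c' where v: "v = b' / c'" "b' \<in> affine_ring" "c' \<in> affine_ring - M"
    unfolding local_ring_def by blast
  have nz: "c \<noteq> 0" "c' \<noteq> 0" using diff_M_nz[OF u(3)] diff_M_nz[OF v(3)] .
  have cc: "c * c' \<in> affine_ring - M" by (rule diff_M_mult[OF u(3) v(3)])
  have "u + v = (b * c' + b' * c) / (c * c')" unfolding u(1) v(1) by (rule add_frac_eq[OF nz])
  moreover have "b * c' + b' * c \<in> affine_ring" using u(2,3) v(2,3) by (intro affine_add affine_mult) auto
  ultimately show "u + v \<in> local_ring M" unfolding local_ring_def using cc by blast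
  have "u * v = (b * b') / (c * c')" unfolding u(1) v(1) by (rule times_divide_times_eq)
  moreover have "b * b' \<in> affine_ring" using u(2) v(2) by (rule affine_mult)
  ultimately show "u * v \<in> local_ring M" unfolding local_ring_def using cc by blast
next
  fix u assume uK: "u \<in> K"
  show "u \<in> local_ring M \<or> inverse u \<in> local_ring M"
  proof (cases "u = 0")
    case True
    then show ?thesis using affine_local[of 0] M_sub zero_M by auto
  next
    case False
    from K_decomp[OF uK False] obtain n b c where
      bc: "b \<in> affine_ring - M" "c \<in> affine_ring - M" "u * c = e P ^ n * b \<or> u * e P ^ n * c = b" by blast
    have nz: "b \<noteq> 0" "c \<noteq> 0" using diff_M_nz[OF bc(1)] diff_M_nz[OF bc(2)] .
    have eP: "e P ^ n \<in> affine_ring" using e_affine[of "P ^ n"] by simp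
    show ?thesis
      using bc(3)
    proof
      assume "u * c = e P ^ n * b"
      then have "u = e P ^ n * b / c" using nz by (metis nonzero_mult_div_cancel_right)
      moreover have "e P ^ n * b \<in> affine_ring" using bc by (intro affine_mult eP) blast
      ultimately show ?thesis unfolding local_ring_def using bc by blast
    next
      assume eq: "u * e P ^ n * c = b"
      have "u * (e P ^ n * c / b) = u * e P ^ n * c / b" by (simp add: mult.assoc)
      then have "u * (e P ^ n * c / b) = 1" unfolding eq using nz by simp
      then have "inverse u = e P ^ n * c / b" by (rule inverse_unique)
      moreover have "e P ^ n * c \<in> affine_ring" using bc by (intro affine_mult eP) blast
      ultimately show ?thesis unfolding local_ring_def using bc by blast
    qed
  qed
qed

lemma max_local:
  assumes "u \<in> M" "c \<in> affine_ring - M"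
  shows "u / c \<in> maximal_ideal_of (local_ring M)"
proof -
  have "u / c \<in> local_ring M" unfolding local_ring_def using assms M_sub by blast
  moreover have "inverse (u / c) \<notin> local_ring M" if "u / c \<noteq> 0"
    using inverse_P_notin[of u c] assms that by auto
  ultimately show ?thesis unfolding maximal_ideal_of_def by blast
qed

text \<open>\<open>M\<close> can be recovered from its localization; this is what separates distinct
  points in \<open>affine_point_inj\<close>.\<close>

lemma max_local_affine: "maximal_ideal_of (local_ring M) \<inter> affine_ring = M"
proof
  show "M \<subseteq> maximal_ideal_of (local_ring M) \<inter> affine_ring"
    using max_local[OF _ one_diff_M] M_sub by auto
  show "maximal_ideal_of (local_ring M) \<inter> affine_ring \<subseteq> M"
  proof (rule subsetI, rule ccontr)
    fix u assume u: "u \<in> maximal_ideal_of (local_ring M) \<inter> affine_ring" "u \<notin> M"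
    then have "1 / u \<in> local_ring M" unfolding local_ring_def using one_diff_M by blast
    then show False using u zero_M by (auto simp: maximal_ideal_of_def divide_inverse)
  qed
qed

end
end

lemma dvd_diff_cong: "(P::'a::comm_ring_1) dvd v \<Longrightarrow> w = u - v \<Longrightarrow> P dvd w \<longleftrightarrow> P dvd u"
  using dvd_diff[of P u v] dvd_add[of P w v] by auto

context artin_schreier_curve
begin

lemma prime_overI:
  assumes "M \<subseteq> affine_ring" "\<And>u v. u \<in> M \<Longrightarrow> v \<in> M \<Longrightarrow> u + v \<in> M"
    "\<And>u v. u \<in> M \<Longrightarrow> v \<in> affine_ring \<Longrightarrow> u * v \<in> M"
    "\<And>u v. u \<in> affine_ring \<Longrightarrow> v \<in> affine_ring \<Longrightarrow> u * v \<in> M \<Longrightarrow> u \<in> M \<or> v \<in> M"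
    "\<And>r. e r \<in> M \<longleftrightarrow> P dvd r" "degree P > 0"
  shows "prime_over P M"
  using assms unfolding prime_over_def by simp

lemma affineE: "u \<in> affine_ring \<Longrightarrow> (\<And>A B. u = lin A B \<Longrightarrow> thesis) \<Longrightarrow> thesis"
  unfolding affine_ring_def by blast

lemma affine_sub_closed_point:
  assumes R: "R \<in> closed_points K" and x: "x \<in> R"
  shows "affine_ring \<subseteq> R"
proof
  interpret closed_point K R by standard (rule subfield_K R)+
  have eR: "e p \<in> R" for p by (rule e_in) (intro const x add mult; assumption)+
  have "\<zeta> \<in> R"
    by (rule integral[OF zeta_K minus[OF one] eR[of f]]) (simp add: power2_eq_square zeta_sq)
  then show "u \<in> R" if "u \<in> affine_ring" for u
    using that by (elim affineE) (simp add: lin_def add mult eR)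
qed

text \<open>The maximal ideal meets k[x] nontrivially, since otherwise all denominators would be
  units and R would be K. A nonzero polynomial of least degree in it generates the contraction, and
  \<open>K_decomp\<close> then leaves no room between R and the localization.\<close>

lemma finite_closed_point:
  assumes R: "R \<in> closed_points K" and x: "x \<in> R"
  obtains P where "prime_over P (maximal_ideal_of R \<inter> affine_ring)"
    "R = local_ring (maximal_ideal_of R \<inter> affine_ring)"
proof -
  interpret closed_point K R by standard (rule subfield_K R)+
  have aff: "u \<in> R" if "u \<in> affine_ring" for u
    using affine_sub_closed_point[OF R x] that by blast
  let ?S = "\<lambda>n. \<exists>p. p \<noteq> 0 \<and> e p \<in> \<mm> \<and> degree p = n"
  have "\<exists>p. p \<noteq> 0 \<and> e p \<in> \<mm>"
  proof (rule ccontr)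
    assume n: "\<not> (\<exists>p. p \<noteq> 0 \<and> e p \<in> \<mm>)"
    have "K \<subseteq> R"
    proof
      fix u assume "u \<in> K"
      then obtain A B C where u: "u = lin A B / e C" and C: "C \<noteq> 0" unfolding K_eq by blast
      have "e C \<notin> \<mm>" using n C by blast
      then have "inverse (e C) \<in> R" by (rule unit[OF aff[OF e_affine]])
      then show "u \<in> R" unfolding u divide_inverse by (rule mult[OF aff[OF lin_affine]])
    qed
    then show False using sub proper by blast
  qed
  then have ex: "\<exists>n. ?S n" by blast
  define n where "n = (LEAST n. ?S n)"
  have "?S n" unfolding n_def using ex by (rule LeastI_ex)
  then obtain P where P: "P \<noteq> 0" "e P \<in> \<mm>" "degree P = n" by blast
  have min: "n \<le> degree p" if "p \<noteq> 0" "e p \<in> \<mm>" for p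
    unfolding n_def by (rule Least_le) (use that in blast)
  have eP: "e r \<in> \<mm> \<longleftrightarrow> P dvd r" for r
  proof
    assume "P dvd r"
    then obtain s where "r = P * s" by (elim dvdE)
    then show "e r \<in> \<mm>" using max_mult[OF P(2) aff[OF e_affine[of s]]] by simp
  next
    assume r: "e r \<in> \<mm>"
    have "e (r mod P) = e r - e P * e (r div P)"
      by (simp flip: emb_poly_mult emb_poly_diff add: minus_mult_div_eq_mod)
    also have "\<dots> \<in> \<mm>" by (intro max_diff max_mult r P aff e_affine)
    finally have "e (r mod P) \<in> \<mm>" .
    then have "r mod P = 0"
      using min[of "r mod P"] degree_mod_less'[OF P(1), of r] P(3) by fastforce
    then show "P dvd r" by (simp add: dvd_eq_mod_eq_0)
  qed
  have dP: "degree P > 0"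
  proof (rule ccontr)
    assume "\<not> degree P > 0"
    then have "is_unit P" using P(1) by (simp add: is_unit_iff_degree)
    then have "e 1 \<in> \<mm>" using eP by blast
    then show False using one_max by simp
  qed
  let ?M = "\<mm> \<inter> affine_ring"
  have PM: "prime_over P ?M"
  proof (rule prime_overI)
    show "u + v \<in> ?M" if "u \<in> ?M" "v \<in> ?M" for u v
      using that max_add affine_add by simp
    show "u * v \<in> ?M" if "u \<in> ?M" "v \<in> affine_ring" for u v
      using that max_mult[OF _ aff] affine_mult by simp
    show "u \<in> ?M \<or> v \<in> ?M" if "u \<in> affine_ring" "v \<in> affine_ring" "u * v \<in> ?M" for u v
      using that max_prime[OF aff aff, of u v] by blast
  qed (use eP e_affine dP in auto)
  have "R = local_ring ?M"
  proof
    show "local_ring ?M \<subseteq> R"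
    proof
      fix w assume "w \<in> local_ring ?M"
      then obtain u v where w: "w = u / v" "u \<in> affine_ring" "v \<in> affine_ring" "v \<notin> \<mm>"
        unfolding local_ring_def by blast
      have "inverse v \<in> R" by (rule unit[OF aff[OF w(3)] w(4)])
      then show "w \<in> R" unfolding w(1) divide_inverse by (rule mult[OF aff[OF w(2)]])
    qed
    show "R \<subseteq> local_ring ?M"
    proof
      fix u assume u: "u \<in> R"
      show "u \<in> local_ring ?M"
      proof (cases "u = 0")
        case True
        then show ?thesis using affine_local[OF PM, of 0] e_affine[of 0] by simp
      next
        case False
        have "u \<in> K" using u sub by blast
        from K_decomp[OF PM this False] obtain n b c where
          bc: "b \<in> affine_ring - ?M" "c \<in> affine_ring - ?M" "u * c = e P ^ n * b \<or> u * e P ^ n * c = b"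
          by blast
        have c0: "c \<noteq> 0" using diff_M_nz[OF PM bc(2)] .
        have "u * c = e P ^ n * b \<or> u * c = e P ^ 0 * b"
        proof (cases "n = 0 \<or> u * c = e P ^ n * b")
          case True
          then show ?thesis using bc(3) by auto
        next
          case n: False
          then obtain m where m: "n = Suc m" by (cases n) auto
          \<comment> \<open>A genuine pole is impossible: b would be P times an element of R and
            hence lie in the maximal ideal.\<close>
          have "b = e P * (u * e P ^ m * c)" using bc(3) n m by (simp add: mult_ac)
          also have "\<dots> \<in> \<mm>" using bc by (intro max_mult P mult u power aff e_affine) blast
          finally show ?thesis using bc by blast
        qed
        then obtain k where "u * c = e P ^ k * b" by blast
        then have "u = e P ^ k * b / c" using c0 by (simp add: eq_divide_eq)
        moreover have "e P ^ k * b \<in> affine_ring"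
          using bc e_affine[of "P ^ k"] by (intro affine_mult) auto
        ultimately show ?thesis unfolding local_ring_def using bc by blast
      qed
    qed
  qed
  with PM show ?thesis by (rule that)
qed

lemma prime_elem_degree: "prime_elem (P :: 'k poly) \<Longrightarrow> degree P > 0"
  using is_unit_iff_degree[of P] prime_elem_not_unit[of P] prime_elem_not_zeroI[of P] by blast

text \<open>The kernel of the map from k[x, \<zeta>] to k[x] / (P) that sends \<zeta> to S, provided
  that S solves the equation of \<zeta> modulo P.\<close>

definition split_ideal :: "'k poly \<Rightarrow> 'k poly \<Rightarrow> 'k rat_closure set" where
  "split_ideal P S = {lin A B | A B. P dvd A + B * S}"

lemma lin_split_ideal: "lin A B \<in> split_ideal P S \<longleftrightarrow> P dvd A + B * S"
  by (auto simp: split_ideal_def lin_eq_iff)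

text \<open>Sending \<zeta> to S is multiplicative up to the defect B D (S^2 + S - f), which P
  divides; primality is then inherited from P.\<close>

lemma prime_over_split:
  assumes P: "prime_elem P" and S: "P dvd S\<^sup>2 + S - f"
  shows "prime_over P (split_ideal P S)"
proof -
  have key: "lin A B * lin C D \<in> split_ideal P S \<longleftrightarrow> P dvd (A + B * S) * (C + D * S)" for A B C D
  proof -
    have "(A * C + B * D * f) + (A * D + B * C - B * D) * S = (A + B * S) * (C + D * S) - B * D * (S\<^sup>2 + S - f)"
      by (simp add: power2_eq_square algebra_simps)
    moreover have "P dvd B * D * (S\<^sup>2 + S - f)" using S by (rule dvd_mult)
    ultimately show ?thesis unfolding lin_mult lin_split_ideal by (intro dvd_diff_cong)
  qed
  show ?thesis
  proof (rule prime_overI)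
    show "split_ideal P S \<subseteq> affine_ring" unfolding split_ideal_def using lin_affine by blast
    then have sub: "u \<in> affine_ring" if "u \<in> split_ideal P S" for u using that by blast
    show "u + v \<in> split_ideal P S" if u: "u \<in> split_ideal P S" and v: "v \<in> split_ideal P S" for u v
    proof -
      obtain A B where A: "u = lin A B" using sub[OF u] by (elim affineE)
      obtain C D where C: "v = lin C D" using sub[OF v] by (elim affineE)
      have eq: "(A + C) + (B + D) * S = (A + B * S) + (C + D * S)" by (simp add: algebra_simps)
      show ?thesis using u v unfolding A C lin_add lin_split_ideal eq by (rule dvd_add)
    qed
    show "u * v \<in> split_ideal P S" if u: "u \<in> split_ideal P S" and v: "v \<in> affine_ring" for u v
    proof -
      obtain A B where A: "u = lin A B" using sub[OF u] by (elim affineE)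
      obtain C D where C: "v = lin C D" using v by (elim affineE)
      show ?thesis using u unfolding A C key by (simp add: lin_split_ideal)
    qed
    show "u \<in> split_ideal P S \<or> v \<in> split_ideal P S"
      if u: "u \<in> affine_ring" and v: "v \<in> affine_ring" and uv: "u * v \<in> split_ideal P S" for u v
    proof -
      obtain A B where A: "u = lin A B" using u by (elim affineE)
      obtain C D where C: "v = lin C D" using v by (elim affineE)
      show ?thesis using uv prime_elem_dvd_multD[OF P] unfolding A C key lin_split_ideal by blast
    qed
    show "e r \<in> split_ideal P S \<longleftrightarrow> P dvd r" for r
      using lin_split_ideal[of r 0] by (simp add: lin_0)
  qed (rule prime_elem_degree[OF P])
qed

text \<open>If P did not divide B, then with V inverse to B modulo P the element -A V would be a
  root of S^2 + S - f modulo P.\<close>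

lemma prime_dvd_nrm:
  assumes P: "prime_elem P" and inert: "\<And>S. \<not> P dvd S\<^sup>2 + S - f" and dvd: "P dvd nrm A B"
  shows "P dvd A \<and> P dvd B"
proof (cases "P dvd B")
  case True
  then have "P dvd A * B + B\<^sup>2 * f" by (simp add: power2_eq_square)
  from dvd_add[OF dvd this] have "P dvd A * A" by (simp add: nrm_def power2_eq_square)
  then show ?thesis using True prime_elem_dvd_multD[OF P] by blast
next
  case False
  then obtain V where V: "P dvd V * B - 1" using prime_elem_inverse_mod[OF P] by blast
  obtain W where W: "V * B - 1 = P * W" using V by (elim dvdE)
  have VB: "V * B = 1 + P * W" using W by (simp add: algebra_simps)
  have "(A * V)\<^sup>2 - A * V * (V * B) - (V * B)\<^sup>2 * f = V\<^sup>2 * nrm A B"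
    by (simp add: nrm_def power2_eq_square algebra_simps)
  then have 1: "P dvd (A * V)\<^sup>2 - A * V * (V * B) - (V * B)\<^sup>2 * f" using dvd by simp
  have "(A * V)\<^sup>2 - A * V * (V * B) - (V * B)\<^sup>2 * f
      = ((A * V)\<^sup>2 - A * V - f) - P * (A * V * W + (2 * W + P * W\<^sup>2) * f)"
    unfolding VB by (simp add: power2_eq_square algebra_simps)
  then have "P dvd (A * V)\<^sup>2 - A * V - f" using 1 dvd_diff_cong[OF dvd_triv_left] by blast
  moreover have "(A * V)\<^sup>2 - A * V - f = (- (A * V))\<^sup>2 + (- (A * V)) - f" by simp
  ultimately show ?thesis using inert by metis
qed

text \<open>For primality, pass to norms: P divides the norm of the product, hence one of the two
  norms, and by \<open>prime_dvd_nrm\<close> both coefficients of that factor.\<close>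

lemma prime_over_inert:
  assumes P: "prime_elem P" and inert: "\<And>S. \<not> P dvd S\<^sup>2 + S - f"
  shows "prime_over P {lin A B | A B. P dvd A \<and> P dvd B}"
proof (rule prime_overI)
  let ?M = "{lin A B | A B. P dvd A \<and> P dvd B}"
  have mem: "lin A B \<in> ?M \<longleftrightarrow> P dvd A \<and> P dvd B" for A B by (auto simp: lin_eq_iff)
  show "?M \<subseteq> affine_ring" using lin_affine by blast
  then have sub: "u \<in> affine_ring" if "u \<in> ?M" for u using that by blast
  show "u + v \<in> ?M" if u: "u \<in> ?M" and v: "v \<in> ?M" for u v
  proof -
    obtain A B where A: "u = lin A B" using sub[OF u] by (elim affineE)
    obtain C D where C: "v = lin C D" using sub[OF v] by (elim affineE)
    show ?thesis using u v unfolding A C lin_add mem by (simp add: dvd_add)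
  qed
  show "u * v \<in> ?M" if u: "u \<in> ?M" and v: "v \<in> affine_ring" for u v
  proof -
    obtain A B where A: "u = lin A B" using sub[OF u] by (elim affineE)
    obtain C D where C: "v = lin C D" using v by (elim affineE)
    have "P dvd A" "P dvd B" using u unfolding A mem by simp_all
    then show ?thesis unfolding A C lin_mult mem
      by (intro conjI dvd_add dvd_diff) (simp_all add: dvd_mult dvd_mult2)
  qed
  show "u \<in> ?M \<or> v \<in> ?M" if u: "u \<in> affine_ring" and v: "v \<in> affine_ring" and uv: "u * v \<in> ?M" for u v
  proof -
    obtain A B where A: "u = lin A B" using u by (elim affineE)
    obtain C D where C: "v = lin C D" using v by (elim affineE)
    define E F where "E = A * C + B * D * f" and "F = A * D + B * C - B * D"
    have "P dvd E" "P dvd F" using uv unfolding A C lin_mult mem E_def F_def by simp_all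
    then have "P dvd nrm E F" by (simp add: nrm_def power2_eq_square)
    then have "P dvd nrm A B * nrm C D" unfolding E_def F_def nrm_mult .
    then have "P dvd nrm A B \<or> P dvd nrm C D" by (rule prime_elem_dvd_multD[OF P])
    then show ?thesis unfolding A C mem using prime_dvd_nrm[OF P inert] by blast
  qed
  show "e r \<in> ?M \<longleftrightarrow> P dvd r" for r
    using mem[of r 0] by (simp add: lin_0)
qed (rule prime_elem_degree[OF P])

text \<open>If the equation has a root S modulo P, then S + 1 is another one, and an element in both
  kernels has B and then A divisible by P. Without a root, the ideal generated by P avoids the
  element at once.\<close>

lemma ex_prime_over_avoiding:
  assumes P: "prime_elem P" and nd: "\<not> (P dvd A \<and> P dvd B)"
  obtains M where "prime_over P M" "lin A B \<notin> M"
proof (cases "\<exists>S. P dvd S\<^sup>2 + S - f")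
  case True
  then obtain S where S: "P dvd S\<^sup>2 + S - f" by blast
  have eq: "(S + 1)\<^sup>2 + (S + 1) - f = (S\<^sup>2 + S - f) + 2 * (S + 1)"
    by (simp add: power2_eq_square algebra_simps)
  have S1: "P dvd (S + 1)\<^sup>2 + (S + 1) - f" unfolding eq two_poly using S by simp
  show ?thesis
  proof (cases "P dvd A + B * S")
    case False
    then show ?thesis using that[OF prime_over_split[OF P S]] by (simp add: lin_split_ideal)
  next
    case 1: True
    have "\<not> P dvd A + B * (S + 1)"
    proof
      assume 2: "P dvd A + B * (S + 1)"
      have "(A + B * (S + 1)) - (A + B * S) = B" by (simp add: algebra_simps)
      then have "P dvd B" using dvd_diff[OF 2 1] by simp
      moreover from this have "P dvd A" using 1 by (metis dvd_add_left_iff dvd_mult2)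
      ultimately show False using nd by blast
    qed
    then show ?thesis using that[OF prime_over_split[OF P S1]] by (simp add: lin_split_ideal)
  qed
next
  case False
  then have "prime_over P {lin A B | A B. P dvd A \<and> P dvd B}" by (intro prime_over_inert[OF P]) blast
  moreover have "lin A B \<notin> {lin A B | A B. P dvd A \<and> P dvd B}" using nd by (auto simp: lin_eq_iff)
  ultimately show ?thesis by (rule that)
qed

lemma x_local: "prime_over P M \<Longrightarrow> x \<in> local_ring M"
  by (rule affine_local[OF _ e_affine])

text \<open>With a denominator of least degree, a prime factor P of it cannot divide both A and B,
  so some prime over P misses the numerator and u has a pole there.\<close>

lemma affine_ring_eq_Inter:
  assumes u: "u \<in> K" and reg: "\<And>R. R \<in> closed_points K \<Longrightarrow> x \<in> R \<Longrightarrow> u \<in> R"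
  shows "u \<in> affine_ring"
proof -
  let ?S = "\<lambda>n. \<exists>A B C. u = lin A B / e C \<and> C \<noteq> 0 \<and> degree C = n"
  have "\<exists>n. ?S n" using u unfolding K_eq by blast
  then have "?S (LEAST n. ?S n)" by (rule LeastI_ex)
  then obtain A B C where C: "u = lin A B / e C" "C \<noteq> 0" and dC: "degree C = (LEAST n. ?S n)" by blast
  have min: "degree C \<le> degree C'" if "u = lin A' B' / e C'" "C' \<noteq> 0" for A' B' C'
    unfolding dC by (rule Least_le) (use that in blast)
  have "degree C = 0"
  proof (rule ccontr)
    assume "degree C \<noteq> 0"
    then obtain P where P: "P dvd C" "prime_elem P" using ex_prime_elem_dvd by blast
    obtain C' where C': "C = P * C'" using P(1) by (elim dvdE)
    have nz: "P \<noteq> 0" "C' \<noteq> 0" using C(2) C' by auto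
    have "\<not> (P dvd A \<and> P dvd B)"
    proof
      assume "P dvd A \<and> P dvd B"
      then obtain A' B' where "A = P * A'" "B = P * B'" by (auto elim!: dvdE)
      then have "u = (e P * lin A' B') / (e P * e C')" unfolding C(1) C' e_lin by simp
      then have "u = lin A' B' / e C'" using nz by simp
      from min[OF this nz(2)] show False
        using prime_elem_degree[OF P(2)] nz by (simp add: C' degree_mult_eq)
    qed
    from ex_prime_over_avoiding[OF P(2) this] obtain M where M: "prime_over P M" "lin A B \<notin> M" .
    have "u \<in> local_ring M" by (rule reg[OF local_ring_closed_point[OF M(1)] x_local[OF M(1)]])
    moreover have "u \<notin> local_ring M"
      unfolding C(1) by (rule inverse_P_notin[OF M(1)]) (use e_M[OF M(1)] P C M lin_affine in auto)
    ultimately show False by blast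
  qed
  then obtain c where c: "C = [:c:]" by (rule degree_eq_zeroE)
  then have "c \<noteq> 0" using C by simp
  then have "u = e [:inverse c:] * lin A B"
    unfolding C(1) c by (simp add: divide_inverse emb_const_inverse flip: emb_const_def)
  then show ?thesis unfolding e_lin using lin_affine by simp
qed

text \<open>The local ring at the kernel of evaluation at (c, d): here P is x - c and S is the
  constant d.\<close>

definition affine_point :: "'k \<Rightarrow> 'k \<Rightarrow> 'k rat_closure set" where
  "affine_point c d = local_ring (split_ideal [:- c, 1:] [:d:])"

lemma prime_elem_linear: "prime_elem [:- c, 1 :: 'k:]"
  by (intro field_poly_irreducible_imp_prime irreducible_linear_field_poly) simp

lemma linear_split_ideal: "lin A B \<in> split_ideal [:- c, 1:] [:d:] \<longleftrightarrow> poly A c + poly B c * d = 0"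
  unfolding lin_split_ideal by (simp add: poly_eq_0_iff_dvd[symmetric] mult.commute)

lemma prime_over_point:
  assumes "d\<^sup>2 + d = poly f c"
  shows "prime_over [:- c, 1:] (split_ideal [:- c, 1:] [:d:])"
  by (rule prime_over_split[OF prime_elem_linear])
    (use assms in \<open>simp add: poly_eq_0_iff_dvd[symmetric]\<close>)

lemma affine_point_rational:
  assumes cd: "d\<^sup>2 + d = poly f c"
  shows "affine_point c d \<in> rational_points K" "x \<in> affine_point c d"
proof -
  let ?M = "split_ideal [:- c, 1:] [:d:]"
  note PM = prime_over_point[OF cd]
  show "x \<in> affine_point c d" unfolding affine_point_def by (rule x_local[OF PM])
  show "affine_point c d \<in> rational_points K"
    unfolding rational_points_def affine_point_def
  proof (intro CollectI conjI ballI)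
    show "local_ring ?M \<in> closed_points K" by (rule local_ring_closed_point[OF PM])
    fix u assume "u \<in> local_ring ?M"
    then obtain b v where u: "u = b / v" "b \<in> affine_ring" "v \<in> affine_ring - ?M"
      unfolding local_ring_def by blast
    obtain A B where b: "b = lin A B" using u(2) by (elim affineE)
    obtain C D where v: "v = lin C D" using u(3) by (blast elim: affineE)
    \<comment> \<open>The values of numerator and denominator at the point; their quotient
      \<open>r\<close> is the residue of u.\<close>
    define s t where "s = poly A c + poly B c * d" and "t = poly C c + poly D c * d"
    have t: "t \<noteq> 0" using u(3) unfolding v t_def linear_split_ideal[symmetric] by blast
    define r where "r = s / t"
    have v0: "v \<noteq> 0" by (rule diff_M_nz[OF PM u(3)])
    have "u - emb_const r = (b - emb_const r * v) / v"
      using v0 by (simp add: u(1) field_simps)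
    also have "b - emb_const r * v = lin (A - [:r:] * C) (B - [:r:] * D)"
      unfolding b v emb_const_def e_lin lin_diff by simp
    finally have eq: "u - emb_const r = lin (A - [:r:] * C) (B - [:r:] * D) / v" .
    have "poly (A - [:r:] * C) c + poly (B - [:r:] * D) c * d = s - r * t"
      by (simp add: s_def t_def algebra_simps)
    also have "\<dots> = 0" using t by (simp add: r_def)
    finally have "lin (A - [:r:] * C) (B - [:r:] * D) \<in> ?M" by (simp only: linear_split_ideal)
    then have "u - emb_const r \<in> maximal_ideal_of (local_ring ?M)"
      unfolding eq by (rule max_local[OF PM _ u(3)])
    then show "\<exists>c. u - emb_const c \<in> maximal_ideal_of (local_ring ?M)" by blast
  qed
qed

lemma affine_point_inj:
  assumes "d\<^sup>2 + d = poly f c" "d'\<^sup>2 + d' = poly f c'" "affine_point c d = affine_point c' d'"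
  shows "c = c' \<and> d = d'"
proof -
  have eq: "split_ideal [:- c, 1:] [:d:] = split_ideal [:- c', 1:] [:d':]"
    using assms(3) unfolding affine_point_def
    by (metis (no_types) max_local_affine[OF prime_over_point[OF assms(1)]]
        max_local_affine[OF prime_over_point[OF assms(2)]])
  \<comment> \<open>The ideal contains x - c and \<zeta> - d, which determine both
    coordinates.\<close>
  have "lin [:- c, 1:] 0 \<in> split_ideal [:- c, 1:] [:d:]"
    by (simp add: linear_split_ideal)
  then have c: "c' = c" unfolding eq linear_split_ideal by simp
  have "lin [:- d:] 1 \<in> split_ideal [:- c, 1:] [:d:]"
    by (simp add: linear_split_ideal)
  then have "d' = d" unfolding eq linear_split_ideal by simp
  with c show ?thesis by simp
qed

text \<open>The coordinates are the residues of x and \<zeta>. They make the maximal ideal agree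
  with the kernel of evaluation on k[x, \<zeta>], and that ideal determines R.\<close>

lemma rational_affine_point:
  assumes R: "R \<in> rational_points K" and x: "x \<in> R"
  shows "\<exists>c d. d\<^sup>2 + d = poly f c \<and> R = affine_point c d"
proof -
  have Rc: "R \<in> closed_points K" and res: "\<And>u. u \<in> R \<Longrightarrow> \<exists>c. u - emb_const c \<in> maximal_ideal_of R"
    using R unfolding rational_points_def by blast+
  interpret closed_point K R by standard (rule subfield_K Rc)+
  have aff: "u \<in> R" if "u \<in> affine_ring" for u
    using affine_sub_closed_point[OF Rc x] that by blast
  obtain c where c: "x - emb_const c \<in> \<mm>" using res[OF x] by blast
  have zR: "\<zeta> \<in> R" using aff[OF lin_affine[of 0 1]] by (simp add: lin_def)
  obtain d where d: "\<zeta> - emb_const d \<in> \<mm>" using res[OF zR] by blast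
  have const_max: "emb_const s \<in> \<mm> \<longleftrightarrow> s = 0" for s
  proof
    assume s: "emb_const s \<in> \<mm>"
    show "s = 0"
    proof (rule ccontr)
      assume "s \<noteq> 0"
      then have "emb_const s * emb_const (inverse s) = 1" by (simp flip: emb_const_simps)
      then show False using max_mult[OF s const[of "inverse s"]] one_max by simp
    qed
  qed (simp add: zero_max)
  have ev: "e p - emb_const (poly p c) \<in> \<mm>" for p
  proof (induction p)
    case 0
    show ?case by (simp add: zero_max)
  next
    case (pCons s p)
    have "e (pCons s p) - emb_const (poly (pCons s p) c)
       = (e p - emb_const (poly p c)) * x + (x - emb_const c) * emb_const (poly p c)"
      unfolding emb_poly_pCons[of s p] by (simp add: emb_const_simps algebra_simps)
    also have "\<dots> \<in> \<mm>" by (intro max_add max_mult pCons.IH c x const)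
    finally show ?case .
  qed
  have lin_max: "lin A B \<in> \<mm> \<longleftrightarrow> poly A c + poly B c * d = 0" for A B
  proof -
    have "lin A B - emb_const (poly A c + poly B c * d)
      = (e A - emb_const (poly A c)) + (e B - emb_const (poly B c)) * \<zeta> + (\<zeta> - emb_const d) * emb_const (poly B c)"
      by (simp add: lin_def emb_const_simps algebra_simps)
    also have "\<dots> \<in> \<mm>" by (intro max_add max_mult ev d zR const)
    finally have m: "lin A B - emb_const (poly A c + poly B c * d) \<in> \<mm>" .
    have "lin A B \<in> \<mm> \<longleftrightarrow> emb_const (poly A c + poly B c * d) \<in> \<mm>"
    proof
      assume "lin A B \<in> \<mm>"
      from max_diff[OF this m] show "emb_const (poly A c + poly B c * d) \<in> \<mm>" by simp
    next
      assume "emb_const (poly A c + poly B c * d) \<in> \<mm>"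
      from max_add[OF m this] show "lin A B \<in> \<mm>" by simp
    qed
    then show ?thesis by (simp only: const_max)
  qed
  have "\<mm> \<inter> affine_ring = split_ideal [:- c, 1:] [:d:]"
  proof (rule Set.set_eqI)
    fix u show "u \<in> \<mm> \<inter> affine_ring \<longleftrightarrow> u \<in> split_ideal [:- c, 1:] [:d:]"
    proof (cases "u \<in> affine_ring")
      case True
      then obtain A B where "u = lin A B" by (elim affineE)
      then show ?thesis using True by (simp only: Int_iff lin_max linear_split_ideal simp_thms)
    next
      case False
      then show ?thesis unfolding split_ideal_def using lin_affine by blast
    qed
  qed
  moreover obtain P where "R = local_ring (\<mm> \<inter> affine_ring)" using finite_closed_point[OF Rc x] by blast
  ultimately have "R = affine_point c d" unfolding affine_point_def by (simp only:)
  moreover have "d\<^sup>2 + d = poly f c"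
  proof -
    \<comment> \<open>(\<zeta> - d) (\<zeta> + d + 1) = f - d - d^2, and its residue is the equation
      of the curve at (c, d).\<close>
    have "lin (- [:d:]) 1 * lin [:d + 1:] 1 \<in> \<mm>"
      by (rule max_mult) (simp_all add: lin_max aff lin_affine)
    also have "lin (- [:d:]) 1 * lin [:d + 1:] 1 = lin (f + [:- d - d * d:]) 0"
      unfolding lin_mult by (simp add: algebra_simps one_pCons)
    finally have "poly f c + (- d - d * d) = 0" by (simp add: lin_max)
    then show ?thesis by (simp add: power2_eq_square algebra_simps)
  qed
  ultimately show ?thesis by blast
qed

subsection \<open>The point at infinity\<close>

text \<open>Multiplication by x^(g+1) expresses \<open>degree B + g + 1\<close> while keeping degree
  0 for the zero polynomial, so that \<open>B = 0\<close> meets every bound. The exponent is chosen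
  because \<zeta> / x^(g+1) has a simple zero at infinity.\<close>

abbreviation sh :: "'k poly \<Rightarrow> 'k poly" where "sh B \<equiv> monom 1 (g + 1) * B"

lemma degree_sh: "B \<noteq> 0 \<Longrightarrow> degree (sh B) = degree B + g + 1"
  by (simp add: degree_mult_eq degree_monom_eq monom_eq_0_iff)

text \<open>The local ring at infinity; there \<open>\<zeta>\<close> has a pole of order \<open>2 g + 1\<close> and \<open>x\<close> one of order 2.
  The condition on \<open>B\<close> says that \<open>B = 0\<close> or \<open>degree B + g + 1 \<le> degree C\<close>.\<close>
definition inf_ring :: "'k rat_closure set" where
  "inf_ring = {lin A B / e C | A B C. C \<noteq> 0 \<and> degree A \<le> degree C \<and> degree (sh B) \<le> degree C}"

lemma inf_ringI:
  "C \<noteq> 0 \<Longrightarrow> degree A \<le> degree C \<Longrightarrow> degree (sh B) \<le> degree C \<Longrightarrow> lin A B / e C \<in> inf_ring"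
  unfolding inf_ring_def by blast

lemma inf_ringE:
  assumes "u \<in> inf_ring"
  obtains A B C where "u = lin A B / e C" "C \<noteq> 0" "degree A \<le> degree C" "degree (sh B) \<le> degree C"
  using assms unfolding inf_ring_def by blast

lemma lin_frac_eqD:
  assumes "lin A B / e C = lin A' B' / e C'" "C \<noteq> 0" "C' \<noteq> 0"
  shows "C' * A = C * A'" "C' * B = C * B'"
proof -
  have "e C' * lin A B = e C * lin A' B'"
    using assms by (simp add: frac_eq_eq mult.commute)
  then show "C' * A = C * A'" "C' * B = C * B'" unfolding e_lin lin_eq_iff by simp_all
qed

lemma degree_le_cross:
  assumes "C' * A = C * A'" "C \<noteq> (0::'k poly)" "C' \<noteq> 0" "degree A' \<le> degree C'"
  shows "degree A \<le> degree C"
proof (cases "A = 0")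
  case False
  then have "A' \<noteq> 0" using assms by auto
  then have "degree C' + degree A = degree C + degree A'"
    using assms(1-3) False by (metis degree_mult_eq)
  then show ?thesis using assms(4) by linarith
qed simp

text \<open>Equal fractions have proportional numerators and denominators, so degree differences
  agree and membership can be read off from any representation.\<close>

lemma inf_ring_iff:
  assumes "C \<noteq> 0"
  shows "lin A B / e C \<in> inf_ring \<longleftrightarrow> degree A \<le> degree C \<and> degree (sh B) \<le> degree C"
proof
  assume "lin A B / e C \<in> inf_ring"
  then obtain A' B' C' where *: "lin A B / e C = lin A' B' / e C'" "C' \<noteq> 0"
    "degree A' \<le> degree C'" "degree (sh B') \<le> degree C'" by (elim inf_ringE)
  note eqs = lin_frac_eqD[OF *(1) assms *(2)]
  have "C' * sh B = monom 1 (g + 1) * (C' * B)" by (rule mult.left_commute)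
  also have "\<dots> = C * sh B'" unfolding eqs(2) by (rule mult.left_commute)
  finally have "C' * sh B = C * sh B'" .
  then show "degree A \<le> degree C \<and> degree (sh B) \<le> degree C"
    using degree_le_cross[OF eqs(1) assms *(2,3)] degree_le_cross[OF _ assms *(2,4)] by blast
qed (use assms inf_ringI in blast)

lemma inf_ring_sub: "inf_ring \<subseteq> K"
  by (auto simp: inf_ring_def intro!: is_subfield_divide[OF subfield_K] lin_K e_K)

lemma x_notin_inf: "x \<notin> inf_ring"
  using inf_ring_iff[of 1 "[:0, 1:]" 0] by (simp add: lin_0)

lemma lin_e: "lin A B * e C = lin (C * A) (C * B)"
  by (subst mult.commute) (rule e_lin)

lemma inf_add:
  assumes "u \<in> inf_ring" "v \<in> inf_ring"
  shows "u + v \<in> inf_ring"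
proof -
  obtain A B C where u: "u = lin A B / e C" "C \<noteq> 0" "degree A \<le> degree C" "degree (sh B) \<le> degree C"
    using assms(1) by (elim inf_ringE)
  obtain A' B' C' where v: "v = lin A' B' / e C'" "C' \<noteq> 0" "degree A' \<le> degree C'" "degree (sh B') \<le> degree C'"
    using assms(2) by (elim inf_ringE)
  have nz: "e C \<noteq> 0" "e C' \<noteq> 0" using u v by simp_all
  have "u + v = (lin A B * e C' + lin A' B' * e C) / (e C * e C')"
    unfolding u(1) v(1) by (rule add_frac_eq[OF nz])
  then have eq: "u + v = lin (C' * A + C * A') (C' * B + C * B') / e (C * C')"
    by (simp only: lin_e lin_add emb_poly_mult)
  have CC: "C * C' \<noteq> 0" "degree (C * C') = degree C + degree C'"
    using u v by (simp_all add: degree_mult_eq)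
  have sh: "sh (C' * B + C * B') = C' * sh B + C * sh B'" by (simp add: algebra_simps)
  have d: "degree (p * q) \<le> degree (C * C')" if "degree p \<le> degree C" "degree q \<le> degree C'" for p q
    unfolding CC using that degree_mult_le[of p q] by linarith
  have d': "degree (p * q) \<le> degree (C * C')" if "degree p \<le> degree C'" "degree q \<le> degree C" for p q
    unfolding CC using that degree_mult_le[of p q] by linarith
  show ?thesis unfolding eq inf_ring_iff[OF CC(1)] sh
    using degree_add_le[OF d'[OF order_refl u(3)] d[OF order_refl v(3)]]
      degree_add_le[OF d'[OF order_refl u(4)] d[OF order_refl v(4)]] by blast
qed

text \<open>The bound for \<open>B * B' * f\<close> has room for the \<open>- 1\<close> because two
  shifts contribute 2 g + 2, whereas f has degree 2 g + 1.\<close>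

lemma inf_mult_aux:
  assumes "degree A \<le> degree C" "degree (sh B) \<le> degree C" "degree A' \<le> degree C'" "degree (sh B') \<le> degree C'"
  shows "degree (A * A') \<le> degree C + degree C'"
    and "degree (B * B' * f) \<le> degree C + degree C' - 1"
    and "degree (sh (A * B' + B * A')) \<le> degree C + degree C'"
    and "degree (sh (B * B')) \<le> degree C + degree C' - 1"
proof -
  show "degree (A * A') \<le> degree C + degree C'"
    using assms degree_mult_le[of A A'] by linarith
  have bb: "B \<noteq> 0 \<Longrightarrow> degree B + g + 1 \<le> degree C" "B' \<noteq> 0 \<Longrightarrow> degree B' + g + 1 \<le> degree C'"
    using assms degree_sh[of B] degree_sh[of B'] by auto
  show "degree (B * B' * f) \<le> degree C + degree C' - 1" "degree (sh (B * B')) \<le> degree C + degree C' - 1"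
  proof -
    have "B = 0 \<or> B' = 0 \<or> degree B + degree B' + (2 * g + 1) \<le> degree C + degree C' - 1"
      using bb by linarith
    then show "degree (B * B' * f) \<le> degree C + degree C' - 1"
      using degree_mult_le[of "B * B'" f] degree_mult_le[of B B'] deg_f by auto
    have "B = 0 \<or> B' = 0 \<or> degree B + degree B' + (g + 1) \<le> degree C + degree C' - 1"
      using bb by linarith
    then show "degree (sh (B * B')) \<le> degree C + degree C' - 1"
      using degree_mult_le[of "monom 1 (g + 1)" "B * B'"] degree_mult_le[of B B'] degree_monom_eq[of "1::'k" "g + 1"] by auto
  qed
  have "sh (A * B' + B * A') = A * sh B' + sh B * A'" by (simp add: algebra_simps)
  moreover have "degree (A * sh B') \<le> degree C + degree C'" "degree (sh B * A') \<le> degree C + degree C'"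
    using assms degree_mult_le[of A "sh B'"] degree_mult_le[of "sh B" A'] by linarith+
  ultimately show "degree (sh (A * B' + B * A')) \<le> degree C + degree C'"
    by (simp only: degree_add_le)
qed

lemma inf_mult:
  assumes "u \<in> inf_ring" "v \<in> inf_ring"
  shows "u * v \<in> inf_ring"
proof -
  obtain A B C where u: "u = lin A B / e C" "C \<noteq> 0" "degree A \<le> degree C" "degree (sh B) \<le> degree C"
    using assms(1) by (elim inf_ringE)
  obtain A' B' C' where v: "v = lin A' B' / e C'" "C' \<noteq> 0" "degree A' \<le> degree C'" "degree (sh B') \<le> degree C'"
    using assms(2) by (elim inf_ringE)
  have "u * v = (lin A B * lin A' B') / e (C * C')" unfolding u(1) v(1) by simp
  then have eq: "u * v = lin (A * A' + B * B' * f) (A * B' + B * A' - B * B') / e (C * C')"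
    unfolding lin_mult .
  have CC: "C * C' \<noteq> 0" "degree (C * C') = degree C + degree C'"
    using u v by (simp_all add: degree_mult_eq)
  note d = inf_mult_aux[OF u(3,4) v(3,4)]
  have sh: "sh (A * B' + B * A' - B * B') = sh (A * B' + B * A') - sh (B * B')" by (simp add: algebra_simps)
  show ?thesis unfolding eq inf_ring_iff[OF CC(1)] sh CC(2)
    by (intro conjI degree_add_le degree_diff_le) (use d in linarith)+
qed

text \<open>The hypotheses say that the fraction vanishes at infinity, so its square compensates the
  double pole of x. For B this is the bound of \<open>inf_ring\<close> itself, since B \<zeta> / C
  has odd order. The bounds are doubled to match those on degrees of norms.\<close>

lemma x_square_inf:
  assumes C: "C \<noteq> 0" and A: "A = 0 \<or> 2 * degree A + 1 \<le> 2 * degree C"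
    and B: "B = 0 \<or> 2 * degree B + 2 * g + 2 \<le> 2 * degree C"
  shows "x * (lin A B / e C) * (lin A B / e C) \<in> inf_ring"
proof -
  have CC: "C * C \<noteq> 0" "degree (C * C) = 2 * degree C" using C by (simp_all add: degree_mult_eq)
  have "x * (lin A B / e C) * (lin A B / e C) = e [:0, 1:] * (lin A B * lin A B) / e (C * C)" by simp
  then have eq: "x * (lin A B / e C) * (lin A B / e C)
      = lin ([:0, 1:] * (A * A + B * B * f)) ([:0, 1:] * - (B * B)) / e (C * C)"
    unfolding lin_square e_lin .
  have dx: "p = 0 \<or> degree p + 1 \<le> n \<Longrightarrow> degree ([:0, 1:] * p) \<le> n" for p :: "'k poly" and n
    using degree_mult_le[of "[:0, 1:]" p] by auto
  show ?thesis
    unfolding eq inf_ring_iff[OF CC(1)] CC(2)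
  proof
    have 1: "degree ([:0, 1:] * (A * A)) \<le> 2 * degree C"
      by (rule dx) (use A degree_mult_le[of A A] in auto)
    have 2: "degree ([:0, 1:] * (B * B * f)) \<le> 2 * degree C"
      by (rule dx) (use B degree_mult_le[of "B * B" f] degree_mult_le[of B B] deg_f in auto)
    show "degree ([:0, 1:] * (A * A + B * B * f)) \<le> 2 * degree C"
      unfolding distrib_left by (rule degree_add_le[OF 1 2])
    show "degree (sh ([:0, 1:] * - (B * B))) \<le> 2 * degree C"
    proof (cases "B = 0")
      case False
      have "degree (sh ([:0, 1:] * - (B * B))) \<le> (g + 1) + degree ([:0, 1:] * - (B * B))"
        using degree_mult_le[of "monom 1 (g + 1)" "[:0, 1:] * - (B * B)"] degree_monom_eq[of "1::'k" "g + 1"] by simp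
      also have "degree ([:0, 1:] * - (B * B)) \<le> degree B + degree B + 1"
        by (rule dx) (use degree_mult_le[of B B] in simp)
      finally show ?thesis using B False g by linarith
    qed simp
  qed
qed

text \<open>The inverse is C times the conjugate over the norm, and a pole of u forces the norm to
  have degree above 2 degree C. The second claim strengthens the first, saying that 1 / u vanishes
  there; it excludes larger rings in \<open>closed_point_at_infinity\<close>.\<close>

lemma inf_pole:
  assumes u: "u \<in> K" and nR: "u \<notin> inf_ring"
  shows "inverse u \<in> inf_ring" and "x * inverse u * inverse u \<in> inf_ring"
proof -
  obtain A B C where uABC: "u = lin A B / e C" and C: "C \<noteq> 0" using u unfolding K_eq by blast
  have AB: "A \<noteq> 0 \<or> B \<noteq> 0"
  proof (rule ccontr)
    assume "\<not> (A \<noteq> 0 \<or> B \<noteq> 0)"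
    then show False using nR inf_ring_iff[OF C, of A B] unfolding uABC by simp
  qed
  define N where "N = nrm A B"
  have N: "N \<noteq> 0" "2 * degree A \<le> degree N" and NB: "B \<noteq> 0 \<Longrightarrow> 2 * degree B + 2 * g + 1 \<le> degree N"
    unfolding N_def using nrm_degree[OF AB] by blast+
  have NB': "2 * degree B \<le> degree N" using NB by (cases "B = 0") auto
  have "degree A > degree C \<or> degree (sh B) > degree C"
    using nR unfolding uABC inf_ring_iff[OF C] by linarith
  then have NC: "2 * degree C + 1 \<le> degree N"
  proof
    assume s: "degree (sh B) > degree C"
    then have "B \<noteq> 0" by auto
    then show ?thesis using NB s degree_sh[of B] by linarith
  qed (use N in linarith)
  define A1 B1 where "A1 = C * (A - B)" and "B1 = C * (- B)"
  have nz: "lin A B \<noteq> 0" using AB lin_eq_0_iff by blast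
  then have cnz: "lin (A - B) (- B) \<noteq> 0" using lin_conj[of A B] N(1) by (auto simp: N_def)
  have "inverse u = e C / lin A B" by (simp add: uABC)
  also have "\<dots> = e C * lin (A - B) (- B) / e N"
    using nz cnz by (simp add: lin_conj[symmetric] N_def)
  finally have iu: "inverse u = lin A1 B1 / e N" unfolding e_lin A1_def B1_def .
  have dA1: "2 * degree A1 + 1 \<le> 2 * degree N"
  proof -
    have "degree A1 \<le> degree C + degree (A - B)" unfolding A1_def by (rule degree_mult_le)
    moreover have "2 * degree (A - B) \<le> degree N"
      using degree_diff_le_max[of A B] N(2) NB' by linarith
    ultimately show ?thesis using NC by linarith
  qed
  have dB1: "2 * degree B1 + 2 * g + 2 \<le> 2 * degree N" if "B1 \<noteq> 0"
  proof -
    have "B \<noteq> 0" using that by (auto simp: B1_def)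
    moreover have "degree B1 \<le> degree C + degree B" unfolding B1_def using degree_mult_le[of C "- B"] by simp
    ultimately show ?thesis using NC NB by linarith
  qed
  show "inverse u \<in> inf_ring"
    unfolding iu inf_ring_iff[OF N(1)]
  proof
    show "degree A1 \<le> degree N" using dA1 by linarith
    show "degree (sh B1) \<le> degree N"
      using dB1 degree_sh[of B1] by (cases "B1 = 0") auto
  qed
  show "x * inverse u * inverse u \<in> inf_ring"
    unfolding iu by (rule x_square_inf[OF N(1)]) (use dA1 dB1 in blast)+
qed

lemma inf_const: "emb_const c \<in> inf_ring"
  using inf_ring_iff[of 1 "[:c:]" 0] by (simp add: lin_0 emb_const_def)

lemma inf_closed_point: "inf_ring \<in> closed_points K"
  unfolding closed_points_def
proof (intro CollectI conjI ballI)
  show "range emb_const \<subseteq> inf_ring" using inf_const by blast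
  show "inf_ring \<subset> K" using inf_ring_sub x_K x_notin_inf by blast
qed (use inf_add inf_mult inf_pole(1) in blast)+

text \<open>R contains y = 1 / x, and w = \<zeta> / x^(g+1) by integrality; together these give all
  of \<open>inf_ring\<close>. An additional element u of R would yield x = (x / u^2) u^2 in
  R.\<close>

lemma closed_point_at_infinity:
  assumes R: "R \<in> closed_points K" and x: "x \<notin> R"
  shows "R = inf_ring"
proof -
  interpret closed_point K R by standard (rule subfield_K R)+
  define y where "y = inverse x"
  have xy: "x * y = 1" by (simp add: y_def)
  have y: "y \<in> \<mm>"
    using total[OF x_K] x by (auto simp: y_def maximal_ideal_of_def)
  have yR: "y \<in> R" by (rule max_sub[OF y])
  have poly_R: "e p * y ^ n \<in> R" if "degree p \<le> n" for p n
    using that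
  proof (induction p arbitrary: n)
    case 0
    then show ?case by (simp add: zero)
  next
    case (pCons c p)
    have eq: "e (pCons c p) * y ^ n = emb_const c * y ^ n + e p * (x * y ^ n)"
      unfolding emb_poly_pCons[of c p] by (simp add: algebra_simps)
    show ?case
    proof (cases "p = 0")
      case True
      then show ?thesis unfolding eq using mult[OF const power[OF yR]] by simp
    next
      case False
      then obtain m where m: "n = Suc m" "degree p \<le> m" using pCons.prems by (cases n) auto
      have "x * y ^ n = y ^ m" using xy by (simp add: m(1) mult.assoc[symmetric])
      then show ?thesis unfolding eq using pCons.IH[OF m(2)] by (simp add: add mult const power yR)
    qed
  qed
  \<comment> \<open>Multiplication by y^(degree p) reverses p into a polynomial in y whose constant
    term is the leading coefficient, a unit.\<close>
  have poly_unit: "e p * y ^ degree p \<notin> \<mm>" if "p \<noteq> 0" for p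
    using that
  proof (induction p)
    case (pCons c p)
    show ?case
    proof (cases "p = 0")
      case True
      then have c: "c \<noteq> 0" using pCons by auto
      show ?thesis
      proof
        assume "e (pCons c p) * y ^ degree (pCons c p) \<in> \<mm>"
        then have "emb_const c * emb_const (inverse c) \<in> \<mm>"
          using True by (intro max_mult const) (simp add: emb_const_def)
        then show False using one_max c by (simp flip: emb_const_simps)
      qed
    next
      case False
      have "e (pCons c p) * y ^ degree (pCons c p) = emb_const c * y ^ Suc (degree p) + e p * (x * y ^ Suc (degree p))"
        using False unfolding emb_poly_pCons[of c p] by (simp add: algebra_simps)
      also have "x * y ^ Suc (degree p) = y ^ degree p" using xy by (simp add: mult.assoc[symmetric])
      finally have eq: "e p * y ^ degree p = e (pCons c p) * y ^ degree (pCons c p) - y * (y ^ degree p * emb_const c)"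
        by (simp add: mult_ac)
      have "y * (y ^ degree p * emb_const c) \<in> \<mm>" by (intro max_mult[OF y] mult power yR const)
      then show ?thesis using pCons.IH[OF False] max_diff unfolding eq by blast
    qed
  qed simp
  define w where "w = y ^ (g + 1) * \<zeta>"
  have wR: "w \<in> R"
  proof (rule integral)
    show "w \<in> K" unfolding w_def y_def
      by (intro K_mult is_subfield_power[OF subfield_K] K_inverse x_K zeta_K)
    show "- (y ^ (g + 1)) \<in> R" by (intro minus power yR)
    show "e f * y ^ (2 * g + 2) \<in> R" by (rule poly_R) (simp add: deg_f)
    have "2 * g + 2 = (g + 1) + (g + 1)" by simp
    then have y2: "y ^ (2 * g + 2) = y ^ (g + 1) * y ^ (g + 1)" by (simp only: power_add)
    have "w\<^sup>2 = y ^ (g + 1) * y ^ (g + 1) * (\<zeta> * \<zeta>)"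
      by (simp add: w_def power2_eq_square mult_ac)
    then show "w\<^sup>2 = - (y ^ (g + 1)) * w + e f * y ^ (2 * g + 2)"
      unfolding zeta_sq y2 by (simp add: w_def algebra_simps)
  qed
  have sub_inf: "inf_ring \<subseteq> R"
  proof
    fix u assume "u \<in> inf_ring"
    then obtain A B C where u: "u = lin A B / e C" "C \<noteq> 0" "degree A \<le> degree C" "degree (sh B) \<le> degree C"
      by (elim inf_ringE)
    define n where "n = degree C"
    define i where "i = inverse (e C * y ^ n)"
    have "e C * y ^ n \<in> R" unfolding n_def by (rule poly_R) simp
    then have iR: "i \<in> R" unfolding i_def n_def by (rule unit[OF _ poly_unit[OF u(2)]])
    have ynz: "y \<noteq> 0" using xy by auto
    then have iC: "inverse (e C) = y ^ n * i" by (simp add: i_def)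
    have 1: "e A * y ^ n * i \<in> R" using u(3) by (intro mult iR poly_R) (simp add: n_def)
    have 2: "e B * \<zeta> * y ^ n * i \<in> R"
    proof (cases "B = 0")
      case False
      then have d: "degree B + (g + 1) \<le> n" using u(4) degree_sh[OF False] by (simp add: n_def)
      then have "n = (n - (g + 1)) + (g + 1)" by linarith
      then have "y ^ n = y ^ (n - (g + 1)) * y ^ (g + 1)" by (metis power_add)
      then have "e B * \<zeta> * y ^ n * i = (e B * y ^ (n - (g + 1))) * w * i" by (simp add: w_def mult_ac)
      also have "\<dots> \<in> R" using d by (intro mult iR wR poly_R) linarith
      finally show ?thesis .
    qed (simp add: zero)
    have "u = e A * y ^ n * i + e B * \<zeta> * y ^ n * i"
      unfolding u(1) divide_inverse iC by (simp add: lin_def algebra_simps)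
    also have "\<dots> \<in> R" by (rule add[OF 1 2])
    finally show "u \<in> R" .
  qed
  show ?thesis
  proof (rule subset_antisym[OF subsetI sub_inf], rule ccontr)
    fix u assume u: "u \<in> R" "u \<notin> inf_ring"
    have "u \<in> K" using u sub by blast
    have "u \<noteq> 0" using u(2) inf_const[of 0] by auto
    have "x * inverse u * inverse u \<in> R" using inf_pole(2)[OF \<open>u \<in> K\<close> u(2)] sub_inf by blast
    then have "x * inverse u * inverse u * (u * u) \<in> R" by (rule mult[OF _ mult[OF u(1) u(1)]])
    moreover have "x * inverse u * inverse u * (u * u) = x" using \<open>u \<noteq> 0\<close> by (simp add: field_simps)
    ultimately show False using x by simp
  qed
qed

lemma inf_rational: "inf_ring \<in> rational_points K"
  unfolding rational_points_def
proof (intro CollectI conjI ballI)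
  show "inf_ring \<in> closed_points K" by (rule inf_closed_point)
  interpret closed_point K inf_ring by standard (rule subfield_K inf_closed_point)+
  fix u assume "u \<in> inf_ring"
  then obtain A B C where u: "u = lin A B / e C" "C \<noteq> 0" "degree A \<le> degree C" "degree (sh B) \<le> degree C"
    by (elim inf_ringE)
  \<comment> \<open>The value at infinity: only the coefficients in the degree of C survive, because
    B \<zeta> / C has odd order and therefore vanishes there.\<close>
  define c where "c = coeff A (degree C) / lead_coeff C"
  define A' where "A' = A - smult c C"
  define v where "v = u - emb_const c"
  have v: "v = lin A' B / e C"
  proof -
    have "v = (lin A B - emb_const c * e C) / e C" using u(2) by (simp add: v_def u(1) field_simps)
    also have "lin A B - emb_const c * e C = lin A' B"
      by (simp add: lin_def A'_def emb_poly_smult)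
    finally show ?thesis .
  qed
  have dA': "degree A' \<le> degree C" unfolding A'_def using u(3) by (intro degree_diff_le) auto
  have "coeff A' (degree C) = 0" using u(2) by (simp add: A'_def c_def)
  then have A'0: "A' = 0 \<or> degree A' < degree C"
    using dA' by (metis le_neq_implies_less leading_coeff_0_iff)
  have vR: "v \<in> inf_ring" unfolding v inf_ring_iff[OF u(2)] using dA' u(4) by simp
  have bB: "B \<noteq> 0 \<Longrightarrow> degree B + g + 1 \<le> degree C" using u(4) degree_sh[of B] by auto
  have xvv: "x * v * v \<in> inf_ring"
    unfolding v
  proof (rule x_square_inf[OF u(2)])
    show "A' = 0 \<or> 2 * degree A' + 1 \<le> 2 * degree C" using A'0 by linarith
    show "B = 0 \<or> 2 * degree B + 2 * g + 2 \<le> 2 * degree C" using bB by linarith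
  qed
  have "v \<in> \<mm>"
  proof (rule ccontr)
    assume n: "v \<notin> \<mm>"
    have iv: "inverse v \<in> inf_ring" by (rule unit[OF vR n])
    have "v \<noteq> 0" by (rule unit_nz[OF vR n])
    have "x * v * v * (inverse v * inverse v) \<in> inf_ring" by (rule mult[OF xvv mult[OF iv iv]])
    moreover have "x * v * v * (inverse v * inverse v) = x" using \<open>v \<noteq> 0\<close> by (simp add: field_simps)
    ultimately show False using x_notin_inf by simp
  qed
  then show "\<exists>c. u - emb_const c \<in> \<mm>" unfolding v_def by blast
qed

lemma rational_points_eq:
  "rational_points K = insert inf_ring ((\<lambda>(c, d). affine_point c d) ` {(c, d). d\<^sup>2 + d = poly f c})"
proof
  show "rational_points K \<subseteq> insert inf_ring ((\<lambda>(c, d). affine_point c d) ` {(c, d). d\<^sup>2 + d = poly f c})"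
  proof
    fix R assume R: "R \<in> rational_points K"
    show "R \<in> insert inf_ring ((\<lambda>(c, d). affine_point c d) ` {(c, d). d\<^sup>2 + d = poly f c})"
    proof (cases "x \<in> R")
      case True
      from rational_affine_point[OF R this] show ?thesis by force
    next
      case False
      have "R \<in> closed_points K" using R by (simp add: rational_points_def)
      from closed_point_at_infinity[OF this False] show ?thesis by simp
    qed
  qed
qed (use inf_rational affine_point_rational(1) in auto)

lemma card_rational_points:
  "card (rational_points K) = card {(c, d). d\<^sup>2 + d = poly f c} + 1"
proof -
  let ?P = "{(c, d). d\<^sup>2 + d = poly f c}"
  have "inj_on (\<lambda>(c, d). affine_point c d) ?P"
  proof (rule inj_onI, clarify)
    fix c d c' d'
    assume "d\<^sup>2 + d = poly f c" "d'\<^sup>2 + d' = poly f c'" "affine_point c d = affine_point c' d'"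
    then show "c = c' \<and> d = d'" by (rule affine_point_inj)
  qed
  moreover have "inf_ring \<notin> (\<lambda>(c, d). affine_point c d) ` ?P"
    using affine_point_rational(2) x_notin_inf by auto
  ultimately show ?thesis by (simp add: rational_points_eq card_image)
qed

end

subsection \<open>Regular differentials\<close>

lemma degree_pderiv_le: "degree (pderiv p) \<le> degree p - 1"
  by (rule degree_le) (auto simp: coeff_pderiv intro!: coeff_eq_0)

context artin_schreier_curve
begin

lemma K_diff: "u \<in> K \<Longrightarrow> v \<in> K \<Longrightarrow> u - v \<in> K"
  by (rule is_subfield_diff[OF subfield_K])

lemma K_0: "0 \<in> K" and K_1: "1 \<in> K"
  using const_K[of 0] const_K[of 1] by simp_all

text \<open>In characteristic 2 the square of A + B \<zeta> has \<zeta>-coefficient -B^2, so B = 0;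
  then A^2 = x C^2 fails by parity of degrees.\<close>

lemma x_not_square:
  assumes "w \<in> K" shows "w * w \<noteq> x"
proof
  assume ww: "w * w = x"
  obtain A B C where w: "w = lin A B / e C" and C: "C \<noteq> 0" using assms unfolding K_eq by blast
  have "lin A B * lin A B = w * e C * (w * e C)" using C by (simp add: w)
  also have "\<dots> = w * w * e (C * C)" by simp
  also have "\<dots> = lin ([:0, 1:] * (C * C)) 0" unfolding ww lin_0 emb_poly_mult ..
  finally have eq: "A * A + B * B * f = [:0, 1:] * (C * C)" "A * B + B * A - B * B = 0"
    unfolding lin_mult lin_eq_iff by blast+
  have "A * B + B * A = 0" by (simp add: mult.commute two_poly)
  then have "B * B = 0" using eq(2) by (metis diff_0 neg_equal_0_iff_equal)
  then have "B = 0" by simp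
  then have "A * A = [:0, 1:] * (C * C)" using eq(1) by simp
  then have "degree (A * A) = degree ([:0, 1:] * (C * C))" by (simp only:)
  moreover have "A \<noteq> 0" using \<open>A * A = _\<close> C by auto
  ultimately have "2 * degree A = 1 + 2 * degree C" using C by (simp add: degree_mult_eq)
  then show False by presburger
qed

lemma sq_form_eq_0D:
  assumes "u \<in> K" "v \<in> K" "u * u + x * (v * v) = 0"
  shows "v = 0"
proof (rule ccontr)
  assume v: "v \<noteq> 0"
  have "u * u = x * (v * v)" using assms(3) by (simp only: sum_eq_0_char2[OF two_ac])
  then have "(u / v) * (u / v) = x" using v by simp
  then show False using x_not_square[of "u / v"] is_subfield_divide[OF subfield_K assms(1,2)] by blast
qed

text \<open>In characteristic 2 every element of \<open>K\<close> is \<open>u\<^sup>2 + x v\<^sup>2\<close> with \<open>u, v \<in> K\<close>, and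
  \<open>d/dx\<close> maps it to \<open>v\<^sup>2\<close>.\<close>
definition ddx :: "'k rat_closure \<Rightarrow> 'k rat_closure" where
  "ddx w = (SOME z. \<exists>u\<in>K. \<exists>v\<in>K. w = u * u + x * (v * v) \<and> z = v * v)"

text \<open>The choice in \<open>ddx\<close> is well defined: two representations differ by a form
  (u - u')^2 + x (v - v')^2 = 0, and x is not a square in K.\<close>

lemma ddx_eq:
  assumes "u \<in> K" "v \<in> K"
  shows "ddx (u * u + x * (v * v)) = v * v"
  unfolding ddx_def
proof (rule some_equality)
  show "\<exists>u'\<in>K. \<exists>v'\<in>K. u * u + x * (v * v) = u' * u' + x * (v' * v') \<and> v * v = v' * v'"
    using assms by blast
  fix z assume "\<exists>u'\<in>K. \<exists>v'\<in>K. u * u + x * (v * v) = u' * u' + x * (v' * v') \<and> z = v' * v'"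
  then obtain u' v' where *: "u' \<in> K" "v' \<in> K" "u * u + x * (v * v) = u' * u' + x * (v' * v')" "z = v' * v'"
    by blast
  have "(u - u') * (u - u') + x * ((v - v') * (v - v'))
      = (u * u + x * (v * v)) - (u' * u' + x * (v' * v')) - 2 * (u * u' + x * (v * v') - (u' * u' + x * (v' * v')))"
    by (simp add: algebra_simps)
  also have "\<dots> = 0" unfolding *(3) two_ac by simp
  finally have "v - v' = 0" using sq_form_eq_0D[OF K_diff[OF assms(1) *(1)] K_diff[OF assms(2) *(2)]] by blast
  then show "z = v * v" using *(4) by simp
qed

lemma sq_form_add:
  "(u1 * u1 + x * (v1 * v1)) + (u2 * u2 + x * (v2 * v2))
    = (u1 + u2) * (u1 + u2) + x * ((v1 + v2) * (v1 + v2))"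
proof -
  have "(u1 + u2) * (u1 + u2) + x * ((v1 + v2) * (v1 + v2))
    = (u1 * u1 + x * (v1 * v1)) + (u2 * u2 + x * (v2 * v2)) + 2 * (u1 * u2 + x * (v1 * v2))"
    by (simp add: algebra_simps)
  then show ?thesis by (simp only: two_ac mult_zero_left add_0_right)
qed

lemma sq_form_mult:
  "(u1 * u1 + x * (v1 * v1)) * (u2 * u2 + x * (v2 * v2))
    = (u1 * u2 + x * (v1 * v2)) * (u1 * u2 + x * (v1 * v2))
      + x * ((u1 * v2 + v1 * u2) * (u1 * v2 + v1 * u2))"
proof -
  have "(u1 * u2 + x * (v1 * v2)) * (u1 * u2 + x * (v1 * v2)) + x * ((u1 * v2 + v1 * u2) * (u1 * v2 + v1 * u2))
    = (u1 * u1 + x * (v1 * v1)) * (u2 * u2 + x * (v2 * v2)) + 2 * (2 * (u1 * u2 * x * (v1 * v2)))"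
    by (simp add: algebra_simps)
  then show ?thesis by (simp only: two_ac mult_zero_left add_0_right)
qed

lemma const_square: "\<exists>d. emb_const c = emb_const d * emb_const (d::'k)"
proof -
  have "inj (\<lambda>d::'k. d\<^sup>2)"
    using power_2pow_eq_iff[OF two_k, of _ 1] by (simp add: inj_def)
  then have "surj (\<lambda>d::'k. d\<^sup>2)" by (simp add: finite_UNIV_inj_surj)
  then obtain d where "c = d\<^sup>2" by (metis surjD)
  then have "emb_const c = emb_const d * emb_const d" by (simp add: power2_eq_square emb_const_simps)
  then show ?thesis ..
qed

text \<open>The elements u^2 + x v^2 form a subfield. It contains the constants because a finite
  field is perfect, and it contains \<zeta> = \<zeta>^2 + f.\<close>

lemma sq_form:
  assumes "w \<in> K"
  obtains u v where "u \<in> K" "v \<in> K" "w = u * u + x * (v * v)"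
proof -
  let ?S = "{u * u + x * (v * v) | u v. u \<in> K \<and> v \<in> K}"
  have I: "u * u + x * (v * v) \<in> ?S" if "u \<in> K" "v \<in> K" for u v using that by blast
  have sq: "u * u \<in> ?S" if "u \<in> K" for u using I[OF that K_0] by simp
  have add: "w1 + w2 \<in> ?S" if w: "w1 \<in> ?S" "w2 \<in> ?S" for w1 w2
  proof -
    obtain u1 v1 u2 v2 where *: "u1 \<in> K" "v1 \<in> K" "w1 = u1 * u1 + x * (v1 * v1)"
      "u2 \<in> K" "v2 \<in> K" "w2 = u2 * u2 + x * (v2 * v2)" using w by blast
    show ?thesis unfolding *(3,6) sq_form_add by (rule I[OF K_add[OF *(1,4)] K_add[OF *(2,5)]])
  qed
  have mult: "w1 * w2 \<in> ?S" if w: "w1 \<in> ?S" "w2 \<in> ?S" for w1 w2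
  proof -
    obtain u1 v1 u2 v2 where *: "u1 \<in> K" "v1 \<in> K" "w1 = u1 * u1 + x * (v1 * v1)"
      "u2 \<in> K" "v2 \<in> K" "w2 = u2 * u2 + x * (v2 * v2)" using w by blast
    show ?thesis unfolding *(3,6) sq_form_mult by (intro I K_add K_mult x_K *(1,2,4,5))
  qed
  have gen: "range emb_const \<union> {x, \<zeta>} \<subseteq> ?S"
  proof -
    have c: "emb_const c \<in> ?S" for c
    proof -
      obtain d where d: "emb_const c = emb_const d * emb_const (d::'k)" using const_square[of c] by (elim exE)
      show ?thesis unfolding d by (rule sq[OF const_K])
    qed
    have xS: "x \<in> ?S" using I[OF K_0 K_1] by simp
    have "e f \<in> ?S" by (rule e_in) (fact c xS add mult)+
    then have "\<zeta> * \<zeta> + e f \<in> ?S" by (intro add sq zeta_K)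
    moreover have "\<zeta> * \<zeta> + e f = \<zeta> + 2 * (e f - \<zeta>)" unfolding zeta_sq by (simp add: algebra_simps)
    ultimately have "\<zeta> \<in> ?S" by (simp only: two_ac mult_zero_left add_0_right)
    with c xS show ?thesis by blast
  qed
  have "is_subfield ?S"
    unfolding is_subfield_def
  proof (intro conjI ballI)
    show "0 \<in> ?S" "1 \<in> ?S" using sq[OF K_0] sq[OF K_1] by simp_all
    fix w1 assume w1: "w1 \<in> ?S"
    then obtain u v where uv: "u \<in> K" "v \<in> K" "w1 = u * u + x * (v * v)" by blast
    then have "w1 \<in> K" by (simp add: K_add K_mult x_K)
    \<comment> \<open>An inverse is the element times a square.\<close>
    then have "w1 * (inverse w1 * inverse w1) \<in> ?S" by (intro mult w1 sq K_inverse)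
    then show "inverse w1 \<in> ?S" by (cases "w1 = 0") (simp_all add: mult.assoc[symmetric])
    show "- w1 \<in> ?S" using w1 by (simp only: minus_char2[OF two_ac])
    fix w2 assume w2: "w2 \<in> ?S"
    show "w1 + w2 \<in> ?S" by (rule add[OF w1 w2])
    show "w1 * w2 \<in> ?S" by (rule mult[OF w1 w2])
  qed
  with gen have "is_subfield hull (range emb_const \<union> {x, \<zeta>}) \<subseteq> ?S" by (rule hull_minimal)
  then have "K \<subseteq> ?S" by (simp only: K_def[symmetric])
  then show ?thesis using assms that by blast
qed

lemma derivationD:
  assumes "D \<in> derivations K"
  shows "u \<in> K \<Longrightarrow> D u \<in> K"
    and "u \<in> K \<Longrightarrow> v \<in> K \<Longrightarrow> D (u + v) = D u + D v"
    and "u \<in> K \<Longrightarrow> v \<in> K \<Longrightarrow> D (u * v) = u * D v + v * D u"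
    and "D (emb_const c) = 0"
  using assms unfolding derivations_def by simp_all

lemma ddx_derivation: "ddx \<in> derivations K" and ddx_x: "ddx x = 1"
proof -
  show "ddx x = 1" using ddx_eq[OF K_0 K_1] by simp
  have 1: "ddx w \<in> K" if w: "w \<in> K" for w
    using sq_form[OF w] ddx_eq K_mult by metis
  have 2: "ddx (w1 + w2) = ddx w1 + ddx w2 \<and> ddx (w1 * w2) = w1 * ddx w2 + w2 * ddx w1"
    if w: "w1 \<in> K" "w2 \<in> K" for w1 w2
  proof -
    obtain u1 v1 where 1: "u1 \<in> K" "v1 \<in> K" "w1 = u1 * u1 + x * (v1 * v1)" using sq_form[OF w(1)] .
    obtain u2 v2 where 2: "u2 \<in> K" "v2 \<in> K" "w2 = u2 * u2 + x * (v2 * v2)" using sq_form[OF w(2)] .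
    have d: "ddx w1 = v1 * v1" "ddx w2 = v2 * v2" unfolding 1(3) 2(3) using ddx_eq 1 2 by blast+
    have "ddx (w1 + w2) = (v1 + v2) * (v1 + v2)"
      unfolding 1(3) 2(3) sq_form_add by (rule ddx_eq[OF K_add[OF 1(1) 2(1)] K_add[OF 1(2) 2(2)]])
    also have "\<dots> = v1 * v1 + v2 * v2 + 2 * (v1 * v2)" by (simp add: algebra_simps)
    finally have a: "ddx (w1 + w2) = ddx w1 + ddx w2" unfolding d two_ac by simp
    have "ddx (w1 * w2) = (u1 * v2 + v1 * u2) * (u1 * v2 + v1 * u2)"
      unfolding 1(3) 2(3) sq_form_mult by (rule ddx_eq; intro K_add K_mult x_K 1(1,2) 2(1,2))
    also have "\<dots> = w1 * ddx w2 + w2 * ddx w1 + 2 * (u1 * v2 * v1 * u2 - x * (v1 * v1) * (v2 * v2))"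
      unfolding d unfolding 1(3) 2(3) by (simp add: algebra_simps)
    finally have "ddx (w1 * w2) = w1 * ddx w2 + w2 * ddx w1" unfolding two_ac by simp
    with a show ?thesis by blast
  qed
  have 3: "ddx (emb_const c) = 0" for c
  proof -
    obtain d where d: "emb_const c = emb_const d * emb_const (d::'k)" using const_square[of c] by (elim exE)
    show ?thesis unfolding d using ddx_eq[OF const_K[of d] K_0] by simp
  qed
  show "ddx \<in> derivations K" unfolding derivations_def using 1 2 3 by blast
qed

text \<open>Derivations kill squares, so on u^2 + x v^2 only v^2 D x remains. Hence every
  differential is its value at \<open>ddx\<close> times dx.\<close>

lemma derivation_eq_ddx:
  assumes D: "D \<in> derivations K" and b: "b \<in> K"
  shows "D b = ddx b * D x"
proof -
  note d = derivationD[OF D]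
  obtain u v where uv: "u \<in> K" "v \<in> K" "b = u * u + x * (v * v)" using sq_form[OF b] .
  have sq: "D (w * w) = 0" if "w \<in> K" for w
    using d(3)[OF that that] dbl_ac by simp
  have "D b = D (u * u) + D (x * (v * v))" unfolding uv(3) by (intro d K_mult uv x_K)
  also have "D (x * (v * v)) = x * D (v * v) + v * v * D x" by (intro d K_mult uv x_K)
  also have "D (u * u) + (x * D (v * v) + v * v * D x) = v * v * D x" using sq uv by simp
  also have "v * v = ddx b" unfolding uv(3) using ddx_eq uv by simp
  finally show ?thesis .
qed

lemmas ddx_K = derivationD(1)[OF ddx_derivation]
  and ddx_add = derivationD(2)[OF ddx_derivation]
  and ddx_mult = derivationD(3)[OF ddx_derivation]
  and ddx_const = derivationD(4)[OF ddx_derivation]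

lemma ddx_e: "ddx (e p) = e (pderiv p)"
proof (induction p)
  case 0
  show ?case using ddx_const[of 0] by simp
next
  case (pCons c p)
  have "ddx (e (pCons c p)) = ddx (emb_const c) + (x * ddx (e p) + e p * ddx x)"
    unfolding emb_poly_pCons[of c p] by (simp add: ddx_add ddx_mult const_K K_mult x_K e_K)
  also have "\<dots> = e (p + pCons 0 (pderiv p))"
    unfolding pCons.IH emb_poly_add emb_poly_pCons[of 0 "pderiv p"] by (simp add: ddx_const ddx_x)
  finally show ?case by (simp add: pderiv_pCons)
qed

lemma ddx_zeta: "ddx \<zeta> = e (pderiv f)"
proof -
  have "ddx (\<zeta> * \<zeta> + \<zeta>) = (\<zeta> * ddx \<zeta> + \<zeta> * ddx \<zeta>) + ddx \<zeta>"
    by (simp only: ddx_add[OF K_mult[OF zeta_K zeta_K] zeta_K] ddx_mult[OF zeta_K zeta_K])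
  then have "ddx (\<zeta> * \<zeta> + \<zeta>) = ddx \<zeta>" by (simp only: dbl_ac add_0_left)
  moreover have "\<zeta> * \<zeta> + \<zeta> = e f" unfolding zeta_sq by simp
  ultimately show ?thesis by (simp only: ddx_e)
qed

lemma ddx_lin: "ddx (lin A B) = lin (pderiv A + B * pderiv f) (pderiv B)"
proof -
  have "ddx (lin A B) = e (pderiv A) + (e B * e (pderiv f) + \<zeta> * e (pderiv B))"
    unfolding lin_def by (simp only: ddx_add[OF e_K K_mult[OF e_K zeta_K]] ddx_mult[OF e_K zeta_K] ddx_e ddx_zeta)
  then show ?thesis by (simp add: lin_def algebra_simps)
qed

lemma ddx_divide:
  assumes "u \<in> K" "c \<in> K" "c \<noteq> 0"
  shows "ddx (u / c) = (ddx u - u / c * ddx c) / c"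
proof -
  have "u / c \<in> K" by (rule is_subfield_divide[OF subfield_K assms(1,2)])
  from ddx_mult[OF this assms(2)] have "ddx u = u / c * ddx c + c * ddx (u / c)" using assms(3) by simp
  then have "c * ddx (u / c) = ddx u - u / c * ddx c" by simp
  then show ?thesis using assms(3) by (metis nonzero_mult_div_cancel_left)
qed

text \<open>d/dx maps k[x, \<zeta>] to itself because the derivative of \<zeta> is that of f;
  denominators are units of R, so the quotient rule stays in R.\<close>

lemma ddx_finite:
  assumes R: "R \<in> closed_points K" and x: "x \<in> R" and u: "u \<in> R"
  shows "ddx u \<in> R"
proof -
  interpret closed_point K R by standard (rule subfield_K R)+
  let ?M = "\<mm> \<inter> affine_ring"
  obtain P where P: "prime_over P ?M" "R = local_ring ?M" using finite_closed_point[OF R x] .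
  have aff: "u \<in> R" if "u \<in> affine_ring" for u
    using affine_sub_closed_point[OF R x] that by blast
  obtain b c where bc: "u = b / c" "b \<in> affine_ring" "c \<in> affine_ring - ?M"
    using u P(2) unfolding local_ring_def by blast
  have c0: "c \<noteq> 0" by (rule diff_M_nz[OF P(1) bc(3)])
  have ic: "inverse c \<in> R" using bc(3) unit[OF aff, of c] by blast
  have da: "ddx w \<in> R" if "w \<in> affine_ring" for w
    using that by (elim affineE) (simp only: ddx_lin aff lin_affine)
  have "b \<in> K" "c \<in> K" using bc(2,3) affine_sub_K[OF P(1)] by blast+
  then have "ddx u = (ddx b - u * ddx c) * inverse c"
    unfolding bc(1) divide_inverse[of "_ - _", symmetric] by (rule ddx_divide[OF _ _ c0])
  also have "\<dots> \<in> R" using bc by (intro mult diff da u ic) blast+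
  finally show ?thesis .
qed

text \<open>The differential of a regular function is a regular multiple of x^(g-1) dx; in terms of
  divisors, dx has a zero of order 2 g - 2 at infinity.\<close>

lemma ddx_inf:
  assumes u: "u \<in> inf_ring"
  obtains r where "r \<in> inf_ring" "ddx u = x ^ (g - 1) * r"
proof -
  obtain A B C where uABC: "u = lin A B / e C" "C \<noteq> 0" "degree A \<le> degree C" "degree (sh B) \<le> degree C"
    using u by (elim inf_ringE)
  define n where "n = degree C"
  have eC: "e C \<noteq> 0" using uABC by simp
  define A2 where "A2 = C * pderiv A + C * B * pderiv f - pderiv C * A"
  define B2 where "B2 = C * pderiv B - pderiv C * B"
  have "ddx u = (ddx (lin A B) - lin A B / e C * ddx (e C)) / e C"
    unfolding uABC(1) by (rule ddx_divide[OF lin_K e_K eC])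
  also have "\<dots> = (e C * ddx (lin A B) - ddx (e C) * lin A B) / e (C * C)"
    using eC by (simp add: field_simps)
  also have "e C * ddx (lin A B) - ddx (e C) * lin A B = lin A2 B2"
    unfolding ddx_lin ddx_e e_lin lin_diff A2_def B2_def by (simp add: algebra_simps)
  finally have du: "ddx u = lin A2 B2 / e (C * C)" .
  define C2 where "C2 = [:0, 1:] ^ (g - 1) * (C * C)"
  have C2: "C2 \<noteq> 0" "degree C2 = g - 1 + 2 * n"
    using uABC(2) by (simp_all add: C2_def n_def degree_mult_eq degree_power_eq)
  have bB: "B \<noteq> 0 \<Longrightarrow> degree B + g + 1 \<le> n" using uABC(4) degree_sh[of B] by (auto simp: n_def)
  have f': "degree (pderiv f) \<le> 2 * g" using degree_pderiv_le[of f] deg_f by simp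
  have pd: "degree (pderiv p) \<le> degree p" for p :: "'k poly" using degree_pderiv_le[of p] by linarith
  have r: "lin A2 B2 / e C2 \<in> inf_ring"
    unfolding inf_ring_iff[OF C2(1)] C2(2)
  proof
    have 1: "degree (C * pderiv A) \<le> g - 1 + 2 * n"
      using degree_mult_le[of C "pderiv A"] pd[of A] uABC(3) unfolding n_def by linarith
    \<comment> \<open>The critical term, from the derivative of \<zeta>: n + (n - g - 1) + 2 g = 2 n
      + g - 1 is where the exponent g - 1 comes from.\<close>
    have 2: "degree (C * B * pderiv f) \<le> g - 1 + 2 * n"
    proof (cases "B = 0")
      case False
      show ?thesis
        using degree_mult_le[of "C * B" "pderiv f"] degree_mult_le[of C B] f' bB[OF False] g unfolding n_def by linarith
    qed simp
    have 3: "degree (pderiv C * A) \<le> g - 1 + 2 * n"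
      using degree_mult_le[of "pderiv C" A] pd[of C] uABC(3) unfolding n_def by linarith
    show "degree A2 \<le> g - 1 + 2 * n"
      unfolding A2_def by (intro degree_diff_le degree_add_le 1 2 3)
    show "degree (sh B2) \<le> g - 1 + 2 * n"
    proof (cases "B = 0")
      case False
      have "degree (C * pderiv B) \<le> n + degree B" "degree (pderiv C * B) \<le> n + degree B"
        using degree_mult_le[of C "pderiv B"] pd[of B] degree_mult_le[of "pderiv C" B] pd[of C]
        unfolding n_def by linarith+
      then have "degree B2 \<le> n + degree B" unfolding B2_def by (rule degree_diff_le)
      moreover have "degree (monom (1::'k) (g + 1)) = g + 1" by (simp add: degree_monom_eq)
      ultimately show ?thesis
        using degree_mult_le[of "monom 1 (g + 1)" B2] bB[OF False] by linarith
    qed (simp add: B2_def)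
  qed
  have "x ^ (g - 1) \<noteq> 0" by simp
  then have "ddx u = x ^ (g - 1) * (lin A2 B2 / e C2)"
    unfolding du C2_def by simp
  with r show ?thesis by (rule that)
qed

text \<open>The differential p dx; its value at \<open>ddx\<close> recovers p.\<close>

definition dform :: "'k poly \<Rightarrow> 'k diff" where
  "dform p = (\<lambda>D. if D \<in> derivations K then e p * D x else 0)"

lemma dform_add: "dform (p + q) = dform p + dform q"
  by (auto simp: dform_def fun_eq_iff algebra_simps)

lemma dform_smult: "dform (smult c p) = scale_diff c (dform p)"
  by (auto simp: dform_def fun_eq_iff scale_diff_def emb_poly_smult)

lemma dform_0: "dform 0 = 0"
  by (auto simp: dform_def fun_eq_iff)

lemma dform_eq_iff: "dform p = dform q \<longleftrightarrow> p = q"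
proof
  assume "dform p = dform q"
  then have "dform p ddx = dform q ddx" by simp
  then show "p = q" using ddx_derivation ddx_x by (simp add: dform_def)
qed simp

lemma dform_sum: "dform (\<Sum>i\<in>A. p i) = (\<Sum>i\<in>A. dform (p i))"
  by (induction A rule: infinite_finite_induct)
    (simp_all only: sum.infinite sum.empty sum.insert dform_add dform_0 not_False_eq_True)

lemma differentialsI:
  assumes "b \<in> R" "a \<in> R" "\<And>D. D \<in> derivations K \<Longrightarrow> a * D b = e p * D x"
  shows "dform p \<in> differentials K R"
  unfolding differentials_def
proof (intro CollectI exI conjI)
  show "finite {b}" "{b} \<subseteq> R" "(\<lambda>_. a) ` {b} \<subseteq> R" using assms by auto
  show "dform p = (\<lambda>D. if D \<in> derivations K then \<Sum>b\<in>{b}. (\<lambda>_. a) b * D b else 0)"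
    by (rule ext) (use assms(3) in \<open>simp add: dform_def\<close>)
qed

lemma pderiv_f: "pderiv f \<noteq> 0" "degree (pderiv f) = 2 * g"
proof -
  have "of_nat (2 * g + 1) = (1::'k)" by (simp add: two_k)
  then have "coeff (pderiv f) (2 * g) = lead_coeff f" by (simp add: coeff_pderiv deg_f two_k)
  then have nz: "coeff (pderiv f) (2 * g) \<noteq> 0" using f_nz by simp
  then show "pderiv f \<noteq> 0" by auto
  show "degree (pderiv f) = 2 * g"
    using le_degree[OF nz] degree_pderiv_le[of f] deg_f by simp
qed

text \<open>At infinity \<open>x ^ g / \<zeta>\<close> is a uniformizer.\<close>
lemma dform_regular:
  assumes "degree p < g"
  shows "dform p \<in> regular_differentials K"
  unfolding regular_differentials_def
proof (intro CollectI conjI ballI)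
  show "dform p \<in> differentials K K" by (rule differentialsI[OF x_K e_K[of p]]) simp
  fix R assume R: "R \<in> closed_points K"
  show "dform p \<in> differentials K R"
  proof (cases "x \<in> R")
    case True
    then show ?thesis
      by (rule differentialsI[OF _ subsetD[OF affine_sub_closed_point[OF R True] e_affine[of p]]]) simp
  next
    case False
    have Rinf: "R = inf_ring" by (rule closed_point_at_infinity[OF R False])
    let ?X = "[:0, 1:] :: 'k poly"
    \<comment> \<open>This is x^g / \<zeta> without \<zeta> in the denominator, since \<zeta> (1 +
      \<zeta>) = f.\<close>
    define \<pi> where "\<pi> = lin (?X ^ g) (?X ^ g) / e f"
    \<comment> \<open>From \<zeta> \<pi> = x^g and d(x^g) = 0 follows d\<pi> = - (x^g f' /
      \<zeta>^2) dx. So \<open>a\<close> is p dx divided by d\<pi>, written with \<zeta>^2 = f -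
      \<zeta>.\<close>
    define a where "a = lin (- (p * f)) p / e (?X ^ g * pderiv f)"
    have dX: "degree (?X ^ g) = g" "?X ^ g \<noteq> 0" by (simp_all add: degree_power_eq)
    have \<pi>R: "\<pi> \<in> inf_ring"
      unfolding \<pi>_def inf_ring_iff[OF f_nz] degree_sh[OF dX(2)] using dX(1) deg_f by simp
    have nz: "?X ^ g * pderiv f \<noteq> 0" "degree (?X ^ g * pderiv f) = 3 * g"
      using pderiv_f dX by (simp_all add: degree_mult_eq del: power_eq_0_iff)
    have aR: "a \<in> inf_ring"
      unfolding a_def inf_ring_iff[OF nz(1)] nz(2)
    proof
      show "degree (- (p * f)) \<le> 3 * g" using degree_mult_le[of p f] assms deg_f by simp
      show "degree (sh p) \<le> 3 * g" using degree_sh[of p] assms by (cases "p = 0") auto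
    qed
    have z0: "\<zeta> \<noteq> 0" using lin_eq_0_iff[of 0 1] by (auto simp: lin_def)
    have lin11: "lin 1 1 \<noteq> 0" using lin_eq_0_iff[of 1 1] by simp
    have z1: "\<zeta> * lin 1 1 = e f" by (simp add: lin_def algebra_simps zeta_sq)
    have "\<zeta> * \<pi> = x ^ g * (\<zeta> * lin 1 1) / e f" unfolding \<pi>_def by (simp add: lin_def algebra_simps)
    then have z\<pi>: "\<zeta> * \<pi> = e (?X ^ g)" unfolding z1 using f_nz by simp
    have \<pi>K: "\<pi> \<in> K" using \<pi>R inf_ring_sub by blast
    have pX: "pderiv (?X ^ g) = 0"
    proof -
      obtain m where "g = 2 * m" using g(2) by (elim evenE)
      then have "of_nat g = (0::'k)" by (simp add: two_k)
      then show ?thesis using pderiv_power[of ?X g] by simp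
    qed
    have "\<zeta> * ddx \<pi> + \<pi> * e (pderiv f) = 0"
      using ddx_mult[OF zeta_K \<pi>K] unfolding z\<pi> ddx_e pX ddx_zeta by simp
    then have "\<zeta> * (\<zeta> * ddx \<pi>) = - (\<zeta> * \<pi> * e (pderiv f))"
      by (metis (no_types) add_eq_0_iff2 mult_minus_right mult.assoc)
    then have zz: "\<zeta> * \<zeta> * ddx \<pi> = - (e (?X ^ g) * e (pderiv f))" unfolding z\<pi> by (simp only: mult.assoc)
    have "lin (- (p * f)) p = - (e p * (\<zeta> * \<zeta>))"
      unfolding zeta_sq by (simp add: lin_def algebra_simps)
    then have "a * ddx \<pi> = - (e p * (\<zeta> * \<zeta> * ddx \<pi>)) / e (?X ^ g * pderiv f)"
      unfolding a_def by (simp add: mult_ac)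
    also have "\<dots> = e p * e (?X ^ g * pderiv f) / e (?X ^ g * pderiv f)" unfolding zz by simp
    also have "\<dots> = e p" using nz(1) by (simp del: emb_poly_mult)
    finally have a\<pi>: "a * ddx \<pi> = e p" .
    show ?thesis unfolding Rinf
    proof (rule differentialsI[OF \<pi>R aR])
      fix D assume "D \<in> derivations K"
      from derivation_eq_ddx[OF this \<pi>K] show "a * D \<pi> = e p * D x"
        using a\<pi> by (simp add: mult.assoc[symmetric])
    qed
  qed
qed

lemma differentialsE:
  assumes "\<omega> \<in> differentials K R"
  obtains S a where "S \<subseteq> R" "a ` S \<subseteq> R" "\<omega> ddx = (\<Sum>b\<in>S. a b * ddx b)"
    "\<omega> = (\<lambda>D. if D \<in> derivations K then \<Sum>b\<in>S. a b * D b else 0)"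
proof -
  obtain S a where S: "S \<subseteq> R" "a ` S \<subseteq> R"
    "\<omega> = (\<lambda>D. if D \<in> derivations K then \<Sum>b\<in>S. a b * D b else 0)"
    using assms unfolding differentials_def by blast
  moreover have "\<omega> ddx = (\<Sum>b\<in>S. a b * ddx b)" unfolding S(3) using ddx_derivation by simp
  ultimately show ?thesis using that by blast
qed

text \<open>Write the differential as u dx. Regularity at the finite places puts u into
  k[x, \<zeta>]; at infinity u / x^(g-1) is regular, so A has degree at most g - 1, and a nonzero B
  would need degree B + g + 1 \<le> g - 1.\<close>

lemma regular_dform:
  assumes \<omega>: "\<omega> \<in> regular_differentials K"
  shows "\<exists>p. degree p < g \<and> \<omega> = dform p"
proof -
  have KK: "\<omega> \<in> differentials K K" and reg: "\<And>R. R \<in> closed_points K \<Longrightarrow> \<omega> \<in> differentials K R"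
    using \<omega> unfolding regular_differentials_def by blast+
  define u where "u = \<omega> ddx"
  obtain S a where S: "S \<subseteq> K" "a ` S \<subseteq> K" "u = (\<Sum>b\<in>S. a b * ddx b)"
     and \<omega>_def: "\<omega> = (\<lambda>D. if D \<in> derivations K then \<Sum>b\<in>S. a b * D b else 0)"
    unfolding u_def using KK by (rule differentialsE)
  have uK: "u \<in> K" unfolding S(3)
    using S(1,2) by (intro is_subfield_sum[OF subfield_K] K_mult ddx_K) auto
  have \<omega>D: "\<omega> D = u * D x" if D: "D \<in> derivations K" for D
  proof -
    have "\<omega> D = (\<Sum>b\<in>S. a b * ddx b * D x)"
    proof -
      have "a b * D b = a b * ddx b * D x" if "b \<in> S" for b
        using derivation_eq_ddx[OF D, of b] S(1) that by (simp only: mult.assoc subsetD)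
      then have "(\<Sum>b\<in>S. a b * D b) = (\<Sum>b\<in>S. a b * ddx b * D x)" by (rule sum.cong[OF refl])
      then show ?thesis using D by (simp only: \<omega>_def if_True)
    qed
    then show ?thesis by (simp only: S(3) sum_distrib_right)
  qed
  have "u \<in> affine_ring"
  proof (rule affine_ring_eq_Inter[OF uK])
    fix R assume R: "R \<in> closed_points K" and x: "x \<in> R"
    interpret closed_point K R by standard (rule subfield_K R)+
    obtain S' a' where S': "S' \<subseteq> R" "a' ` S' \<subseteq> R" "u = (\<Sum>b\<in>S'. a' b * ddx b)"
      unfolding u_def using reg[OF R] by (rule differentialsE)
    show "u \<in> R" unfolding S'(3)
      by (intro sum mult ddx_finite[OF R x]) (use S' in auto)
  qed
  then obtain A B where uAB: "u = lin A B" by (elim affineE)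
  interpret I: closed_point K inf_ring by standard (rule subfield_K inf_closed_point)+
  obtain S' a' where S': "S' \<subseteq> inf_ring" "a' ` S' \<subseteq> inf_ring" "u = (\<Sum>b\<in>S'. a' b * ddx b)"
    unfolding u_def using reg[OF inf_closed_point] by (rule differentialsE)
  have "\<forall>b\<in>S'. \<exists>r. r \<in> inf_ring \<and> ddx b = x ^ (g - 1) * r"
  proof
    fix b assume "b \<in> S'"
    then have "b \<in> inf_ring" using S'(1) by blast
    then obtain r where "r \<in> inf_ring" "ddx b = x ^ (g - 1) * r" by (rule ddx_inf)
    then show "\<exists>r. r \<in> inf_ring \<and> ddx b = x ^ (g - 1) * r" by blast
  qed
  from bchoice[OF this] obtain r where r: "\<And>b. b \<in> S' \<Longrightarrow> r b \<in> inf_ring \<and> ddx b = x ^ (g - 1) * r b"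
    by blast
  have "u = x ^ (g - 1) * (\<Sum>b\<in>S'. a' b * r b)"
    unfolding S'(3) sum_distrib_left by (rule sum.cong) (use r in \<open>simp_all add: mult_ac\<close>)
  moreover have "x ^ (g - 1) \<noteq> 0" by simp
  ultimately have "u / e ([:0, 1:] ^ (g - 1)) = (\<Sum>b\<in>S'. a' b * r b)" by simp
  also have "\<dots> \<in> inf_ring" using r S'(2) by (intro I.sum I.mult) auto
  finally have in_inf: "lin A B / e ([:0, 1:] ^ (g - 1)) \<in> inf_ring" unfolding uAB .
  have Xg: "[:0, 1:] ^ (g - 1) \<noteq> (0::'k poly)" "degree ([:0, 1:] ^ (g - 1) :: 'k poly) = g - 1"
    by (simp_all add: degree_power_eq)
  have d: "degree A \<le> g - 1" "degree (sh B) \<le> g - 1"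
    using in_inf unfolding inf_ring_iff[OF Xg(1)] Xg(2) by blast+
  have "B = 0" using d(2) degree_sh[of B] by linarith
  then have u: "u = e A" by (simp add: uAB lin_0)
  have "\<omega> = dform A"
  proof (rule ext)
    fix D show "\<omega> D = dform A D"
      using \<omega>D[of D] u by (cases "D \<in> derivations K") (simp_all add: dform_def \<omega>_def)
  qed
  moreover have "degree A < g" using d(1) g(1) by linarith
  ultimately show ?thesis by blast
qed

lemma regular_differentials_eq: "regular_differentials K = dform ` {p. degree p < g}"
proof (rule subset_antisym[OF subsetI image_subsetI])
  fix \<omega> assume "\<omega> \<in> regular_differentials K"
  from regular_dform[OF this] show "\<omega> \<in> dform ` {p. degree p < g}" by auto
qed (simp add: dform_regular)

lemma has_genus: "has_genus K g"
proof -
  let ?b = "\<lambda>i. dform (monom 1 i)"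
  let ?B = "?b ` {..<g}"
  have comb: "(\<Sum>i<g. scale_diff (c i) (?b i)) = dform (\<Sum>i<g. monom (c i) i)" for c
    by (simp add: dform_sum smult_monom flip: dform_smult)
  have co: "coeff (\<Sum>i<g. monom (c i) i) j = (if j < g then c j else 0)" for c :: "nat \<Rightarrow> 'k" and j
    by (simp add: coeff_sum)
  have inj: "inj_on ?b {..<g}"
  proof (rule inj_onI)
    fix i j assume "?b i = ?b j"
    then have "monom 1 i = (monom 1 j :: 'k poly)" by (simp only: dform_eq_iff)
    then show "i = j" by (metis degree_monom_eq zero_neq_one)
  qed
  have fin: "finite ?B" by (rule finite_imageI) (rule finite_lessThan)
  have scal: "c \<omega> = 0" if 0: "(\<Sum>\<omega>\<in>?B. scale_diff (c \<omega>) \<omega>) = 0" and \<omega>: "\<omega> \<in> ?B" for c \<omega>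
  proof -
    from \<omega> obtain j where j': "\<omega> = ?b j" "j \<in> {..<g}" by (rule imageE)
    then have j: "j < g" "\<omega> = ?b j" by simp_all
    have eq: "(\<Sum>\<omega>\<in>?B. scale_diff (c \<omega>) \<omega>) = (\<Sum>i<g. scale_diff (c (?b i)) (?b i))"
      by (rule sum.reindex_cong[OF inj refl]) (rule refl)
    have "(\<Sum>i<g. scale_diff (c (?b i)) (?b i)) = 0" by (rule trans[OF eq[symmetric] 0])
    then have "dform (\<Sum>i<g. monom (c (?b i)) i) = dform 0"
      unfolding comb dform_0 .
    then have "(\<Sum>i<g. monom (c (?b i)) i) = 0" unfolding dform_eq_iff .
    then have "coeff (\<Sum>i<g. monom (c (?b i)) i) j = coeff 0 j" by (rule arg_cong)
    then have "c (?b j) = 0" unfolding co coeff_0 using j(1) by (simp only: if_True)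
    then show "c \<omega> = 0" by (simp only: j(2))
  qed
  have "diffs.independent ?B" proof
    assume "diffs.dependent ?B"
    then obtain u where u: "(\<Sum>v\<in>?B. scale_diff (u v) v) = 0" "\<exists>v\<in>?B. u v \<noteq> 0"
      unfolding diffs.dependent_finite[OF fin] by (elim exE conjE)
    then show False using scal[OF u(1)] by (elim bexE) blast
  qed
  moreover have "diffs.span ?B = regular_differentials K"
  proof
    have "diffs.subspace (dform ` {p. degree p < g})"
    proof (rule diffs.subspaceI)
      have "dform 0 \<in> dform ` {p. degree p < g}" using g(1) by (intro imageI CollectI) simp
      then show "0 \<in> dform ` {p. degree p < g}" by (simp only: dform_0)
      fix v w c assume v: "v \<in> dform ` {p. degree p < g}"
      then obtain p where p: "degree p < g" "v = dform p" by blast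
      have "degree (smult c p) < g" using degree_smult_le[of c p] p(1) by (rule le_less_trans)
      then show "scale_diff c v \<in> dform ` {p. degree p < g}"
        unfolding p(2) dform_smult[symmetric] by (intro imageI CollectI)
      assume w: "w \<in> dform ` {p. degree p < g}"
      then obtain q where q: "degree q < g" "w = dform q" by blast
      show "v + w \<in> dform ` {p. degree p < g}"
        unfolding p(2) q(2) dform_add[symmetric] by (intro imageI CollectI degree_add_less p q)
    qed
    moreover have "?B \<subseteq> dform ` {p. degree p < g}"
    proof (rule image_subsetI)
      fix i assume "i \<in> {..<g}"
      then have "degree (monom (1::'k) i) < g" by (intro le_less_trans[OF degree_monom_le]) simp
      then show "dform (monom 1 i) \<in> dform ` {p. degree p < g}" by (intro imageI CollectI)
    qed
    ultimately show "diffs.span ?B \<subseteq> regular_differentials K"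
      unfolding regular_differentials_eq by (intro diffs.span_minimal)
    show "regular_differentials K \<subseteq> diffs.span ?B"
    proof
      fix \<omega> assume "\<omega> \<in> regular_differentials K"
      then obtain p where p: "degree p < g" "\<omega> = dform p" using regular_dform by blast
      have "p = (\<Sum>i<g. monom (coeff p i) i)"
        by (rule poly_eqI) (use p(1) in \<open>auto simp: co coeff_eq_0\<close>)
      then have "\<omega> = (\<Sum>i<g. scale_diff (coeff p i) (?b i))" unfolding comb p(2) by (rule arg_cong)
      also have "\<dots> \<in> diffs.span ?B"
        by (intro diffs.span_sum diffs.span_scale diffs.span_base imageI)
      finally show "\<omega> \<in> diffs.span ?B" .
    qed
  qed
  moreover have "card ?B = g" using card_image[OF inj] by simp
  ultimately show ?thesis unfolding has_genus_def by blast
qed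

end

subsection \<open>Geometric connectedness\<close>

lemma is_subfield_mult: "is_subfield F \<Longrightarrow> u \<in> F \<Longrightarrow> v \<in> F \<Longrightarrow> u * v \<in> F"
  unfolding is_subfield_def by blast

text \<open>Reduction modulo p keeps all powers of w in the finite set of F-combinations of the
  first n powers. It shows both that algebraic constants are fixed by a power of Frobenius and that
  x is transcendental.\<close>

lemma finite_powers:
  fixes F :: "'a::field set"
  assumes F: "is_subfield F" "finite F" and p: "p \<noteq> 0" "\<And>i. coeff p i \<in> F" and w: "poly p w = 0"
  shows "finite (range (\<lambda>i. w ^ i))"
proof -
  define n where "n = degree p"
  define V where "V = (\<lambda>c. \<Sum>j<n. c j * w ^ j) ` ({..<n} \<rightarrow>\<^sub>E F)"
  have "finite V" unfolding V_def by (intro finite_imageI finite_PiE) (simp_all add: F)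
  have n: "n > 0"
  proof (rule ccontr)
    assume "\<not> n > 0"
    then obtain c where c: "p = [:c:]" unfolding n_def using degree_eq_zeroE by blast
    then show False using w p(1) by simp
  qed
  have VI: "(\<Sum>j<n. c j * w ^ j) \<in> V" if "\<And>j. c j \<in> F" for c
  proof -
    have "(\<Sum>j<n. c j * w ^ j) = (\<Sum>j<n. restrict c {..<n} j * w ^ j)" by (rule sum.cong) auto
    then show ?thesis unfolding V_def using that by (intro image_eqI[of _ _ "restrict c {..<n}"]) auto
  qed
  have wn: "w ^ n = - (\<Sum>j<n. coeff p j / lead_coeff p * w ^ j)"
  proof -
    have "0 = (\<Sum>j\<le>n. coeff p j * w ^ j)" using w by (simp add: poly_altdef n_def)
    also have "{..n} = insert n {..<n}" by auto
    also have "(\<Sum>j\<in>insert n {..<n}. coeff p j * w ^ j) = lead_coeff p * w ^ n + (\<Sum>j<n. coeff p j * w ^ j)"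
      by (simp add: n_def)
    finally have "lead_coeff p * w ^ n = - (\<Sum>j<n. coeff p j * w ^ j)" by (simp add: eq_neg_iff_add_eq_0)
    moreover have "w ^ n = lead_coeff p * w ^ n / lead_coeff p" using p(1) by simp
    ultimately have "w ^ n = - (\<Sum>j<n. coeff p j * w ^ j) / lead_coeff p" by (simp only:)
    then show ?thesis by (simp add: sum_divide_distrib)
  qed
  have "w ^ i \<in> V" for i
  proof (induction i)
    case 0
    have "(\<Sum>j<n. (if j = 0 then 1 else 0) * w ^ j) \<in> V"
      by (rule VI) (use F in \<open>auto simp: is_subfield_def\<close>)
    moreover have "(\<Sum>j<n. (if j = 0 then 1 else 0) * w ^ j) = (\<Sum>j<n. if j = 0 then 1 else 0)"
      by (rule sum.cong) auto
    ultimately show ?case using n by simp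
  next
    case (Suc i)
    then obtain c where c: "c \<in> {..<n} \<rightarrow>\<^sub>E F" "w ^ i = (\<Sum>j<n. c j * w ^ j)" unfolding V_def by blast
    \<comment> \<open>Multiplication by w shifts the coefficients up, and the overflow
      \<open>c (n - 1)\<close> is reduced by the monic relation for w^n.\<close>
    define c' where "c' j = (if j < n then (if j = 0 then 0 else c (j - 1)) - c (n - 1) * (coeff p j / lead_coeff p) else 0)" for j
    have cF: "c j \<in> F" if "j < n" for j using c(1) that by auto
    have "c' j \<in> F" for j
    proof (cases "j < n")
      case True
      have "(if j = 0 then 0 else c (j - 1)) \<in> F" using cF[of "j - 1"] True F(1) by (auto simp: is_subfield_def)
      moreover have "c (n - 1) * (coeff p j / lead_coeff p) \<in> F"
        by (intro is_subfield_mult[OF F(1)] is_subfield_divide[OF F(1)] p(2) cF) (use n in simp)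
      ultimately show ?thesis using True is_subfield_diff[OF F(1)] by (simp add: c'_def)
    next
      case False
      then show ?thesis using F(1) by (simp add: c'_def is_subfield_def)
    qed
    then have 1: "(\<Sum>j<n. c' j * w ^ j) \<in> V" by (rule VI)
    obtain m where m: "n = Suc m" using n by (cases n) auto
    have "w ^ Suc i = (\<Sum>j<Suc m. c j * w ^ Suc j)"
      unfolding power_Suc c(2) m sum_distrib_left by (rule sum.cong) (auto simp: mult_ac)
    also have "\<dots> = (\<Sum>j<m. c j * w ^ Suc j) + c m * w ^ n" by (simp add: m)
    also have "(\<Sum>j<m. c j * w ^ Suc j) = (\<Sum>j<n. (if j = 0 then 0 else c (j - 1)) * w ^ j)"
      unfolding m by (subst sum.lessThan_Suc_shift) simp
    also have "c m * w ^ n = - (\<Sum>j<n. c (n - 1) * (coeff p j / lead_coeff p) * w ^ j)"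
    proof -
      have "c m = c (n - 1)" by (simp add: m)
      then show ?thesis unfolding wn by (simp only: mult_minus_right sum_distrib_left mult.assoc)
    qed
    also have "(\<Sum>j<n. (if j = 0 then 0 else c (j - 1)) * w ^ j) + - (\<Sum>j<n. c (n - 1) * (coeff p j / lead_coeff p) * w ^ j)
       = (\<Sum>j<n. c' j * w ^ j)"
      unfolding add_uminus_conv_diff sum_subtractf[symmetric]
      by (rule sum.cong[OF refl]) (simp only: c'_def lessThan_iff if_True left_diff_distrib)
    finally show ?case using 1 by simp
  qed
  then have "range (\<lambda>i. w ^ i) \<subseteq> V" by blast
  then show ?thesis using \<open>finite V\<close> by (rule finite_subset)
qed

lemma fixed_power_mult:
  assumes "(w::'a::comm_monoid_mult) ^ 2 ^ M = w"
  shows "w ^ 2 ^ (M * k) = w"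
proof (induction k)
  case (Suc k)
  have "w ^ 2 ^ (M * Suc k) = (w ^ 2 ^ M) ^ 2 ^ (M * k)" by (simp add: power_add power_mult)
  then show ?case by (simp only: assms Suc)
qed simp

text \<open>A finite field inside the ambient closure; a suitable M makes it contain any given
  finite set of algebraic constants.\<close>

definition fixed_field :: "nat \<Rightarrow> 'a::field set" where
  "fixed_field M = {w. w ^ 2 ^ M = w}"

lemma emb_poly_eval: "emb_poly p = poly (map_poly emb_const p) (emb_poly [:0, 1:])"
proof -
  have "degree (map_poly emb_const p) = degree p" by (intro degree_map_poly) simp
  then show ?thesis unfolding emb_poly_altdef[of p] poly_altdef by (simp add: coeff_map_poly)
qed

text \<open>A linear functional on the closure with prescribed value at one vector transports linear
  relations with coefficients in the closure to relations over the constants.\<close>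
lemma ex_const_functional:
  fixes w0 :: "'k::field rat_closure"
  assumes "w0 \<noteq> 0"
  shows "\<exists>\<phi>. (\<forall>u v. \<phi> (u + v) = \<phi> u + \<phi> v) \<and> (\<forall>(s::'k) v. \<phi> (emb_const s * v) = s * \<phi> v) \<and> \<phi> w0 = 1"
proof -
  interpret vs: vector_space "\<lambda>s w. emb_const (s::'k) * w"
    by unfold_locales (simp_all add: emb_const_simps algebra_simps)
  have ind: "vs.independent {w0}" using assms by (simp add: vs.dependent_single)
  let ?B = "vs.extend_basis {w0}"
  have B: "vs.independent ?B" "vs.span ?B = UNIV" "w0 \<in> ?B"
    using vs.independent_extend_basis[OF ind] vs.span_extend_basis[OF ind] vs.extend_basis_superset[OF ind] by auto
  let ?\<phi> = "\<lambda>v. vs.representation ?B v w0"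
  have "?\<phi> (u + v) = ?\<phi> u + ?\<phi> v" for u v
    using vs.representation_add[OF B(1), of v u] B(2) by simp
  moreover have "?\<phi> (emb_const s * v) = s * ?\<phi> v" for s v
    using vs.representation_scale[OF B(1), of v s] B(2) by simp
  moreover have "?\<phi> w0 = 1"
    using vs.representation_basis[OF B(1,3)] by simp
  ultimately show ?thesis by (intro exI[of _ ?\<phi>] conjI allI)
qed

context artin_schreier_curve
begin

context
  fixes n :: nat assumes n: "CARD('k) = 2 ^ n"
begin

lemma n_pos: "n \<ge> 1"
proof (rule ccontr)
  assume "\<not> n \<ge> 1"
  then have "card (UNIV::'k set) = 1" using n by simp
  moreover have "card {0, 1 :: 'k} \<le> card (UNIV::'k set)" by (rule card_mono) auto
  ultimately show False by simp
qed

lemma is_subfield_range_const: "is_subfield (range (emb_const :: 'k \<Rightarrow> _))"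
  unfolding is_subfield_def
proof (intro conjI ballI)
  let ?k = "range (emb_const :: 'k \<Rightarrow> _)"
  show "0 \<in> ?k" "1 \<in> ?k" using rangeI[of emb_const 0] rangeI[of emb_const 1] by simp_all
  fix u v assume "u \<in> ?k" "v \<in> ?k"
  then obtain s t :: 'k where st: "u = emb_const s" "v = emb_const t" by blast
  show "u + v \<in> ?k" unfolding st emb_const_simps(1)[symmetric] by simp
  show "u * v \<in> ?k" unfolding st emb_const_simps(2)[symmetric] by simp
next
  fix u assume "u \<in> range (emb_const :: 'k \<Rightarrow> _)"
  then obtain s :: 'k where s: "u = emb_const s" by blast
  show "- u \<in> range (emb_const :: 'k \<Rightarrow> _)" unfolding s emb_const_minus[symmetric] by simp
  show "inverse u \<in> range (emb_const :: 'k \<Rightarrow> _)" unfolding s emb_const_inverse[symmetric] by simp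
qed

text \<open>Two Frobenius iterates of w coincide, and injectivity of Frobenius cancels the smaller
  one. Exponents are multiples of n so that the constants from k are fixed as well.\<close>

lemma const_closure_fixed:
  assumes "w \<in> (const_closure :: 'k rat_closure set)"
  shows "\<exists>m\<ge>1. w ^ 2 ^ (n * m) = w"
proof -
  obtain q :: "'k poly" where q: "q \<noteq> 0" "poly (map_poly emb_const q) w = 0"
    using assms unfolding const_closure_def by blast
  have fin: "finite (range (\<lambda>i. w ^ i))"
  proof (rule finite_powers[OF is_subfield_range_const])
    show "map_poly emb_const q \<noteq> 0" using q(1) by (simp add: map_poly_eq_0_iff)
    show "coeff (map_poly emb_const q) i \<in> range emb_const" for i by (simp add: coeff_map_poly)
  qed (use q in simp_all)
  have "range (\<lambda>i. w ^ 2 ^ (n * i)) \<subseteq> range (\<lambda>i. w ^ i)" by blast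
  then have "finite (range (\<lambda>i. w ^ 2 ^ (n * i)))" using fin by (rule finite_subset)
  then have "\<not> inj (\<lambda>i. w ^ 2 ^ (n * i))" using finite_imageD infinite_UNIV_nat by blast
  then obtain i j where "i \<noteq> j" "w ^ 2 ^ (n * i) = w ^ 2 ^ (n * j)" unfolding inj_def by blast
  then obtain i j where ij: "i < j" "w ^ 2 ^ (n * i) = w ^ 2 ^ (n * j)"
    by (metis linorder_neqE_nat)
  have "n * j = n * (j - i) + n * i" using ij(1) by (simp flip: distrib_left)
  then have "w ^ 2 ^ (n * j) = (w ^ 2 ^ (n * (j - i))) ^ 2 ^ (n * i)" by (simp only: power_add power_mult)
  then have "w ^ 2 ^ (n * (j - i)) = w" using ij(2) power_2pow_eq_iff[OF two_ac] by metis
  then show ?thesis using ij(1) by (intro exI[of _ "j - i"]) simp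
qed

lemma finite_const_closure_fixed:
  assumes "finite C" "C \<subseteq> (const_closure :: 'k rat_closure set)"
  shows "\<exists>m\<ge>1. \<forall>w\<in>C. w ^ 2 ^ (n * m) = w"
  using assms
proof (induction C)
  case empty
  show ?case by (intro exI[of _ 1]) simp
next
  case (insert v C)
  then obtain m where m: "m \<ge> 1" "\<forall>w\<in>C. w ^ 2 ^ (n * m) = w" by blast
  obtain l where l: "l \<ge> 1" "v ^ 2 ^ (n * l) = v" using const_closure_fixed insert.prems by blast
  have "w ^ 2 ^ (n * (m * l)) = w" if "w \<in> insert v C" for w
  proof (cases "w = v")
    case True
    have "n * (m * l) = (n * l) * m" by simp
    then show ?thesis using fixed_power_mult[OF l(2), of m] True by (simp only:)
  next
    case False
    then have "w ^ 2 ^ (n * m) = w" using m(2) that by blast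
    from fixed_power_mult[OF this, of l] show ?thesis by (simp only: mult.assoc)
  qed
  moreover have "m * l \<ge> 1" using m l by simp
  ultimately show ?case by blast
qed

context
  fixes M :: nat assumes M: "M \<ge> 1"
begin

lemma subfield_fixed: "is_subfield (fixed_field M :: 'k rat_closure set)"
  and finite_fixed: "finite (fixed_field M :: 'k rat_closure set)"
proof -
  show "finite (fixed_field M :: 'k rat_closure set)"
    unfolding fixed_field_def by (rule card_fixed_power_le(1)[OF M])
  show "is_subfield (fixed_field M :: 'k rat_closure set)"
    unfolding is_subfield_def fixed_field_def
    by (auto simp: power_2pow_add[OF two_ac] power_mult_distrib power_inverse minus_char2[OF two_ac] zero_power)
qed

text \<open>An element algebraic over a finite field has finitely many powers, but the powers of x
  are told apart by their degrees.\<close>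

lemma x_transcendental:
  assumes "\<And>i. coeff p i \<in> (fixed_field M)" "poly p x = 0"
  shows "p = 0"
proof (rule ccontr)
  assume "p \<noteq> 0"
  then have "finite (range (\<lambda>i. x ^ i))"
    by (rule finite_powers[OF subfield_fixed finite_fixed]) (use assms in simp_all)
  moreover have "inj (\<lambda>i. x ^ i)"
  proof (rule injI)
    fix i j assume "x ^ i = x ^ j"
    then have "e ([:0, 1:] ^ i) = e ([:0, 1:] ^ j)" by simp
    then have "([:0, 1:] :: 'k poly) ^ i = [:0, 1:] ^ j" by (simp only: emb_poly_eq_iff)
    then have "degree (([:0, 1:] :: 'k poly) ^ i) = degree (([:0, 1:] :: 'k poly) ^ j)" by (simp only:)
    then show "i = j" by (simp add: degree_power_eq)
  qed
  ultimately show False using finite_imageD infinite_UNIV_nat by blast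
qed

text \<open>Multiplying by the conjugate gives a norm form that vanishes at x, hence vanishes as a
  polynomial; by parity of degrees this is impossible over any field.\<close>

lemma zeta_transcendental:
  assumes const: "\<And>s::'k. emb_const s \<in> (fixed_field M)"
    and P: "\<And>i. coeff P i \<in> (fixed_field M)" and R: "\<And>i. coeff R i \<in> (fixed_field M)"
    and 0: "poly P x + poly R x * \<zeta> = 0"
  shows "P = 0 \<and> R = 0"
proof (rule ccontr)
  assume n0: "\<not> (P = 0 \<and> R = 0)"
  let ?f = "map_poly emb_const f"
  have df: "degree ?f = 2 * g + 1" using deg_f by (subst degree_map_poly) simp_all
  let ?N = "P\<^sup>2 - P * R - R\<^sup>2 * ?f"
  have ev: "poly ?N x = (poly P x + poly R x * \<zeta>) * (poly P x - poly R x - poly R x * \<zeta>)"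
  proof -
    have "poly ?N x = poly P x * poly P x - poly P x * poly R x - poly R x * poly R x * (\<zeta> * \<zeta> + \<zeta>)"
      by (simp add: zeta_sq power2_eq_square emb_poly_eval[symmetric])
    then show ?thesis by (simp add: algebra_simps)
  qed
  have mult: "coeff (p * q) i \<in> (fixed_field M)"
    if "\<And>i. coeff p i \<in> (fixed_field M)" "\<And>i. coeff q i \<in> (fixed_field M)" for p q :: "'k rat_closure poly" and i
    unfolding coeff_mult
    by (intro is_subfield_sum[OF subfield_fixed] is_subfield_mult[OF subfield_fixed] that)
  have "coeff ?f i \<in> (fixed_field M)" for i using const by (simp add: coeff_map_poly)
  then have "coeff ?N i \<in> (fixed_field M)" for i
    unfolding coeff_diff power2_eq_square
    by (intro is_subfield_diff[OF subfield_fixed] mult P R)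
  then have "?N = 0" by (rule x_transcendental) (simp only: ev 0 mult_zero_left)
  moreover have "?N \<noteq> 0" by (rule quadratic_form_degree(1)[OF df]) (use n0 in blast)
  ultimately show False by blast
qed

end

lemma common_denominator:
  assumes "finite S" "S \<subseteq> K"
  shows "\<exists>D. D \<noteq> 0 \<and> (\<forall>b\<in>S. b * e D \<in> affine_ring)"
  using assms
proof (induction S)
  case empty
  show ?case by (intro exI[of _ 1]) simp
next
  case (insert b S)
  then obtain D where D: "D \<noteq> 0" "\<forall>b\<in>S. b * e D \<in> affine_ring" by blast
  have "b \<in> K" using insert.prems by blast
  then obtain A B C where b: "b = lin A B / e C" "C \<noteq> 0" unfolding K_eq by blast
  have "b * e C = lin A B" using b by simp
  then have "b * e (D * C) = lin A B * e D" by (simp add: mult_ac)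
  then have "b * e (D * C) \<in> affine_ring" using affine_mult[OF lin_affine e_affine] by metis
  moreover have "b' * e (D * C) \<in> affine_ring" if "b' \<in> S" for b'
    using affine_mult[OF bspec[OF D(2) that] e_affine[of C]] by (simp add: mult.assoc)
  moreover have "D * C \<noteq> 0" using D b by simp
  ultimately show ?case by blast
qed

text \<open>After clearing denominators a relation over the algebraic constants is one in 1 and
  \<zeta> with polynomial coefficients in x, so it splits into relations among the
  \<open>c b\<close> with coefficients in k. A k-linear functional with value 1 at
  \<open>c b0\<close> carries these to k, which contradicts independence over k.\<close>

lemma geometrically_connected: "geometrically_connected K"
  unfolding geometrically_connected_def
proof (intro allI impI)
  fix S assume S: "finite S" "S \<subseteq> K" and ind: "lin_indep_over (range (emb_const :: 'k \<Rightarrow> _)) S"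
  show "lin_indep_over const_closure S"
    unfolding lin_indep_over_def
  proof (intro allI impI, rule ccontr)
    fix c assume c: "c ` S \<subseteq> const_closure" and 0: "(\<Sum>b\<in>S. c b * b) = 0" and "\<not> (\<forall>b\<in>S. c b = 0)"
    then obtain b0 where b0: "b0 \<in> S" "c b0 \<noteq> 0" by blast
    obtain m where m: "m \<ge> 1" "\<forall>w\<in>c ` S. w ^ 2 ^ (n * m) = w"
      using finite_const_closure_fixed[OF finite_imageI[OF S(1)] c] by blast
    define M where "M = n * m"
    have M: "M \<ge> 1" using n_pos m(1) by (simp add: M_def)
    have constF: "emb_const s \<in> fixed_field M" for s :: 'k
    proof -
      have "s ^ 2 ^ n = s" using finite_field_power_card[of s] by (simp only: n)
      from fixed_power_mult[OF this, of m] have "s ^ 2 ^ M = s" by (simp only: M_def)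
      then show ?thesis by (simp add: fixed_field_def emb_const_power[symmetric])
    qed
    have cF: "c b \<in> fixed_field M" if "b \<in> S" for b
      using m(2) that by (simp add: fixed_field_def M_def)
    obtain D where D: "D \<noteq> 0" "\<forall>b\<in>S. b * e D \<in> affine_ring" using common_denominator[OF S] by blast
    have "\<forall>b\<in>S. \<exists>AB. b * e D = lin (fst AB) (snd AB)"
    proof
      fix b assume "b \<in> S"
      then have "b * e D \<in> affine_ring" using D(2) by blast
      then obtain A B where "b * e D = lin A B" by (elim affineE)
      then show "\<exists>AB. b * e D = lin (fst AB) (snd AB)" by (intro exI[of _ "(A, B)"]) simp
    qed
    from bchoice[OF this] obtain AB where AB: "\<And>b. b \<in> S \<Longrightarrow> b * e D = lin (fst (AB b)) (snd (AB b))" by blast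
    define A where "A b = fst (AB b)" for b
    define B where "B b = snd (AB b)" for b
    have AB: "b * e D = lin (A b) (B b)" if "b \<in> S" for b using AB[OF that] by (simp only: A_def B_def)
    \<comment> \<open>The relation as a formal polynomial; once it is zero, each of its coefficients
      gives a separate relation among the \<open>c b\<close>.\<close>
    define comb where "comb Z = (\<Sum>b\<in>S. smult (c b) (map_poly emb_const (Z b)))" for Z :: "_ \<Rightarrow> 'k poly"
    have comb_coeff: "coeff (comb Z) i = (\<Sum>b\<in>S. c b * emb_const (coeff (Z b) i))" for Z i
      by (simp add: comb_def coeff_sum coeff_map_poly)
    have comb_F: "coeff (comb Z) i \<in> fixed_field M" for Z i
      unfolding comb_coeff
      by (intro is_subfield_sum[OF subfield_fixed[OF M]] is_subfield_mult[OF subfield_fixed[OF M]] cF constF)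
    have comb_ev: "poly (comb Z) x = (\<Sum>b\<in>S. c b * e (Z b))" for Z
      by (simp add: comb_def poly_sum emb_poly_eval[symmetric])
    have "poly (comb A) x + poly (comb B) x * \<zeta> = (\<Sum>b\<in>S. c b * lin (A b) (B b))"
      unfolding comb_ev by (simp add: sum_distrib_right lin_def distrib_left mult.assoc sum.distrib)
    also have "\<dots> = (\<Sum>b\<in>S. c b * b) * e D"
      unfolding sum_distrib_right by (rule sum.cong[OF refl]) (simp only: AB[symmetric] mult.assoc)
    finally have "poly (comb A) x + poly (comb B) x * \<zeta> = 0" unfolding 0 by simp
    from zeta_transcendental[OF M constF comb_F comb_F this]
    have comb0: "comb A = 0" "comb B = 0" by blast+
    obtain \<phi> where add: "\<And>u v. \<phi> (u + v) = \<phi> u + \<phi> v"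
      and scale: "\<And>(s::'k) v. \<phi> (emb_const s * v) = s * \<phi> v" and \<phi>1: "\<phi> (c b0) = 1"
      using ex_const_functional[OF b0(2)] by blast
    have \<phi>0: "\<phi> 0 = 0" using scale[of 0 0] by simp
    have \<phi>sum: "\<phi> (\<Sum>b\<in>S'. u b) = (\<Sum>b\<in>S'. \<phi> (u b))" for S' and u :: "_ \<Rightarrow> 'k rat_closure"
      by (induction S' rule: infinite_finite_induct) (simp_all add: add \<phi>0)
    have rel: "(\<Sum>b\<in>S. smult (\<phi> (c b)) (Z b)) = 0" if "comb Z = 0" for Z
    proof (rule poly_eqI)
      fix i
      have "0 = \<phi> (coeff (comb Z) i)" by (simp add: that \<phi>0)
      also have "\<dots> = (\<Sum>b\<in>S. \<phi> (emb_const (coeff (Z b) i) * c b))"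
        unfolding comb_coeff \<phi>sum by (simp add: mult.commute)
      also have "\<dots> = coeff (\<Sum>b\<in>S. smult (\<phi> (c b)) (Z b)) i"
        unfolding scale by (simp add: coeff_sum mult.commute)
      finally show "coeff (\<Sum>b\<in>S. smult (\<phi> (c b)) (Z b)) i = coeff 0 i" by simp
    qed
    have relE: "(\<Sum>b\<in>S. emb_const (\<phi> (c b)) * e (Z b)) = 0" if "comb Z = 0" for Z
      using arg_cong[OF rel[OF that], of e] by (simp add: emb_poly_sum emb_poly_smult)
    have "(\<Sum>b\<in>S. emb_const (\<phi> (c b)) * b) * e D = (\<Sum>b\<in>S. emb_const (\<phi> (c b)) * lin (A b) (B b))"
      unfolding sum_distrib_right by (rule sum.cong[OF refl]) (simp only: AB[symmetric] mult.assoc)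
    also have "\<dots> = (\<Sum>b\<in>S. emb_const (\<phi> (c b)) * e (A b)) + (\<Sum>b\<in>S. emb_const (\<phi> (c b)) * e (B b)) * \<zeta>"
      by (simp add: sum_distrib_right lin_def distrib_left mult.assoc sum.distrib)
    also have "\<dots> = 0" using relE[OF comb0(1)] relE[OF comb0(2)] by simp
    finally have "(\<Sum>b\<in>S. emb_const (\<phi> (c b)) * b) = 0" using D(1) by simp
    moreover have "(\<lambda>b. emb_const (\<phi> (c b))) ` S \<subseteq> range emb_const" by blast
    ultimately have "emb_const (\<phi> (c b0)) = 0"
      using ind b0(1) unfolding lin_indep_over_def by blast
    then show False using \<phi>1 by simp
  qed
qed

end
end

subsection \<open>Maximality\<close>

text \<open>The polynomial is monic, so a proper factor is linear in z and has a root r in k[x]; but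
  r^2 + r - f is the norm form at (r, -1), which is not zero.\<close>

lemma irreducible_artin_schreier:
  fixes f :: "'a::field poly"
  assumes deg_f: "degree f = 2 * g + 1"
  shows "irreducible [:- f, 1, 1:]"
proof (rule irreducibleI)
  show "[:- f, 1, 1:] \<noteq> 0" by simp
  show "\<not> is_unit [:- f, 1, 1:]"
  proof
    assume "is_unit [:- f, 1, 1:]"
    then have "degree [:- f, 1, 1:] \<le> degree (1 :: 'a poly poly)" by (rule dvd_imp_degree_le) simp
    then show False by simp
  qed
  fix U V assume UV: "[:- f, 1, 1:] = U * V"
  have nz: "U \<noteq> 0" "V \<noteq> 0" using UV by auto
  have deg: "degree U + degree V = 2" using arg_cong[OF UV, of degree] nz by (simp add: degree_mult_eq)
  have lead: "lead_coeff U * lead_coeff V = 1"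
    using arg_cong[OF UV, of lead_coeff] by (simp add: lead_coeff_mult)
  have unit: "is_unit W" if "degree W = 0" "is_unit (lead_coeff W)" for W :: "'a poly poly"
    using that by (metis degree_eq_zeroE is_unit_const_poly_iff lead_coeff_pCons(2))
  consider "degree U = 0" | "degree V = 0" | "degree U = 1" using deg by linarith
  then show "is_unit U \<or> is_unit V"
  proof cases
    case 1
    then show ?thesis using unit[of U] lead dvdI[of 1 "lead_coeff U" "lead_coeff V"] by simp
  next
    case 2
    then show ?thesis using unit[of V] lead dvdI[of 1 "lead_coeff V" "lead_coeff U"] by (simp add: mult.commute)
  next
    case 3
    \<comment> \<open>The leading coefficient of V is the inverse of that of U, so the linear factor
      has its root in k[x].\<close>
    define r where "r = - (coeff U 0 * lead_coeff V)"
    have "poly U r = coeff U 0 + r * lead_coeff U"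
      using 3 by (simp add: poly_altdef mult.commute)
    also have "\<dots> = coeff U 0 - coeff U 0 * (lead_coeff U * lead_coeff V)"
      by (simp add: r_def mult_ac)
    also have "\<dots> = 0" by (simp only: lead) simp
    finally have "poly [:- f, 1, 1:] r = 0" unfolding UV by simp
    then have "r\<^sup>2 - r * (- 1) - (- 1)\<^sup>2 * f = 0" by (simp add: power2_eq_square algebra_simps)
    then show ?thesis using quadratic_form_degree(1)[OF deg_f, of r "- 1"] by simp
  qed
qed

theorem corollary6p4:
  fixes f0 p :: nat and Fp :: "'k::{field,finite} set" and a :: 'k
  assumes "f0 \<ge> 1" and "p = 2 ^ f0"
    and "CARD('k) = p ^ 4"
    and "is_subfield Fp" and "card Fp = p"
    and "a \<in> Fp" and "a \<noteq> 0" and "trace_to_F2 f0 a = 0"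
  shows "(\<exists>Q. is_Q_a f0 Fp a Q) \<and>
         (odd f0 \<longrightarrow> (\<forall>Q. is_Q_a f0 Fp a Q \<longrightarrow>
            irreducible (artin_schreier_eq Q) \<and>
            maximal_curve p (curve_function_field (artin_schreier_eq Q))))"
proof -
  interpret trace_zero_setting f0 p Fp a by standard (rule assms)+
  have "irreducible (artin_schreier_eq Q) \<and>
      maximal_curve p (curve_function_field (artin_schreier_eq Q))"
    if odd: "odd f0" and Q: "is_Q_a f0 Fp a Q" for Q
  proof -
    define g where "g = (2::nat) ^ (f0 - 2)"
    define f where "f = [:0, 1:] * Q"
    \<comment> \<open>This excludes \<open>f0 = 2\<close>, where g would be 1 and odd.\<close>
    have f0_3: "f0 \<ge> 3" using f0_ge_2 odd by (metis Suc_leI eval_nat_numeral(3) even_numeral le_neq_implies_less)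
    have f0_eqs: "f0 - 1 = Suc (f0 - 2)" "f0 = Suc (Suc (f0 - 2))" using f0_3 by simp_all
    have g2: "2 ^ (f0 - 1) = 2 * g" unfolding f0_eqs(1) g_def by simp
    have "(2::nat) ^ f0 = 2 ^ Suc (Suc (f0 - 2))" using f0_eqs(2) by (rule arg_cong)
    then have p4: "p = 4 * g" by (simp add: assms(2) g_def)
    have degQ: "degree Q = 2 * g" using degree_Q[OF Q] g2 by simp
    have g1: "g \<ge> 1" by (simp add: g_def)
    have Qnz: "Q \<noteq> 0" using degQ g1 by auto
    have deg_f: "degree f = 2 * g + 1" unfolding f_def using Qnz by (simp add: degQ)
    have eq: "artin_schreier_eq Q = [:- f, 1, 1:]" by (simp add: artin_schreier_eq_def f_def)
    define \<zeta> where "\<zeta> = (SOME \<zeta>. poly (map_poly emb_poly (artin_schreier_eq Q)) \<zeta> = 0)"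
    have pol: "map_poly emb_poly (artin_schreier_eq Q) = [:- emb_poly f, 1, 1:]"
      unfolding eq by (simp add: map_poly_pCons)
    have "\<exists>\<zeta>. poly (map_poly emb_poly (artin_schreier_eq Q)) \<zeta> = 0"
      by (rule alg_closed_imp_poly_has_root) (simp add: pol)
    then have "poly (map_poly emb_poly (artin_schreier_eq Q)) \<zeta> = 0"
      unfolding \<zeta>_def by (rule someI_ex)
    then have root: "\<zeta>\<^sup>2 + \<zeta> = emb_poly f"
      unfolding pol by (simp add: power2_eq_square algebra_simps)
    have "f0 - 2 > 0" using f0_3 by simp
    then have "even g" by (simp add: g_def)
    interpret C: artin_schreier_curve f \<zeta> g
      by standard (fact two deg_f root g1 \<open>even g\<close>)+
    have K: "curve_function_field (artin_schreier_eq Q) = C.K"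
      unfolding curve_function_field_def Let_def C.K_def \<zeta>_def[symmetric] ..
    have ev: "poly f c = c * poly Q c" for c by (simp add: f_def)
    have "2 * card {(c, d). d\<^sup>2 + d = poly f c} = 2 * p ^ 4 + p ^ 3"
      unfolding ev by (rule card_affine_points[OF Q odd])
    moreover have "p ^ 3 = 2 * (2 * g * p\<^sup>2)" unfolding p4 by (simp add: power2_eq_square power3_eq_cube)
    ultimately have "card (rational_points C.K) = p ^ 4 + 1 + 2 * g * p\<^sup>2"
      unfolding C.card_rational_points by linarith
    then have "maximal_curve p C.K"
      unfolding maximal_curve_def
      using assms(3) C.geometrically_connected[OF card_k'] C.has_genus by blast
    then show ?thesis unfolding K using irreducible_artin_schreier[OF deg_f] by (simp only: eq)
  qed
  then show ?thesis using ex_Q_a by blast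
qed

end
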